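(* Let $\alpha\in(\frac34,1)$ and let $V(z)=\sum_{j=0}^ma_jz^{2j}$ be a real even polynomial of degree $2m\ge4$ with $a_m>0$ and $\overline a_1=0$. If there exists $\theta\in\mathbb R$ such that $$\sum_{j=2}^m\overline a_j\,\theta^{2(j-2)}<0,$$ then there exists $c>0$ such that $\log\mathcal Z_N>cN^{4(1-\alpha)}$ for all $N\in\mathbb N=\{1,2,\dots\}$. As a consequence, the densities $\frac{d\overline\nu_N}{d\mu}=\mathcal Z_N^{-1}e^{-\int_{\mathbb T^2}\widetilde V_N(\Pi_N\phi)dx}$ do not converge in $L^1(\mu)$ as $N\to\infty$.
   Context: $\mathbb T^2=(\mathbb R/2\pi\mathbb Z)^2$; $\Pi_N$ is the Fourier projection onto $\{k\in\mathbb Z^2:|k|\le N\}$. $\mu$ is the law on $\mathcal D'(\mathbb T^2)$ of the real Gaussian field $\phi=\frac1{2\pi}\sum_{k\in\mathbb Z^2}\frac{g_k}{\sqrt{1+|k|^{2\alpha}}}e^{ik\cdot x}$, with $(g_k)$ centered complex Gaussians, $g_{-k}=\overline{g_k}$, $\mathbb E|g_k|^2=1$, $\mathbb E(g_k^2)=0$ for $k\neq 0$, $g_0$ real, otherwise independent. $\sigma^2:=\frac1{4\pi^2}\int_{|\xi|\le1}|\xi|^{-2\alpha}d\xi$, $\widetilde\sigma_N^2:=\frac1{4\pi^2}\sum_{|k|\le N}\frac1{1+|k|^{2\alpha}}$, $\sigma_N^2:=N^{-2(1-\alpha)}\widetilde\sigma_N^2$. $H_k(\cdot;\tau^2)$ is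 the Hermite polynomial given by $e^{tx-\frac12\tau^2t^2}=\sum_k\frac{t^k}{k!}H_k(x;\tau^2)$. $\overline a_j:=\frac1{(2j)!}\mathbb E[V^{(2j)}(\mathcal N(0,\sigma^2))]$ and $\overline a_{j,N}:=\frac1{(2j)!}\mathbb E[V^{(2j)}(\mathcal N(0,\sigma_N^2))]$. The renormalized potential (chaos components of order $0$ and $2$ removed) is $V_N(\varphi):=\sum_{j=2}^m\overline a_{j,N}N^{-(2j-4)(1-\alpha)}H_{2j}(\varphi;\widetilde\sigma_N^2)$; $\widetilde V_N(\varphi):=V_N(\varphi)-\frac12(\varphi^2-\widetilde\sigma_N^2)$; $\mathcal Z_N:=\mathbb E^\mu\big[e^{-\int_{\mathbb T^2}\widetilde V_N(\Pi_N\phi)dx}\big]$; $\overline\nu_N(d\phi):=\mathcal Z_N^{-1}e^{-\int_{\mathbb T^2}\widetilde V_N(\Pi_N\phi)dx}\mu(d\phi)$. *)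

theory Defs
  imports "HOL-Probability.Probability" "HOL-Computational_Algebra.Polynomial"
begin

section \<open>Distributions on the two-dimensional torus\<close>

text \<open>Functions on the torus are functions on the plane that are periodic with period \<open>2 * pi\<close>
  in both variables; integrals over the torus are Lebesgue integrals over one period cell.
  The norm on \<^typ>\<open>real \<times> real\<close> is the Euclidean one.\<close>

definition torus :: "(real \<times> real) set" where
  "torus = {0..2 * pi} \<times> {0..2 * pi}"

definition freq :: "int \<times> int \<Rightarrow> real \<times> real" where
  "freq k = (of_int (fst k), of_int (snd k))"

definition dir_deriv :: "real \<times> real \<Rightarrow> (real \<times> real \<Rightarrow> real) \<Rightarrow> real \<times> real \<Rightarrow> real" where
  "dir_deriv v f = (\<lambda>x. frechet_derivative f (at x) v)"

definition iter_deriv :: "(real \<times> real) list \<Rightarrow> (real \<times> real \<Rightarrow> real) \<Rightarrow> real \<times> real \<Rightarrow> real" where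
  "iter_deriv vs f = foldr dir_deriv vs f"

definition smooth :: "(real \<times> real \<Rightarrow> real) \<Rightarrow> bool" where
  "smooth f \<longleftrightarrow> (\<forall>vs \<in> lists Basis. iter_deriv vs f differentiable_on UNIV)"

definition test_functions :: "(real \<times> real \<Rightarrow> real) set" where
  "test_functions =
     {f. smooth f \<and> (\<forall>x y. f (x + 2 * pi, y) = f (x, y) \<and> f (x, y + 2 * pi) = f (x, y))}"

definition Cn_norm :: "nat \<Rightarrow> (real \<times> real \<Rightarrow> real) \<Rightarrow> real" where
  "Cn_norm n f = (SUP vs \<in> {vs \<in> lists Basis. length vs \<le> n}. SUP x. \<bar>iter_deriv vs f x\<bar>)"

text \<open>Real distributions: the linear functionals on the real test functions that are continuous
  for the Frechet topology given by the norms \<^const>\<open>Cn_norm\<close>. The value of such a functional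
  outside the test functions is fixed to be \<^const>\<open>undefined\<close>.\<close>

definition distributions :: "((real \<times> real \<Rightarrow> real) \<Rightarrow> real) set" where
  "distributions = {u \<in> extensional test_functions.
     (\<forall>f \<in> test_functions. \<forall>h \<in> test_functions. u (\<lambda>x. f x + h x) = u f + u h) \<and>
     (\<forall>c. \<forall>f \<in> test_functions. u (\<lambda>x. c * f x) = c * u f) \<and>
     (\<exists>C n. \<forall>f \<in> test_functions. \<bar>u f\<bar> \<le> C * Cn_norm n f)}"

text \<open>The measurable space of distributions. Only the sets matter: this is the smallest
  sigma-algebra that makes all the evaluations at test functions measurable (it is also the Borel
  sigma-algebra of the space of distributions).\<close>

definition distribution_space :: "((real \<times> real \<Rightarrow> real) \<Rightarrow> real) measure" where
  "distribution_space = restrict_space (\<Pi>\<^sub>M f \<in> test_functions. borel) distributions"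

text \<open>The pairing of the distribution \<open>u\<close> with \<open>exp (- \<i> k \<bullet> x)\<close>, divided by
  the area \<open>4 * pi\<^sup>2\<close>.\<close>

definition fourier_coeff :: "((real \<times> real \<Rightarrow> real) \<Rightarrow> real) \<Rightarrow> int \<times> int \<Rightarrow> complex" where
  "fourier_coeff u k = 1 / (4 * pi\<^sup>2) *
     (complex_of_real (u (\<lambda>x. cos (freq k \<bullet> x))) - \<i> * complex_of_real (u (\<lambda>x. sin (freq k \<bullet> x))))"

definition modes :: "nat \<Rightarrow> (int \<times> int) set" where
  "modes N = {k. norm (freq k) \<le> real N}"

text \<open>The sum is real because \<open>u\<close> is real and \<^term>\<open>modes N\<close> is symmetric.\<close>

definition fourier_proj :: "nat \<Rightarrow> ((real \<times> real \<Rightarrow> real) \<Rightarrow> real) \<Rightarrow> real \<times> real \<Rightarrow> real" where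
  "fourier_proj N u x = Re (\<Sum>k \<in> modes N. fourier_coeff u k * cis (freq k \<bullet> x))"


section \<open>The Gaussian field\<close>

text \<open>Variance zero is allowed.\<close>

definition centered_gaussian :: "'w measure \<Rightarrow> ('w \<Rightarrow> real) \<Rightarrow> bool" where
  "centered_gaussian P X \<longleftrightarrow> X \<in> borel_measurable P \<and>
     (\<exists>s\<ge>0. distr P borel X =
        (if s = 0 then return borel 0 else density lborel (\<lambda>x. ennreal (normal_density 0 s x))))"

text \<open>Real and imaginary part are jointly Gaussian.\<close>

definition centered_complex_gaussian :: "'w measure \<Rightarrow> ('w \<Rightarrow> complex) \<Rightarrow> bool" where
  "centered_complex_gaussian P X \<longleftrightarrow> (\<forall>w. centered_gaussian P (\<lambda>\<omega>. w \<bullet> X \<omega>))"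

text \<open>The last clause is the independence that is compatible with \<open>g (- k) = cnj (g k)\<close>: a
  subfamily is independent if it does not contain both \<open>k\<close> and \<open>- k\<close> for any \<open>k \<noteq> 0\<close>.\<close>

definition gaussian_coefficients :: "'w measure \<Rightarrow> (int \<times> int \<Rightarrow> 'w \<Rightarrow> complex) \<Rightarrow> bool" where
  "gaussian_coefficients P g \<longleftrightarrow>
     (\<forall>k. g k \<in> borel_measurable P) \<and>
     (\<forall>k. centered_complex_gaussian P (g k)) \<and>
     (\<forall>k. AE \<omega> in P. g (- k) \<omega> = cnj (g k \<omega>)) \<and>
     (\<forall>k. (LINT \<omega>|P. (cmod (g k \<omega>))\<^sup>2) = 1) \<and>
     (\<forall>k. k \<noteq> 0 \<longrightarrow> (LINT \<omega>|P. (g k \<omega>)\<^sup>2) = 0) \<and>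
     (AE \<omega> in P. g 0 \<omega> \<in> \<real>) \<and>
     (\<forall>K. (\<forall>k \<in> K. k \<noteq> 0 \<longrightarrow> - k \<notin> K) \<longrightarrow> prob_space.indep_vars P (\<lambda>_. borel) g K)"

text \<open>\<open>\<Phi>\<close> is a random distribution given almost surely by the Fourier series
  \<open>1 / (2 * pi) * (\<Sum>k. g k / sqrt (1 + \<bar>k\<bar> powr (2 * \<alpha>)) * exp (\<i> k \<bullet> x))\<close>, which converges in the
  sense of distributions. Note that \<open>0 powr (2 * \<alpha>) = 0\<close>.\<close>

definition is_gaussian_field ::
  "real \<Rightarrow> 'w measure \<Rightarrow> (int \<times> int \<Rightarrow> 'w \<Rightarrow> complex) \<Rightarrow>
     ('w \<Rightarrow> (real \<times> real \<Rightarrow> real) \<Rightarrow> real) \<Rightarrow> bool" where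
  "is_gaussian_field \<alpha> P g \<Phi> \<longleftrightarrow>
     \<Phi> \<in> measurable P distribution_space \<and>
     (AE \<omega> in P. \<forall>f \<in> test_functions.
        ((\<lambda>k. 1 / (2 * pi) * (g k \<omega> / complex_of_real (sqrt (1 + norm (freq k) powr (2 * \<alpha>)))) *
              (LINT x:torus|lborel. cis (freq k \<bullet> x) * complex_of_real (f x)))
          has_sum complex_of_real (\<Phi> \<omega> f)) UNIV)"


section \<open>The renormalized potential and the measures\<close>

definition sigma_sq :: "real \<Rightarrow> real" where
  "sigma_sq \<alpha> = 1 / (4 * pi\<^sup>2) *
     (LINT \<xi>:cball 0 1|(lborel :: (real \<times> real) measure). norm \<xi> powr (- 2 * \<alpha>))"

definition sigma_tilde_sq :: "real \<Rightarrow> nat \<Rightarrow> real" where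
  "sigma_tilde_sq \<alpha> N = 1 / (4 * pi\<^sup>2) * (\<Sum>k \<in> modes N. 1 / (1 + norm (freq k) powr (2 * \<alpha>)))"

definition sigma_N_sq :: "real \<Rightarrow> nat \<Rightarrow> real" where
  "sigma_N_sq \<alpha> N = real N powr (- 2 * (1 - \<alpha>)) * sigma_tilde_sq \<alpha> N"

text \<open>\<open>hermite k x v\<close> is the Hermite polynomial of degree \<open>k\<close> and variance \<open>v\<close>: \<open>k!\<close> times the
  Taylor coefficient of \<open>t ^ k\<close> in the generating function.\<close>

definition hermite :: "nat \<Rightarrow> real \<Rightarrow> real \<Rightarrow> real" where
  "hermite k x v = (deriv ^^ k) (\<lambda>t. exp (t * x - v * t\<^sup>2 / 2)) 0"

text \<open>Expectation under the normal law with mean \<open>0\<close> and variance \<open>v > 0\<close>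
  (\<^const>\<open>normal_density\<close> takes the standard deviation).\<close>

definition gauss_mean :: "real \<Rightarrow> (real \<Rightarrow> real) \<Rightarrow> real" where
  "gauss_mean v F = (LINT z|density lborel (\<lambda>z. ennreal (normal_density 0 (sqrt v) z)). F z)"

definition abar :: "real \<Rightarrow> real poly \<Rightarrow> nat \<Rightarrow> real" where
  "abar \<alpha> V j = 1 / fact (2 * j) * gauss_mean (sigma_sq \<alpha>) (poly ((pderiv ^^ (2 * j)) V))"

definition abar_N :: "real \<Rightarrow> real poly \<Rightarrow> nat \<Rightarrow> nat \<Rightarrow> real" where
  "abar_N \<alpha> V N j = 1 / fact (2 * j) * gauss_mean (sigma_N_sq \<alpha> N) (poly ((pderiv ^^ (2 * j)) V))"

definition V_ren :: "real \<Rightarrow> real poly \<Rightarrow> nat \<Rightarrow> nat \<Rightarrow> real \<Rightarrow> real" where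
  "V_ren \<alpha> V m N y = (\<Sum>j=2..m. abar_N \<alpha> V N j * real N powr (- (2 * real j - 4) * (1 - \<alpha>)) *
                               hermite (2 * j) y (sigma_tilde_sq \<alpha> N))"

definition V_tilde :: "real \<Rightarrow> real poly \<Rightarrow> nat \<Rightarrow> nat \<Rightarrow> real \<Rightarrow> real" where
  "V_tilde \<alpha> V m N y = V_ren \<alpha> V m N y - 1 / 2 * (y\<^sup>2 - sigma_tilde_sq \<alpha> N)"

definition gibbs_weight ::
  "real \<Rightarrow> real poly \<Rightarrow> nat \<Rightarrow> nat \<Rightarrow> ((real \<times> real \<Rightarrow> real) \<Rightarrow> real) \<Rightarrow> real" where
  "gibbs_weight \<alpha> V m N u = exp (- (LINT x:torus|lborel. V_tilde \<alpha> V m N (fourier_proj N u x)))"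

definition partition_fn ::
  "real \<Rightarrow> real poly \<Rightarrow> nat \<Rightarrow> ((real \<times> real \<Rightarrow> real) \<Rightarrow> real) measure \<Rightarrow> nat \<Rightarrow> real" where
  "partition_fn \<alpha> V m \<mu> N = (LINT u|\<mu>. gibbs_weight \<alpha> V m N u)"

definition gibbs_density ::
  "real \<Rightarrow> real poly \<Rightarrow> nat \<Rightarrow> ((real \<times> real \<Rightarrow> real) \<Rightarrow> real) measure \<Rightarrow> nat \<Rightarrow>
     ((real \<times> real \<Rightarrow> real) \<Rightarrow> real) \<Rightarrow> real" where
  "gibbs_density \<alpha> V m \<mu> N u = inverse (partition_fn \<alpha> V m \<mu> N) * gibbs_weight \<alpha> V m N u"

definition gibbs_measure ::
  "real \<Rightarrow> real poly \<Rightarrow> nat \<Rightarrow> ((real \<times> real \<Rightarrow> real) \<Rightarrow> real) measure \<Rightarrow> nat \<Rightarrow>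
     ((real \<times> real \<Rightarrow> real) \<Rightarrow> real) measure" where
  "gibbs_measure \<alpha> V m \<mu> N = density \<mu> (\<lambda>u. ennreal (gibbs_density \<alpha> V m \<mu> N u))"

definition converges_in_L1 :: "'b measure \<Rightarrow> (nat \<Rightarrow> 'b \<Rightarrow> real) \<Rightarrow> bool" where
  "converges_in_L1 M F \<longleftrightarrow>
     (\<exists>f. integrable M f \<and> (\<lambda>n. \<integral>\<^sup>+ u. ennreal \<bar>F n u - f u\<bar> \<partial>M) \<longlonglongrightarrow> 0)"

end

theory Submission
  imports Defs
begin

text \<open>Shift the field by a constant \<open>h\<close>, i.e. tilt the law of the zero mode, and apply Jensen's inequality.
  Since \<open>\<E> H\<^sub>k (\<phi> + h) = h ^ k\<close>, and since the cost of the shift cancels the term \<open>- h\<^sup>2 / 2\<close> of the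
  potential, this gives
  \<open>ln Z\<^sub>N \<ge> - 4 \<pi>\<^sup>2 (\<Sum>j=2..m. a\<^bsub>j,N\<^esub> N\<^bsup>- (2 j - 4) (1 - \<alpha>)\<^esup> h\<^bsup>2 j\<^esup>)\<close>, which for \<open>h = \<theta> N\<^bsup>1 - \<alpha>\<^esup>\<close> is
  of order \<open>N\<^bsup>4 (1 - \<alpha>)\<^esup>\<close> once the coefficients are close to their limits. For the remaining finitely many \<open>N\<close>, Jensen's
  inequality is strict at \<open>h = 0\<close>: otherwise the energy would vanish almost surely, hence also under
  every shift, but its mean after the shift is a nonzero polynomial in \<open>h\<close>.

  For the second claim, orthogonality of the Hermite polynomials bounds the second moment of the energy by
  \<open>O(N\<^bsup>6 (1 - \<alpha>)\<^esup>) = o((ln Z\<^sub>N)\<^sup>2)\<close>. So the densities tend to \<open>0\<close> in probability, although their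
  integrals are \<open>1\<close>.\<close>

section \<open>Hermite polynomials and exponential weights\<close>

text \<open>Gaussian laws enter only through moment generating functions of pairs, and every Hermite
  identity is a derivative at s = 0 of a generating function, taken under the integral sign. So the
  shift of the field is never carried out: it exists only as the weight exp (t Z - t^2 / 2) in the
  zero mode Z. Since Z has covariance 1 / (2 pi) with the field at every point, t = 2 pi h.

  The second moment is the delicate spot. Put r = N^(1 - alpha); the variance of the field is of
  order r^2 and ln Z_N is at least of order r^4. Bounding every covariance by the variance would
  give a second moment of order r^8, the same as the lower bound for (ln Z_N)^2, and nothing would
  follow. Parseval on two of the covariance factors saves one power of the variance, whence r^6.

  The degree-2 component serves twice: its coefficient - 1 / 2 cancels the cost of the shift, and
  being nonzero it gives Z_N > 1 for each single N, as a bound claimed from N = 1 on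
  requires.\<close>

fun hermite_poly :: "nat \<Rightarrow> real \<Rightarrow> real poly" where
  "hermite_poly 0 v = 1"
| "hermite_poly (Suc k) v = [:0, 1:] * hermite_poly k v - smult v (pderiv (hermite_poly k v))"

text \<open>The exponential contributes the factor x - v t and the inner argument contributes - v
  times the derivative of the polynomial, which is the recursion of \<open>hermite_poly\<close>.
  Evaluating at x - v t instead of x makes the formula hold at every t, as iterated derivatives
  demand.\<close>

lemma has_field_derivative_hermite_poly:
  "((\<lambda>t. poly (hermite_poly k v) (x - v * t) * exp (t * x - v * t\<^sup>2 / 2)) has_field_derivative
     poly (hermite_poly (Suc k) v) (x - v * t) * exp (t * x - v * t\<^sup>2 / 2)) (at t)"
  by (auto intro!: derivative_eq_intros DERIV_chain2[OF poly_DERIV] simp: algebra_simps)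

text \<open>An iterated \<open>deriv\<close> depends on a whole neighbourhood, so the candidates for
  all orders are given at all points at once.\<close>

lemma funpow_deriv_eqI:
  fixes F :: "nat \<Rightarrow> real \<Rightarrow> real"
  assumes "\<And>k t. (F k has_field_derivative F (Suc k) t) (at t)"
  shows "(deriv ^^ k) (F 0) = F k"
proof (induction k)
  case (Suc k)
  then show ?case using assms[THEN DERIV_imp_deriv] by auto
qed simp

lemma hermite_eq_poly: "hermite k x v = poly (hermite_poly k v) x"
  using funpow_deriv_eqI[of "\<lambda>k t. poly (hermite_poly k v) (x - v * t) * exp (t * x - v * t\<^sup>2 / 2)" k,
      OF has_field_derivative_hermite_poly]
  by (simp add: hermite_def)

lemma hermite_0 [simp]: "hermite 0 x v = 1"
  and hermite_1: "hermite 1 x v = x"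
  and hermite_2: "hermite 2 x v = x\<^sup>2 - v"
  by (simp_all add: hermite_eq_poly numeral_2_eq_2 pderiv_pCons algebra_simps)

lemma degree_hermite_poly: "degree (hermite_poly k v) = k"
  and coeff_hermite_poly_self: "coeff (hermite_poly k v) k = 1"
proof -
  have "degree (hermite_poly k v) \<le> k \<and> coeff (hermite_poly k v) k = 1"
  proof (induction k)
    case (Suc k)
    let ?p = "hermite_poly k v"
    have "degree ([:0,1:] * ?p) \<le> Suc k"
      using Suc degree_mult_le[of "[:0,1:]" ?p] by simp
    moreover have "degree (smult v (pderiv ?p)) \<le> k"
      using Suc degree_smult_le[of v "pderiv ?p"] degree_pderiv[of ?p] by linarith
    moreover have "coeff (smult v (pderiv ?p)) (Suc k) = 0"
      using coeff_eq_0[of "smult v (pderiv ?p)" "Suc k"] calculation(2) by linarith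
    ultimately show ?case using Suc
      by (auto intro!: degree_diff_le)
  qed simp
  then show "degree (hermite_poly k v) = k" "coeff (hermite_poly k v) k = 1"
    by (auto intro!: antisym le_degree)
qed

text \<open>Each further factor x consumes half of the exponent, through |x| <= 2 / c * exp (c |x| /
  2); hence the rate c is arbitrary in the induction.\<close>

lemma poly_le_exp:
  fixes p :: "real poly"
  assumes "c > 0"
  obtains C where "C > 0" "\<And>x. \<bar>poly p x\<bar> \<le> C * exp (c * \<bar>x\<bar>)"
proof -
  have "\<exists>C>0. \<forall>x. \<bar>poly p x\<bar> \<le> C * exp (c * \<bar>x\<bar>)" using assms
  proof (induction p arbitrary: c)
    case 0
    then show ?case by (auto intro!: exI[of _ 1])
  next
    case (pCons a p)
    from pCons(2)[of "c / 2"] pCons(3) obtain C where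
      C: "C > 0" "\<And>x. \<bar>poly p x\<bar> \<le> C * exp (c / 2 * \<bar>x\<bar>)" by auto
    have "\<bar>poly (pCons a p) x\<bar> \<le> (\<bar>a\<bar> + 2 / c * C) * exp (c * \<bar>x\<bar>)" for x
    proof -
      have "\<bar>x\<bar> \<le> 2 / c * exp (c / 2 * \<bar>x\<bar>)"
        using exp_ge_add_one_self[of "c / 2 * \<bar>x\<bar>"] pCons(3) by (simp add: field_simps)
      then have "\<bar>x\<bar> * \<bar>poly p x\<bar> \<le> (2 / c * exp (c / 2 * \<bar>x\<bar>)) * (C * exp (c / 2 * \<bar>x\<bar>))"
        using C pCons(3) by (intro mult_mono) auto
      also have "\<dots> = 2 / c * C * exp (c * \<bar>x\<bar>)"
        by (simp add: mult_exp_exp)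
      finally have "\<bar>x * poly p x\<bar> \<le> 2 / c * C * exp (c * \<bar>x\<bar>)" by (simp add: abs_mult)
      moreover have "\<bar>a\<bar> * 1 \<le> \<bar>a\<bar> * exp (c * \<bar>x\<bar>)" using pCons(3) by (intro mult_left_mono) auto
      ultimately show ?thesis by (simp add: algebra_simps)
    qed
    moreover have "\<bar>a\<bar> + 2 / c * C > 0" using C(1) pCons(3) by (simp add: add_nonneg_pos)
    ultimately show ?case by blast
  qed
  then show thesis using that by blast
qed

text \<open>The mean value inequality turns the bound D on the derivative near s0 into a bound on
  the difference quotients, to which dominated convergence applies.\<close>

lemma has_field_derivative_integral_dominated:
  fixes f :: "real \<Rightarrow> 'a \<Rightarrow> real"
  assumes int: "\<And>s. integrable M (f s)"
    and f': "f' s0 \<in> borel_measurable M"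
    and deriv: "\<And>s \<omega>. ((\<lambda>s. f s \<omega>) has_field_derivative f' s \<omega>) (at s)"
    and dom: "\<And>s \<omega>. \<bar>s - s0\<bar> \<le> 1 \<Longrightarrow> \<bar>f' s \<omega>\<bar> \<le> D \<omega>"
    and D: "integrable M D"
  shows "((\<lambda>s. \<integral>\<omega>. f s \<omega> \<partial>M) has_field_derivative (\<integral>\<omega>. f' s0 \<omega> \<partial>M)) (at s0)"
  unfolding DERIV_def tendsto_at_iff_sequentially comp_def
proof (intro allI impI)
  fix X :: "nat \<Rightarrow> real"
  assume X: "\<forall>i. X i \<in> UNIV - {0}" "X \<longlonglongrightarrow> 0"
  \<comment> \<open>D dominates only within distance 1 of s0, so the terms before n0 are
    discarded.\<close>
  from X(2) obtain n0 where n0: "\<And>n. n \<ge> n0 \<Longrightarrow> \<bar>X n\<bar> < 1"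
    by (metis LIMSEQ_iff diff_zero real_norm_def zero_less_one)
  let ?q = "\<lambda>n \<omega>. (f (s0 + X n) \<omega> - f s0 \<omega>) / X n"
  have "(\<lambda>n. \<integral>\<omega>. ?q (n + n0) \<omega> \<partial>M) \<longlonglongrightarrow> (\<integral>\<omega>. f' s0 \<omega> \<partial>M)"
  proof (rule integral_dominated_convergence[where w = D])
    show "f' s0 \<in> borel_measurable M" "integrable M D" by fact+
    show "?q (n + n0) \<in> borel_measurable M" for n
      using int by (auto intro!: borel_measurable_divide borel_measurable_diff)
    show "AE \<omega> in M. (\<lambda>n. ?q (n + n0) \<omega>) \<longlonglongrightarrow> f' s0 \<omega>"
    proof (rule AE_I2)
      fix \<omega>
      have "(\<lambda>n. ?q n \<omega>) \<longlonglongrightarrow> f' s0 \<omega>"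
        using deriv[of \<omega> s0] X unfolding DERIV_def tendsto_at_iff_sequentially comp_def by blast
      then show "(\<lambda>n. ?q (n + n0) \<omega>) \<longlonglongrightarrow> f' s0 \<omega>" by (rule LIMSEQ_ignore_initial_segment)
    qed
    show "AE \<omega> in M. norm (?q (n + n0) \<omega>) \<le> D \<omega>" for n
    proof (rule AE_I2)
      fix \<omega>
      let ?h = "X (n + n0)"
      have h: "\<bar>?h\<bar> < 1" "?h \<noteq> 0" using n0 X(1) by auto
      have "norm (f (s0 + ?h) \<omega> - f s0 \<omega>) \<le> D \<omega> * norm (s0 + ?h - s0)"
      proof (rule field_differentiable_bound[of "cball s0 1" "\<lambda>s. f s \<omega>" "\<lambda>s. f' s \<omega>"])
        show "((\<lambda>s. f s \<omega>) has_field_derivative f' z \<omega>) (at z within cball s0 1)" for z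
          using deriv has_field_derivative_at_within by blast
        show "norm (f' z \<omega>) \<le> D \<omega>" if "z \<in> cball s0 1" for z
          using that dom[of z \<omega>] by (auto simp: dist_real_def abs_minus_commute)
      qed (use h in \<open>auto simp: dist_real_def\<close>)
      then show "norm (?q (n + n0) \<omega>) \<le> D \<omega>"
        using h by (simp add: field_simps)
    qed
  qed
  then have "(\<lambda>n. \<integral>\<omega>. ?q n \<omega> \<partial>M) \<longlonglongrightarrow> (\<integral>\<omega>. f' s0 \<omega> \<partial>M)"
    by (rule LIMSEQ_offset)
  moreover have "(\<integral>\<omega>. ?q n \<omega> \<partial>M) = ((\<integral>\<omega>. f (s0 + X n) \<omega> \<partial>M) - (\<integral>\<omega>. f s0 \<omega> \<partial>M)) / X n" for n
    using int by simp
  ultimately have "(\<lambda>n. ((\<integral>\<omega>. f (s0 + X n) \<omega> \<partial>M) - (\<integral>\<omega>. f s0 \<omega> \<partial>M)) / X n)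
      \<longlonglongrightarrow> (\<integral>\<omega>. f' s0 \<omega> \<partial>M)" by (simp only:)
  then show "(\<lambda>n. ((\<integral>\<omega>. f (s0 + X n) \<omega> \<partial>M) - (\<integral>\<omega>. f s0 \<omega> \<partial>M)) / X n)
      \<longlonglongrightarrow> (\<integral>\<omega>. f' s0 \<omega> \<partial>M)" .
qed

lemma borel_measurable_poly [measurable (raw)]:
  fixes p :: "real poly"
  assumes "f \<in> borel_measurable M"
  shows "(\<lambda>x. poly p (f x)) \<in> borel_measurable M"
  using measurable_compose[OF assms borel_measurable_continuous_onI[of "poly p"]]
  by (simp add: continuous_on_poly)

text \<open>Exponential moments of A weighted by Y permit k derivatives in s under the integral, and
  at s = 0 these produce the Hermite polynomial. The factor Y stays general: it will be an
  exponential tilt in one use and another Hermite polynomial in the other.\<close>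

lemma
  fixes Y A :: "'a \<Rightarrow> real"
  assumes A: "A \<in> borel_measurable M"
    and YA: "\<And>c. integrable M (\<lambda>\<omega>. Y \<omega> * exp (c * \<bar>A \<omega>\<bar>))"
  shows integrable_times_poly_exp:
      "integrable M (\<lambda>\<omega>. Y \<omega> * (poly p (A \<omega> - u) * exp (s * A \<omega> - w)))"
    and integral_times_hermite:
      "(\<integral>\<omega>. Y \<omega> * hermite k (A \<omega>) v \<partial>M)
         = (deriv ^^ k) (\<lambda>s. \<integral>\<omega>. Y \<omega> * exp (s * A \<omega> - v * s\<^sup>2 / 2) \<partial>M) 0"
proof -
  have Y: "Y \<in> borel_measurable M" using YA[of 0] by simp
  \<comment> \<open>Uniform over bounded u and s, because dominating the derivative needs one bound
    for all parameters near s0; w >= 0 lets \<open>exp (- w)\<close> be dropped.\<close>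
  have dom: "\<exists>C. \<forall>u w s x. \<bar>u\<bar> \<le> R \<longrightarrow> \<bar>s\<bar> \<le> R \<longrightarrow> 0 \<le> w \<longrightarrow>
      \<bar>poly p (x - u) * exp (s * x - w)\<bar> \<le> C * exp ((R + 1) * \<bar>x\<bar>)" for p :: "real poly" and R
  proof -
    obtain C where C: "C > 0" "\<And>x. \<bar>poly p x\<bar> \<le> C * exp (1 * \<bar>x\<bar>)"
      using poly_le_exp[of 1 p] by auto
    have "\<bar>poly p (x - u) * exp (s * x - w)\<bar> \<le> C * exp R * exp ((R + 1) * \<bar>x\<bar>)"
      if "\<bar>u\<bar> \<le> R" "\<bar>s\<bar> \<le> R" "0 \<le> w" for u w s x
    proof -
      have "\<bar>poly p (x - u)\<bar> \<le> C * exp (R + \<bar>x\<bar>)"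
        using C(2)[of "x - u"] that C(1)
        by (smt (verit, ccfv_SIG) exp_le_cancel_iff mult_left_mono)
      moreover have "s * x \<le> R * \<bar>x\<bar>"
        using mult_right_mono[OF that(2), of "\<bar>x\<bar>"] abs_ge_self[of "s * x"]
        by (simp add: abs_mult)
      then have "exp (s * x - w) \<le> exp (R * \<bar>x\<bar>)" using that by auto
      ultimately have "\<bar>poly p (x - u) * exp (s * x - w)\<bar> \<le> C * exp (R + \<bar>x\<bar>) * exp (R * \<bar>x\<bar>)"
        unfolding abs_mult abs_exp_cancel using C(1) by (intro mult_mono) auto
      also have "\<dots> = C * exp R * exp ((R + 1) * \<bar>x\<bar>)"
        by (simp add: mult_exp_exp ring_distribs add_ac)
      finally show ?thesis .
    qed
    then show ?thesis by blast
  qed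
  have nn: "integrable M (\<lambda>\<omega>. Y \<omega> * (poly p (A \<omega> - u) * exp (s * A \<omega> - w)))"
    if "w \<ge> 0" for p :: "real poly" and u s w
  proof -
    let ?R = "max \<bar>u\<bar> \<bar>s\<bar>"
    obtain C where "\<And>x. \<bar>poly p (x - u) * exp (s * x - w)\<bar> \<le> C * exp ((?R + 1) * \<bar>x\<bar>)"
      using dom[of ?R p] \<open>w \<ge> 0\<close> max.cobounded1[of "\<bar>u\<bar>" "\<bar>s\<bar>"] max.cobounded2[of "\<bar>s\<bar>" "\<bar>u\<bar>"] by fast
    then have "\<bar>poly p (A \<omega> - u) * exp (s * A \<omega> - w)\<bar> \<le> \<bar>C * exp ((?R + 1) * \<bar>A \<omega>\<bar>)\<bar>" for \<omega>
      using abs_ge_self order_trans by blast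
    from mult_left_mono[OF this, of "\<bar>Y _\<bar>"]
    have "norm (Y \<omega> * (poly p (A \<omega> - u) * exp (s * A \<omega> - w)))
        \<le> norm (C * (Y \<omega> * exp ((?R + 1) * \<bar>A \<omega>\<bar>)))" for \<omega>
      by (simp add: abs_mult mult.left_commute)
    then show ?thesis
      by (intro Bochner_Integration.integrable_bound[OF integrable_mult_right[OF YA[of "?R + 1"], of C]])
        (use Y A in auto)
  qed
  \<comment> \<open>The sign condition on w disappears by taking w = 0 and multiplying by the
    constant \<open>exp (- w)\<close>.\<close>
  show "integrable M (\<lambda>\<omega>. Y \<omega> * (poly p (A \<omega> - u) * exp (s * A \<omega> - w)))" for p :: "real poly" and u s w
    using integrable_mult_left[OF nn[of 0 p u s], of "exp (- w)"]
    by (simp add: exp_diff exp_minus field_simps)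
  note int = this
  define F where "F k s = (\<integral>\<omega>. Y \<omega> * (poly (hermite_poly k v) (A \<omega> - v * s) *
      exp (s * A \<omega> - v * s\<^sup>2 / 2)) \<partial>M)" for k s
  have F: "(F k has_field_derivative F (Suc k) s0) (at s0)" for k s0
  proof -
    \<comment> \<open>For s within distance 1 of s0, the first entry of the maximum bounds the shift
      v s and the second bounds s.\<close>
    let ?p = "hermite_poly (Suc k) v" and ?R = "max (\<bar>v\<bar> * (\<bar>s0\<bar> + 1)) (\<bar>s0\<bar> + 1)"
    obtain C where C: "\<And>u w s x. \<bar>u\<bar> \<le> ?R \<Longrightarrow> \<bar>s\<bar> \<le> ?R \<Longrightarrow> 0 \<le> w \<Longrightarrow>
      \<bar>poly ?p (x - u) * exp (s * x - w)\<bar> \<le> C * exp ((?R + 1) * \<bar>x\<bar>)"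
      using dom[of ?R ?p] by blast
    \<comment> \<open>No sign of v is assumed, so \<open>exp (- v * s\<^sup>2 / 2)\<close> may
      exceed 1; the extra factor bounds it near s0.\<close>
    let ?C' = "C * exp (\<bar>v\<bar> * (\<bar>s0\<bar> + 1)\<^sup>2 / 2)"
    show ?thesis unfolding F_def
    proof (rule has_field_derivative_integral_dominated
        [where D = "\<lambda>\<omega>. \<bar>?C' * (Y \<omega> * exp ((?R + 1) * \<bar>A \<omega>\<bar>))\<bar>"])
      show "((\<lambda>s. Y \<omega> * (poly (hermite_poly k v) (A \<omega> - v * s) * exp (s * A \<omega> - v * s\<^sup>2 / 2)))
        has_field_derivative Y \<omega> * (poly (hermite_poly (Suc k) v) (A \<omega> - v * s) *
          exp (s * A \<omega> - v * s\<^sup>2 / 2))) (at s)" for s \<omega>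
        by (intro DERIV_cmult has_field_derivative_hermite_poly)
      fix s \<omega> assume "\<bar>s - s0\<bar> \<le> 1"
      then have s: "\<bar>s\<bar> \<le> \<bar>s0\<bar> + 1" by linarith
      then have "\<bar>v * s\<bar> \<le> ?R" "\<bar>s\<bar> \<le> ?R" by (auto simp: abs_mult mult_left_mono le_max_iff_disj)
      then have 1: "\<bar>poly ?p (A \<omega> - v * s) * exp (s * A \<omega> - 0)\<bar> \<le> C * exp ((?R + 1) * \<bar>A \<omega>\<bar>)"
        by (rule C) simp
      have "\<bar>s\<bar>\<^sup>2 \<le> (\<bar>s0\<bar> + 1)\<^sup>2" using s by (intro power_mono) auto
      then have "\<bar>v\<bar> * s\<^sup>2 \<le> \<bar>v\<bar> * (\<bar>s0\<bar> + 1)\<^sup>2" by (intro mult_left_mono) auto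
      moreover have "- v * s\<^sup>2 \<le> \<bar>v\<bar> * s\<^sup>2" by (intro mult_right_mono) auto
      ultimately have 2: "exp (- v * s\<^sup>2 / 2) \<le> exp (\<bar>v\<bar> * (\<bar>s0\<bar> + 1)\<^sup>2 / 2)" by simp
      have "\<bar>poly ?p (A \<omega> - v * s) * exp (s * A \<omega> - v * s\<^sup>2 / 2)\<bar>
          = \<bar>poly ?p (A \<omega> - v * s) * exp (s * A \<omega> - 0)\<bar> * exp (- v * s\<^sup>2 / 2)"
        by (simp add: abs_mult mult_exp_exp)
      also have "\<dots> \<le> C * exp ((?R + 1) * \<bar>A \<omega>\<bar>) * exp (\<bar>v\<bar> * (\<bar>s0\<bar> + 1)\<^sup>2 / 2)"
        using 1 2 by (intro mult_mono) (auto intro: order_trans[OF abs_ge_zero])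
      finally have "\<bar>Y \<omega>\<bar> * \<bar>poly ?p (A \<omega> - v * s) * exp (s * A \<omega> - v * s\<^sup>2 / 2)\<bar>
        \<le> \<bar>Y \<omega>\<bar> * (C * exp ((?R + 1) * \<bar>A \<omega>\<bar>) * exp (\<bar>v\<bar> * (\<bar>s0\<bar> + 1)\<^sup>2 / 2))"
        by (rule mult_left_mono) simp
      also have "\<dots> \<le> \<bar>?C' * (Y \<omega> * exp ((?R + 1) * \<bar>A \<omega>\<bar>))\<bar>"
        using mult_right_mono[OF abs_ge_self[of C], of "\<bar>Y \<omega>\<bar> * (exp ((?R + 1) * \<bar>A \<omega>\<bar>) *
            exp (\<bar>v\<bar> * (\<bar>s0\<bar> + 1)\<^sup>2 / 2))"]
        by (simp only: abs_mult abs_exp_cancel mult_ac) simp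
      finally show "\<bar>Y \<omega> * (poly ?p (A \<omega> - v * s) * exp (s * A \<omega> - v * s\<^sup>2 / 2))\<bar>
        \<le> \<bar>?C' * (Y \<omega> * exp ((?R + 1) * \<bar>A \<omega>\<bar>))\<bar>" by (simp add: abs_mult)
    qed (use int YA Y A in \<open>auto intro!: integrable_abs integrable_mult_right simp del: hermite_poly.simps\<close>)
  qed
  have "F 0 = (\<lambda>s. \<integral>\<omega>. Y \<omega> * exp (s * A \<omega> - v * s\<^sup>2 / 2) \<partial>M)"
    by (simp add: F_def fun_eq_iff)
  then show "(\<integral>\<omega>. Y \<omega> * hermite k (A \<omega>) v \<partial>M)
         = (deriv ^^ k) (\<lambda>s. \<integral>\<omega>. Y \<omega> * exp (s * A \<omega> - v * s\<^sup>2 / 2) \<partial>M) 0"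
    using fun_cong[OF funpow_deriv_eqI[of F k, OF F], of 0]
    by (simp add: F_def hermite_eq_poly)
qed

section \<open>Jointly Gaussian variables\<close>

text \<open>Encoded by the moment generating function, with a and b the variances, c the covariance
  and both means 0. Degenerate pairs such as (A, A) are covered, and the Hermite calculus below uses
  nothing else.\<close>

definition jointly_gaussian ::
  "'a measure \<Rightarrow> ('a \<Rightarrow> real) \<Rightarrow> ('a \<Rightarrow> real) \<Rightarrow> real \<Rightarrow> real \<Rightarrow> real \<Rightarrow> bool" where
  "jointly_gaussian M A B a c b \<longleftrightarrow>
     A \<in> borel_measurable M \<and> B \<in> borel_measurable M \<and>
     (\<forall>s t. integrable M (\<lambda>\<omega>. exp (s * A \<omega> + t * B \<omega>)) \<and>
       (\<integral>\<omega>. exp (s * A \<omega> + t * B \<omega>) \<partial>M) = exp ((a * s\<^sup>2 + 2 * c * s * t + b * t\<^sup>2) / 2))"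

lemma jointly_gaussian_swap: "jointly_gaussian M A B a c b \<Longrightarrow> jointly_gaussian M B A b c a"
proof -
  assume J: "jointly_gaussian M A B a c b"
  show ?thesis unfolding jointly_gaussian_def
  proof (intro conjI allI)
    fix s t
    have "s * B \<omega> + t * A \<omega> = t * A \<omega> + s * B \<omega>" for \<omega> by simp
    moreover have "(b * s\<^sup>2 + 2 * c * s * t + a * t\<^sup>2) / 2 = (a * t\<^sup>2 + 2 * c * t * s + b * s\<^sup>2) / 2" by simp
    ultimately show "integrable M (\<lambda>\<omega>. exp (s * B \<omega> + t * A \<omega>))"
      "(\<integral>\<omega>. exp (s * B \<omega> + t * A \<omega>) \<partial>M) = exp ((b * s\<^sup>2 + 2 * c * s * t + a * t\<^sup>2) / 2)"
      using J unfolding jointly_gaussian_def by presburger+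
  qed (use J in \<open>auto simp: jointly_gaussian_def\<close>)
qed

lemma jointly_gaussian_measurable:
  assumes "jointly_gaussian M A B a c b"
  shows "A \<in> borel_measurable M" "B \<in> borel_measurable M"
  using assms by (auto simp: jointly_gaussian_def)

text \<open>At each point the function coincides with one of the four exponentials obtained by
  choosing signs, so their sum dominates it.\<close>

lemma integrable_exp_abs:
  assumes "jointly_gaussian M A B a c b"
  shows "integrable M (\<lambda>\<omega>. exp (s * \<bar>A \<omega>\<bar> + t * \<bar>B \<omega>\<bar>))"
proof -
  have [measurable]: "A \<in> borel_measurable M" "B \<in> borel_measurable M"
    using assms by (auto simp: jointly_gaussian_def)
  have int: "integrable M (\<lambda>\<omega>. exp (s * A \<omega> + t * B \<omega>))" for s t
    using assms by (auto simp: jointly_gaussian_def)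
  show ?thesis
  proof (rule Bochner_Integration.integrable_bound)
    show "integrable M (\<lambda>\<omega>. exp (s * A \<omega> + t * B \<omega>) + exp (s * A \<omega> + (- t) * B \<omega>) +
       exp ((- s) * A \<omega> + t * B \<omega>) + exp ((- s) * A \<omega> + (- t) * B \<omega>))"
      by (intro Bochner_Integration.integrable_add int)
    show "AE \<omega> in M. norm (exp (s * \<bar>A \<omega>\<bar> + t * \<bar>B \<omega>\<bar>)) \<le>
       norm (exp (s * A \<omega> + t * B \<omega>) + exp (s * A \<omega> + (- t) * B \<omega>) +
       exp ((- s) * A \<omega> + t * B \<omega>) + exp ((- s) * A \<omega> + (- t) * B \<omega>))"
      proof (rule AE_I2)
      fix \<omega>
      have "exp (s * \<bar>A \<omega>\<bar> + t * \<bar>B \<omega>\<bar>) \<in> {exp (s * A \<omega> + t * B \<omega>), exp (s * A \<omega> + (- t) * B \<omega>),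
        exp ((- s) * A \<omega> + t * B \<omega>), exp ((- s) * A \<omega> + (- t) * B \<omega>)}"
        by (cases "A \<omega> \<ge> 0"; cases "B \<omega> \<ge> 0") auto
      then show "norm (exp (s * \<bar>A \<omega>\<bar> + t * \<bar>B \<omega>\<bar>)) \<le>
       norm (exp (s * A \<omega> + t * B \<omega>) + exp (s * A \<omega> + (- t) * B \<omega>) +
       exp ((- s) * A \<omega> + t * B \<omega>) + exp ((- s) * A \<omega> + (- t) * B \<omega>))"
        unfolding real_norm_def insert_iff empty_iff
        by (smt (verit) exp_gt_zero)
    qed
  qed simp
qed

lemma integrable_poly_poly_exp:
  fixes p q :: "real poly"
  assumes "jointly_gaussian M A B a c b"
  shows "integrable M (\<lambda>\<omega>. poly p (A \<omega>) * poly q (B \<omega>) * exp (s * \<bar>A \<omega>\<bar> + t * \<bar>B \<omega>\<bar>))"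
proof -
  have [measurable]: "A \<in> borel_measurable M" "B \<in> borel_measurable M"
    using assms by (auto simp: jointly_gaussian_def)
  obtain C where C: "C > 0" "\<And>x. \<bar>poly p x\<bar> \<le> C * exp (1 * \<bar>x\<bar>)" using poly_le_exp[of 1 p] by auto
  obtain D where D: "D > 0" "\<And>x. \<bar>poly q x\<bar> \<le> D * exp (1 * \<bar>x\<bar>)" using poly_le_exp[of 1 q] by auto
  show ?thesis
  proof (rule Bochner_Integration.integrable_bound)
    show "integrable M (\<lambda>\<omega>. C * D * exp ((s + 1) * \<bar>A \<omega>\<bar> + (t + 1) * \<bar>B \<omega>\<bar>))"
      using integrable_exp_abs[OF assms] by simp
    show "AE \<omega> in M. norm (poly p (A \<omega>) * poly q (B \<omega>) * exp (s * \<bar>A \<omega>\<bar> + t * \<bar>B \<omega>\<bar>))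
      \<le> norm (C * D * exp ((s + 1) * \<bar>A \<omega>\<bar> + (t + 1) * \<bar>B \<omega>\<bar>))"
    proof (rule AE_I2)
      fix \<omega>
      have "\<bar>poly p (A \<omega>)\<bar> * \<bar>poly q (B \<omega>)\<bar> \<le> (C * exp (1 * \<bar>A \<omega>\<bar>)) * (D * exp (1 * \<bar>B \<omega>\<bar>))"
        using C D by (intro mult_mono) auto
      from mult_right_mono[OF this, of "exp (s * \<bar>A \<omega>\<bar> + t * \<bar>B \<omega>\<bar>)"]
      show "norm (poly p (A \<omega>) * poly q (B \<omega>) * exp (s * \<bar>A \<omega>\<bar> + t * \<bar>B \<omega>\<bar>))
        \<le> norm (C * D * exp ((s + 1) * \<bar>A \<omega>\<bar> + (t + 1) * \<bar>B \<omega>\<bar>))"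
        using C(1) D(1) by (simp add: abs_mult exp_add ring_distribs mult_ac)
    qed
  qed simp
qed

lemma funpow_deriv_poly: "(deriv ^^ k) (poly p) = poly ((pderiv ^^ k) (p :: real poly))"
  using funpow_deriv_eqI[of "\<lambda>k. poly ((pderiv ^^ k) p)" k] by (simp add: poly_DERIV)

text \<open>The tilt times the generating function of A has expectation exp (c s t), whose k-th
  derivative in s at 0 is (t c)^k. With A and B exchanged, the same formula evaluates H_j (B)
  against the generating function of A as the monomial (s c)^j; orthogonality is the k-th derivative
  of that monomial at 0.\<close>

lemma
  assumes J: "jointly_gaussian M A B a c b"
  shows integral_hermite_exp_tilt:
      "(\<integral>\<omega>. exp (t * B \<omega> - b * t\<^sup>2 / 2) * hermite k (A \<omega>) a \<partial>M) = (t * c) ^ k"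
    and integral_hermite_hermite:
      "(\<integral>\<omega>. hermite j (B \<omega>) b * hermite k (A \<omega>) a \<partial>M) = (if j = k then fact k * c ^ k else 0)"
proof -
  have tilt: "(\<integral>\<omega>. exp (t * B \<omega> - b * t\<^sup>2 / 2) * hermite k (A \<omega>) a \<partial>M) = (t * c) ^ k"
    if J: "jointly_gaussian M A B a c b" for A B a c b t k
  proof -
    have [measurable]: "A \<in> borel_measurable M" "B \<in> borel_measurable M"
      using J by (auto simp: jointly_gaussian_def)
    have int: "integrable M (\<lambda>\<omega>. exp (s * A \<omega> + t * B \<omega>))"
      and eq: "(\<integral>\<omega>. exp (s * A \<omega> + t * B \<omega>) \<partial>M) = exp ((a * s\<^sup>2 + 2 * c * s * t + b * t\<^sup>2) / 2)" for s t
      using J by (auto simp: jointly_gaussian_def)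
    have "(\<integral>\<omega>. exp (t * B \<omega> - b * t\<^sup>2 / 2) * exp (s * A \<omega> - a * s\<^sup>2 / 2) \<partial>M) = exp ((t * c) * s)" for s
    proof -
      have "(\<integral>\<omega>. exp (t * B \<omega> - b * t\<^sup>2 / 2) * exp (s * A \<omega> - a * s\<^sup>2 / 2) \<partial>M)
        = (\<integral>\<omega>. exp (s * A \<omega> + t * B \<omega>) * exp (- (b * t\<^sup>2 / 2) - a * s\<^sup>2 / 2) \<partial>M)"
        by (intro Bochner_Integration.integral_cong) (simp_all add: mult_exp_exp algebra_simps)
      also have "\<dots> = exp ((a * s\<^sup>2 + 2 * c * s * t + b * t\<^sup>2) / 2) * exp (- (b * t\<^sup>2 / 2) - a * s\<^sup>2 / 2)"
        by (simp add: eq)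
      also have "\<dots> = exp ((t * c) * s)" by (simp add: mult_exp_exp field_simps)
      finally show ?thesis .
    qed
    moreover have "integrable M (\<lambda>\<omega>. exp (t * B \<omega> - b * t\<^sup>2 / 2) * exp (s * \<bar>A \<omega>\<bar>))" for s
    proof (rule Bochner_Integration.integrable_bound)
      show "integrable M (\<lambda>\<omega>. exp (- (b * t\<^sup>2 / 2)) * exp (s * \<bar>A \<omega>\<bar> + \<bar>t\<bar> * \<bar>B \<omega>\<bar>))"
        using integrable_exp_abs[OF J] by simp
      have "t * B \<omega> \<le> \<bar>t\<bar> * \<bar>B \<omega>\<bar>" for \<omega> by (simp flip: abs_mult)
      then show "AE \<omega> in M. norm (exp (t * B \<omega> - b * t\<^sup>2 / 2) * exp (s * \<bar>A \<omega>\<bar>))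
        \<le> norm (exp (- (b * t\<^sup>2 / 2)) * exp (s * \<bar>A \<omega>\<bar> + \<bar>t\<bar> * \<bar>B \<omega>\<bar>))"
        by (auto simp: mult_exp_exp algebra_simps)
    qed simp
    ultimately have eq': "(\<integral>\<omega>. exp (t * B \<omega> - b * t\<^sup>2 / 2) * hermite k (A \<omega>) a \<partial>M)
      = (deriv ^^ k) (\<lambda>s. exp ((t * c) * s)) 0"
      by (subst integral_times_hermite) auto
    have DERIV: "((\<lambda>s. (t * c) ^ k * exp ((t * c) * s)) has_field_derivative (t * c) ^ Suc k * exp ((t * c) * s)) (at s)"
      for k s by (auto intro!: derivative_eq_intros)
    have "(deriv ^^ k) (\<lambda>s. exp ((t * c) * s)) = (\<lambda>s. (t * c) ^ k * exp ((t * c) * s))"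
      using funpow_deriv_eqI[of "\<lambda>k s. (t * c) ^ k * exp ((t * c) * s)" k, OF DERIV] by simp
    with eq' show ?thesis by simp
  qed
  show "(\<integral>\<omega>. exp (t * B \<omega> - b * t\<^sup>2 / 2) * hermite k (A \<omega>) a \<partial>M) = (t * c) ^ k"
    by (rule tilt[OF J])
  have "integrable M (\<lambda>\<omega>. hermite j (B \<omega>) b * exp (s * \<bar>A \<omega>\<bar>))" for s
    using integrable_poly_poly_exp[OF J, of 1 "hermite_poly j b" s 0] by (simp add: hermite_eq_poly)
  moreover have "(\<integral>\<omega>. hermite j (B \<omega>) b * exp (s * A \<omega> - a * s\<^sup>2 / 2) \<partial>M) = poly (monom (c ^ j) j) s" for s
    using tilt[OF jointly_gaussian_swap[OF J], of s j] by (simp add: mult_ac poly_monom power_mult_distrib)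
  ultimately have "(\<integral>\<omega>. hermite j (B \<omega>) b * hermite k (A \<omega>) a \<partial>M) = (deriv ^^ k) (poly (monom (c ^ j) j)) 0"
    using jointly_gaussian_measurable[OF J] by (subst integral_times_hermite) auto
  also have "\<dots> = coeff ((pderiv ^^ k) (monom (c ^ j) j)) 0"
    by (simp add: funpow_deriv_poly poly_0_coeff_0)
  also have "\<dots> = (if j = k then fact k * c ^ k else 0)"
    by (simp add: coeff_higher_pderiv pochhammer_fact)
  finally show "(\<integral>\<omega>. hermite j (B \<omega>) b * hermite k (A \<omega>) a \<partial>M) = (if j = k then fact k * c ^ k else 0)" .
qed

section \<open>Linear forms in the Gaussian coefficients\<close>

text \<open>The standard deviation s of the definition is eliminated in favour of the second moment,
  which is what the assumptions on g determine. Variance 0 is a point mass at 0 and is treated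
  apart.\<close>

lemma centered_gaussian_exp:
  assumes P: "prob_space P" and X: "centered_gaussian P X"
  shows "integrable P (\<lambda>\<omega>. (X \<omega>)\<^sup>2)"
    and "integrable P (\<lambda>\<omega>. exp (X \<omega>))"
    and "(\<integral>\<omega>. exp (X \<omega>) \<partial>P) = exp ((\<integral>\<omega>. (X \<omega>)\<^sup>2 \<partial>P) / 2)"
proof -
  interpret prob_space P by fact
  obtain s where s: "s \<ge> 0" and D: "distr P borel X =
      (if s = 0 then return borel 0 else density lborel (\<lambda>x. ennreal (normal_density 0 s x)))"
    and [measurable]: "X \<in> borel_measurable P"
    using X unfolding centered_gaussian_def by auto
  have int: "integrable P (\<lambda>\<omega>. f (X \<omega>)) \<longleftrightarrow> integrable (distr P borel X) f"
    and eq: "(\<integral>\<omega>. f (X \<omega>) \<partial>P) = (\<integral>x. f x \<partial>distr P borel X)"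
    if [measurable]: "f \<in> borel_measurable borel" for f :: "real \<Rightarrow> real"
    using integrable_distr_eq[of X P borel f] integral_distr[of X P borel f] by simp_all
  have "integrable P (\<lambda>\<omega>. (X \<omega>)\<^sup>2) \<and> integrable P (\<lambda>\<omega>. exp (X \<omega>)) \<and>
    (\<integral>\<omega>. exp (X \<omega>) \<partial>P) = exp ((\<integral>\<omega>. (X \<omega>)\<^sup>2 \<partial>P) / 2)"
  proof (cases "s = 0")
    case True
    have D: "distr P borel X = return borel 0" using True D by simp
    have "AE x in distr P borel X. x = 0" unfolding D by (subst AE_return) simp_all
    then have ae: "AE \<omega> in P. X \<omega> = 0" by (simp add: AE_distr_iff)
    have "(\<integral>\<omega>. (X \<omega>)\<^sup>2 \<partial>P) = (\<integral>\<omega>. 0 \<partial>P)" "(\<integral>\<omega>. exp (X \<omega>) \<partial>P) = (\<integral>\<omega>. 1 \<partial>P)"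
      using ae by (intro integral_cong_AE; auto)+
    moreover have "integrable P (\<lambda>\<omega>. (X \<omega>)\<^sup>2) = integrable P (\<lambda>\<omega>. 0 :: real)"
      "integrable P (\<lambda>\<omega>. exp (X \<omega>)) = integrable P (\<lambda>\<omega>. 1 :: real)"
      using ae by (intro integrable_cong_AE; auto)+
    ultimately show ?thesis by (simp add: prob_space)
  next
    case False
    with s have s: "s > 0" by simp
    have D: "distr P borel X = density lborel (\<lambda>x. ennreal (normal_density 0 s x))" using False D by simp
    have "has_bochner_integral lborel (\<lambda>x. normal_density 0 s x * x\<^sup>2) (s\<^sup>2)"
      using normal_moment_even[OF s, of 0 1] by (simp add: power2_eq_square field_simps)
    then have 1: "integrable P (\<lambda>\<omega>. (X \<omega>)\<^sup>2)" "(\<integral>\<omega>. (X \<omega>)\<^sup>2 \<partial>P) = s\<^sup>2"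
      using int[of "\<lambda>x. x\<^sup>2"] eq[of "\<lambda>x. x\<^sup>2"]
      by (simp_all add: D integrable_density integral_density has_bochner_integral_iff)
    have "normal_density 0 s x * exp x = exp (s\<^sup>2 / 2) * normal_density (s\<^sup>2) s x" for x
    proof -
      have "- (x\<^sup>2) / (2 * s\<^sup>2) + x = s\<^sup>2 / 2 - (x - s\<^sup>2)\<^sup>2 / (2 * s\<^sup>2)"
        using s by (simp add: field_simps power2_eq_square)
      then show ?thesis
        by (simp add: normal_density_def mult_exp_exp)
    qed
    then have "has_bochner_integral lborel (\<lambda>x. normal_density 0 s x * exp x) (exp (s\<^sup>2 / 2))"
      using s by (simp add: has_bochner_integral_iff)
    then have "integrable P (\<lambda>\<omega>. exp (X \<omega>))" "(\<integral>\<omega>. exp (X \<omega>) \<partial>P) = exp (s\<^sup>2 / 2)"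
      using int[of exp] eq[of exp]
      by (simp_all add: D integrable_density integral_density has_bochner_integral_iff)
    with 1 show ?thesis by simp
  qed
  then show "integrable P (\<lambda>\<omega>. (X \<omega>)\<^sup>2)" "integrable P (\<lambda>\<omega>. exp (X \<omega>))"
    "(\<integral>\<omega>. exp (X \<omega>) \<partial>P) = exp ((\<integral>\<omega>. (X \<omega>)\<^sup>2 \<partial>P) / 2)" by auto
qed

text \<open>The inner product is the real one on complex numbers, Re (cnj w * z), so the form is
  real for arbitrary weights.\<close>

definition lin_form ::
  "(int \<times> int) set \<Rightarrow> (int \<times> int \<Rightarrow> complex) \<Rightarrow> (int \<times> int \<Rightarrow> 'w \<Rightarrow> complex) \<Rightarrow> 'w \<Rightarrow> real" where
  "lin_form K w g \<omega> = (\<Sum>k\<in>K. w k \<bullet> g k \<omega>)"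

text \<open>One representative of each pair k, - k, together with 0 if present, so that the
  independence clause for g applies.\<close>

definition half :: "(int \<times> int) set \<Rightarrow> (int \<times> int) set" where
  "half K = {k \<in> K. k = 0 \<or> fst k > 0 \<or> (fst k = 0 \<and> snd k > 0)}"

lemma half_no_opposites: "k \<in> half K \<Longrightarrow> k \<noteq> 0 \<Longrightarrow> - k \<notin> half K"
  by (auto simp: half_def prod_eq_iff)

lemma sum_half:
  fixes f :: "int \<times> int \<Rightarrow> real"
  assumes K: "finite K" "\<And>k. k \<in> K \<Longrightarrow> - k \<in> K"
  shows "sum f K = (\<Sum>k\<in>half K. if k = 0 then f k else f k + f (- k))"
proof -
  define Q where "Q = half K - {0}"
  have Q: "finite Q" "finite (half K)" using K by (auto simp: Q_def half_def)
  have "K = half K \<union> uminus ` Q"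
  proof (intro equalityI subsetI)
    fix k assume k: "k \<in> K"
    have "- k \<in> Q" if "k \<notin> half K"
      using that k K(2)[OF k] by (auto simp: Q_def half_def prod_eq_iff)
    then show "k \<in> half K \<union> uminus ` Q" by (metis UnCI image_eqI minus_minus)
  next
    fix k assume "k \<in> half K \<union> uminus ` Q"
    then show "k \<in> K" unfolding Q_def half_def using K(2) by blast
  qed
  have "sum f K = sum f (half K) + sum f (uminus ` Q)"
  proof -
    have "half K \<inter> uminus ` Q = {}"
    proof (rule ccontr)
      assume "half K \<inter> uminus ` Q \<noteq> {}"
      then obtain k where "k \<in> Q" "- k \<in> half K" by blast
      then show False using half_no_opposites[of k K] by (simp add: Q_def)
    qed
    with Q have "sum f (half K \<union> uminus ` Q) = sum f (half K) + sum f (uminus ` Q)"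
      by (intro sum.union_disjoint) simp_all
    then show ?thesis by (rule trans[OF arg_cong[OF \<open>K = half K \<union> uminus ` Q\<close>, of "sum f"]])
  qed
  also have "sum f (uminus ` Q) = (\<Sum>k\<in>Q. f (- k))"
    by (subst sum.reindex) (auto simp: inj_on_def)
  also have "\<dots> = (\<Sum>k\<in>half K. if k = 0 then 0 else f (- k))"
    unfolding Q_def using Q by (intro sum.mono_neutral_cong_left) auto
  finally show ?thesis by (simp flip: sum.distrib) (intro sum.cong, auto)
qed

locale gaussian_field_coefficients = prob_space P for P :: "'w measure" +
  fixes g :: "int \<times> int \<Rightarrow> 'w \<Rightarrow> complex"
  assumes coeffs: "gaussian_coefficients P g"
begin

lemma g_measurable [measurable]: "g k \<in> borel_measurable P"
  and g_gaussian: "centered_complex_gaussian P (g k)"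
  and g_uminus: "AE \<omega> in P. g (- k) \<omega> = cnj (g k \<omega>)"
  and g_norm: "(\<integral>\<omega>. (cmod (g k \<omega>))\<^sup>2 \<partial>P) = 1"
  and g_square: "k \<noteq> 0 \<Longrightarrow> (\<integral>\<omega>. (g k \<omega>)\<^sup>2 \<partial>P) = 0"
  and g_zero_real: "AE \<omega> in P. g 0 \<omega> \<in> \<real>"
  and g_indep: "(\<And>k. k \<in> K \<Longrightarrow> k \<noteq> 0 \<Longrightarrow> - k \<notin> K) \<Longrightarrow> indep_vars (\<lambda>_. borel) g K"
proof -
  note c = coeffs[unfolded gaussian_coefficients_def]
  show "g k \<in> borel_measurable P" using c[THEN conjunct1] by (rule spec)
  note c = c[THEN conjunct2]
  show "centered_complex_gaussian P (g k)" using c[THEN conjunct1] by (rule spec)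
  note c = c[THEN conjunct2]
  show "AE \<omega> in P. g (- k) \<omega> = cnj (g k \<omega>)" using c[THEN conjunct1] by (rule spec)
  note c = c[THEN conjunct2]
  show "(\<integral>\<omega>. (cmod (g k \<omega>))\<^sup>2 \<partial>P) = 1" using c[THEN conjunct1] by (rule spec)
  note c = c[THEN conjunct2]
  show "(\<integral>\<omega>. (g k \<omega>)\<^sup>2 \<partial>P) = 0" if "k \<noteq> 0" using c[THEN conjunct1, THEN spec] that by (rule mp)
  note c = c[THEN conjunct2]
  show "AE \<omega> in P. g 0 \<omega> \<in> \<real>" using c[THEN conjunct1] .
  show "indep_vars (\<lambda>_. borel) g K" if "\<And>k. k \<in> K \<Longrightarrow> k \<noteq> 0 \<Longrightarrow> - k \<notin> K"
    using c[THEN conjunct2, THEN spec, of K] that by simp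
qed

text \<open>A Bochner integral is 0 by convention when the function is not integrable, so the value
  1 forces integrability.\<close>

lemma integrable_norm_sq: "integrable P (\<lambda>\<omega>. (cmod (g k \<omega>))\<^sup>2)"
  using g_norm[of k] not_integrable_integral_eq[of P "\<lambda>\<omega>. (cmod (g k \<omega>))\<^sup>2"] by force

text \<open>The square splits into |w|^2 |z|^2 / 2 and half the real part of (cnj w)^2 z^2. For k
  other than 0 the second part averages to 0, which accounts for the half; at k = 0 both w and g are
  real and all of |w|^2 remains.\<close>

lemma second_moment:
  assumes "k = 0 \<Longrightarrow> w \<in> \<real>"
  shows "(\<integral>\<omega>. (w \<bullet> g k \<omega>)\<^sup>2 \<partial>P) = (if k = 0 then (cmod w)\<^sup>2 else (cmod w)\<^sup>2 / 2)"
proof (cases "k = 0")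
  case True
  then have w: "w = complex_of_real (Re w)" using assms by (simp add: complex_is_Real_iff complex_eq_iff)
  have "AE \<omega> in P. g k \<omega> \<in> \<real>" using g_zero_real True by simp
  then have "AE \<omega> in P. (w \<bullet> g k \<omega>)\<^sup>2 = (cmod w)\<^sup>2 * (cmod (g k \<omega>))\<^sup>2"
    by eventually_elim (subst (1 2) w, auto simp: inner_complex_def cmod_power2 complex_is_Real_iff power_mult_distrib)
  then have "(\<integral>\<omega>. (w \<bullet> g k \<omega>)\<^sup>2 \<partial>P) = (\<integral>\<omega>. (cmod w)\<^sup>2 * (cmod (g k \<omega>))\<^sup>2 \<partial>P)"
    by (intro integral_cong_AE) auto
  then show ?thesis using g_norm[of k] True by simp
next
  case False
  have sq: "integrable P (\<lambda>\<omega>. (g k \<omega>)\<^sup>2)"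
    using integrable_norm_sq[of k] by (rule Bochner_Integration.integrable_bound) (auto simp: norm_power)
  have "(w \<bullet> z)\<^sup>2 = (cmod w)\<^sup>2 * (cmod z)\<^sup>2 / 2 + Re ((cnj w)\<^sup>2 * z\<^sup>2) / 2" for z
    unfolding inner_complex_def cmod_power2 by (simp add: power2_eq_square field_simps)
  then have "(\<integral>\<omega>. (w \<bullet> g k \<omega>)\<^sup>2 \<partial>P)
    = (cmod w)\<^sup>2 * (\<integral>\<omega>. (cmod (g k \<omega>))\<^sup>2 \<partial>P) / 2 + (\<integral>\<omega>. Re ((cnj w)\<^sup>2 * (g k \<omega>)\<^sup>2) \<partial>P) / 2"
    using integrable_norm_sq[of k] sq
    by (simp add: Bochner_Integration.integral_add integrable_Re del: times_complex.simps)
  also have "(\<integral>\<omega>. Re ((cnj w)\<^sup>2 * (g k \<omega>)\<^sup>2) \<partial>P) = Re ((cnj w)\<^sup>2 * (\<integral>\<omega>. (g k \<omega>)\<^sup>2 \<partial>P))"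
    using sq by (subst integral_Re) (auto simp del: times_complex.simps)
  finally show ?thesis using g_norm[of k] g_square[of k] False by simp
qed

text \<open>Symmetry of w and of g makes k and - k contribute equally, so almost surely the form is
  a sum over \<open>half K\<close> of independent Gaussians with doubled weights. Doubling gives the
  second moment 4 |w k|^2 / 2 = |w k|^2 + |w (- k)|^2, which restores the sum over K.\<close>

lemma
  assumes K: "finite K" "\<And>k. k \<in> K \<Longrightarrow> - k \<in> K" and w: "\<And>k. k \<in> K \<Longrightarrow> w (- k) = cnj (w k)"
  shows integrable_exp_lin_form: "integrable P (\<lambda>\<omega>. exp (lin_form K w g \<omega>))"
    and integral_exp_lin_form:
      "(\<integral>\<omega>. exp (lin_form K w g \<omega>) \<partial>P) = exp ((\<Sum>k\<in>K. (cmod (w k))\<^sup>2) / 2)"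
proof -
  define u where "u k = (if k = 0 then w k else 2 * w k)" for k
  have fin: "finite (half K)" using K by (simp add: half_def)
  have "AE \<omega> in P. \<forall>k\<in>K. g (- k) \<omega> = cnj (g k \<omega>)"
    using K(1) g_uminus by (simp add: AE_finite_all)
  then have ae: "AE \<omega> in P. exp (lin_form K w g \<omega>) = (\<Prod>k\<in>half K. exp (u k \<bullet> g k \<omega>))"
  proof eventually_elim
    fix \<omega> assume g: "\<forall>k\<in>K. g (- k) \<omega> = cnj (g k \<omega>)"
    have "(if k = 0 then w k \<bullet> g k \<omega> else w k \<bullet> g k \<omega> + w (- k) \<bullet> g (- k) \<omega>) = u k \<bullet> g k \<omega>"
      if "k \<in> half K" for k
    proof -
      have "k \<in> K" using that by (simp add: half_def)
      then have "w (- k) = cnj (w k)" "g (- k) \<omega> = cnj (g k \<omega>)" using g w by auto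
      then show ?thesis by (simp add: u_def inner_complex_def)
    qed
    then have "lin_form K w g \<omega> = (\<Sum>k\<in>half K. u k \<bullet> g k \<omega>)"
      unfolding lin_form_def by (subst sum_half[OF K]) (simp_all cong: sum.cong)
    then show "exp (lin_form K w g \<omega>) = (\<Prod>k\<in>half K. exp (u k \<bullet> g k \<omega>))"
      by (simp add: exp_sum fin)
  qed
  have G: "centered_gaussian P (\<lambda>\<omega>. u k \<bullet> g k \<omega>)" for k
    using g_gaussian[of k] by (simp add: centered_complex_gaussian_def)
  note gs = centered_gaussian_exp[OF prob_space_axioms G]
  have "indep_vars (\<lambda>_. borel) g (half K)"
    using half_no_opposites[of _ K] by (intro g_indep)
  then have ind: "indep_vars (\<lambda>_. borel) (\<lambda>k \<omega>. exp (u k \<bullet> g k \<omega>)) (half K)"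
    by (rule indep_vars_compose2) simp
  have "integrable P (\<lambda>\<omega>. \<Prod>k\<in>half K. exp (u k \<bullet> g k \<omega>))"
    by (rule indep_vars_integrable[OF fin ind gs(2)])
  then show "integrable P (\<lambda>\<omega>. exp (lin_form K w g \<omega>))"
    by (subst integrable_cong_AE[OF _ _ ae]) (auto simp: lin_form_def)
  have w0: "w 0 \<in> \<real>" if "0 \<in> K" using w[OF that] by (simp add: Reals_cnj_iff)
  have "(\<integral>\<omega>. exp (lin_form K w g \<omega>) \<partial>P) = (\<integral>\<omega>. (\<Prod>k\<in>half K. exp (u k \<bullet> g k \<omega>)) \<partial>P)"
    by (rule integral_cong_AE[OF _ _ ae]) (auto simp: lin_form_def)
  also have "\<dots> = (\<Prod>k\<in>half K. exp ((\<integral>\<omega>. (u k \<bullet> g k \<omega>)\<^sup>2 \<partial>P) / 2))"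
    using gs by (subst indep_vars_lebesgue_integral[OF fin ind]) auto
  also have "\<dots> = exp (\<Sum>k\<in>half K. (\<integral>\<omega>. (u k \<bullet> g k \<omega>)\<^sup>2 \<partial>P) / 2)"
    by (simp add: exp_sum fin)
  also have "(\<Sum>k\<in>half K. (\<integral>\<omega>. (u k \<bullet> g k \<omega>)\<^sup>2 \<partial>P) / 2) = (\<Sum>k\<in>K. (cmod (w k))\<^sup>2 / 2)"
  proof -
    have "(\<integral>\<omega>. (u k \<bullet> g k \<omega>)\<^sup>2 \<partial>P) / 2 =
        (if k = 0 then (cmod (w k))\<^sup>2 / 2 else (cmod (w k))\<^sup>2 / 2 + (cmod (w (- k)))\<^sup>2 / 2)"
      if "k \<in> half K" for k
    proof -
      have k: "k \<in> K" using that by (simp add: half_def)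
      then have "(\<integral>\<omega>. (u k \<bullet> g k \<omega>)\<^sup>2 \<partial>P) = (if k = 0 then (cmod (u k))\<^sup>2 else (cmod (u k))\<^sup>2 / 2)"
        using w0 by (intro second_moment) (auto simp: u_def)
      then show ?thesis
        using w[OF k] by (simp add: u_def norm_mult power_mult_distrib)
    qed
    then show ?thesis
      by (subst sum_half[OF K]) (simp_all cong: sum.cong)
  qed
  finally show "(\<integral>\<omega>. exp (lin_form K w g \<omega>) \<partial>P) = exp ((\<Sum>k\<in>K. (cmod (w k))\<^sup>2) / 2)"
    by (simp add: sum_divide_distrib)
qed

lemma lin_form_measurable [measurable]: "lin_form K w g \<in> borel_measurable P"
  unfolding lin_form_def [abs_def] by simp

text \<open>A combination of the two forms is again a form with symmetric weights, so the generating
  function of the pair reduces to that of a single form.\<close>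

lemma jointly_gaussian_lin_form:
  assumes K: "finite K" "\<And>k. k \<in> K \<Longrightarrow> - k \<in> K"
    and w: "\<And>k. k \<in> K \<Longrightarrow> w (- k) = cnj (w k)" "\<And>k. k \<in> K \<Longrightarrow> w' (- k) = cnj (w' k)"
  shows "jointly_gaussian P (lin_form K w g) (lin_form K w' g)
    (\<Sum>k\<in>K. (cmod (w k))\<^sup>2) (\<Sum>k\<in>K. w k \<bullet> w' k) (\<Sum>k\<in>K. (cmod (w' k))\<^sup>2)"
  unfolding jointly_gaussian_def
proof (intro conjI allI)
  fix s t :: real
  let ?u = "\<lambda>k. s *\<^sub>R w k + t *\<^sub>R w' k"
  have lin: "s * lin_form K w g \<omega> + t * lin_form K w' g \<omega> = lin_form K ?u g \<omega>" for \<omega>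
    by (simp add: lin_form_def inner_add_left sum.distrib sum_distrib_left)
  have u: "?u (- k) = cnj (?u k)" if "k \<in> K" for k
    using w that by simp
  show "integrable P (\<lambda>\<omega>. exp (s * lin_form K w g \<omega> + t * lin_form K w' g \<omega>))"
    unfolding lin by (rule integrable_exp_lin_form[of K ?u, OF K u])
  have "(cmod (?u k))\<^sup>2 = (cmod (w k))\<^sup>2 * s\<^sup>2 + 2 * (w k \<bullet> w' k) * s * t + (cmod (w' k))\<^sup>2 * t\<^sup>2" for k
    unfolding cmod_power2 inner_complex_def by (simp add: power2_eq_square ring_distribs)
  then have eq: "(\<Sum>k\<in>K. (cmod (?u k))\<^sup>2) = (\<Sum>k\<in>K. (cmod (w k))\<^sup>2) * s\<^sup>2 + 2 * (\<Sum>k\<in>K. w k \<bullet> w' k) * s * t +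
       (\<Sum>k\<in>K. (cmod (w' k))\<^sup>2) * t\<^sup>2"
    by (simp only: sum.distrib sum_distrib_left sum_distrib_right)
  show "(\<integral>\<omega>. exp (s * lin_form K w g \<omega> + t * lin_form K w' g \<omega>) \<partial>P) =
     exp (((\<Sum>k\<in>K. (cmod (w k))\<^sup>2) * s\<^sup>2 + 2 * (\<Sum>k\<in>K. w k \<bullet> w' k) * s * t +
       (\<Sum>k\<in>K. (cmod (w' k))\<^sup>2) * t\<^sup>2) / 2)"
    unfolding lin eq [symmetric] by (rule integral_exp_lin_form[of K ?u, OF K u])
qed (rule lin_form_measurable)+

end

section \<open>Fourier analysis on the torus\<close>

lemma torus_eq_cbox: "torus = cbox (0, 0) (2 * pi, 2 * pi)"
  by (simp add: torus_def cbox_Pair_eq)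

lemma compact_torus: "compact torus" by (simp add: torus_eq_cbox)

lemma torus_borel [measurable]: "torus \<in> sets borel"
  using compact_torus by (simp add: borel_compact)

lemma freq_simps [simp]: "freq 0 = 0" "freq (- k) = - freq k" "freq (k - l) = freq k - freq l"
  by (simp_all add: freq_def prod_eq_iff)

lemma dir_deriv_trig:
  "dir_deriv v (\<lambda>x. A * cos (\<xi> \<bullet> x) + B * sin (\<xi> \<bullet> x)) =
     (\<lambda>x. (B * (\<xi> \<bullet> v)) * cos (\<xi> \<bullet> x) + (- A * (\<xi> \<bullet> v)) * sin (\<xi> \<bullet> x))"
proof
  fix x
  have "((\<lambda>x. A * cos (\<xi> \<bullet> x) + B * sin (\<xi> \<bullet> x)) has_derivative
     (\<lambda>h. A * (- sin (\<xi> \<bullet> x) * (\<xi> \<bullet> h)) + B * (cos (\<xi> \<bullet> x) * (\<xi> \<bullet> h)))) (at x)"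
    by (auto intro!: derivative_eq_intros simp: algebra_simps)
  then show "dir_deriv v (\<lambda>x. A * cos (\<xi> \<bullet> x) + B * sin (\<xi> \<bullet> x)) x =
     (B * (\<xi> \<bullet> v)) * cos (\<xi> \<bullet> x) + (- A * (\<xi> \<bullet> v)) * sin (\<xi> \<bullet> x)"
    unfolding dir_deriv_def by (subst frechet_derivative_at [symmetric]) (auto simp: algebra_simps)
qed

text \<open>Neither cos nor sin alone is stable under directional derivatives, but their span at a
  fixed frequency is; hence the two coefficients.\<close>

lemma smooth_trig: "smooth (\<lambda>x. A * cos (\<xi> \<bullet> x) + B * sin (\<xi> \<bullet> x))"
proof -
  have "\<exists>A' B'. iter_deriv vs (\<lambda>x. A * cos (\<xi> \<bullet> x) + B * sin (\<xi> \<bullet> x))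
    = (\<lambda>x. A' * cos (\<xi> \<bullet> x) + B' * sin (\<xi> \<bullet> x))" for vs
  proof (induction vs)
    case Nil
    show ?case by (auto simp: iter_deriv_def)
  next
    case (Cons v vs)
    then obtain A' B' where "iter_deriv vs (\<lambda>x. A * cos (\<xi> \<bullet> x) + B * sin (\<xi> \<bullet> x))
      = (\<lambda>x. A' * cos (\<xi> \<bullet> x) + B' * sin (\<xi> \<bullet> x))" by blast
    then have "iter_deriv (v # vs) (\<lambda>x. A * cos (\<xi> \<bullet> x) + B * sin (\<xi> \<bullet> x))
      = dir_deriv v (\<lambda>x. A' * cos (\<xi> \<bullet> x) + B' * sin (\<xi> \<bullet> x))"
      by (simp add: iter_deriv_def)
    then show ?case unfolding dir_deriv_trig by blast
  qed
  moreover have "(\<lambda>x. A' * cos (\<xi> \<bullet> x) + B' * sin (\<xi> \<bullet> x)) differentiable_on UNIV" for A' B'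
    by (auto simp: differentiable_on_def differentiable_def intro!: exI derivative_eq_intros)
  ultimately show ?thesis unfolding smooth_def by metis
qed

lemma cis_freq_periodic:
  "cis (freq k \<bullet> (x + 2 * pi, y)) = cis (freq k \<bullet> (x, y))"
  "cis (freq k \<bullet> (x, y + 2 * pi)) = cis (freq k \<bullet> (x, y))"
proof -
  have "cis (t + 2 * pi * of_int n) = cis t" for t n
    by (simp flip: cis_mult)
  from this[of "freq k \<bullet> (x, y)" "fst k"] this[of "freq k \<bullet> (x, y)" "snd k"]
  show "cis (freq k \<bullet> (x + 2 * pi, y)) = cis (freq k \<bullet> (x, y))"
    "cis (freq k \<bullet> (x, y + 2 * pi)) = cis (freq k \<bullet> (x, y))"
    by (simp_all add: freq_def algebra_simps)
qed

lemma cos_freq_test_function: "(\<lambda>x. cos (freq k \<bullet> x)) \<in> test_functions"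
  and sin_freq_test_function: "(\<lambda>x. sin (freq k \<bullet> x)) \<in> test_functions"
  using smooth_trig[of 1 "freq k" 0] smooth_trig[of 0 "freq k" 1]
    cis_freq_periodic[of k, THEN arg_cong[of _ _ Re]] cis_freq_periodic[of k, THEN arg_cong[of _ _ Im]]
  by (simp_all add: test_functions_def)

lemma integral_cis_period:
  "(LINT t|lborel. indicator {0..2 * pi} t *\<^sub>R cis (of_int n * t)) = (if n = 0 then 2 * pi else 0)"
proof (cases "n = 0")
  case False
  have "(LINT t|lborel. indicator {0..2 * pi} t *\<^sub>R cis (of_int n * t))
    = cis (of_int n * (2 * pi)) / (\<i> * of_int n) - cis (of_int n * 0) / (\<i> * of_int n)"
  proof (rule integral_FTC_atLeastAtMost)
    show "((\<lambda>t. cis (of_int n * t) / (\<i> * of_int n)) has_vector_derivative cis (of_int n * x))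
      (at x within {0..2 * pi})" for x
    proof -
      have "((\<lambda>t. exp (\<i> * of_int n * t) / (\<i> * of_int n)) has_field_derivative exp (\<i> * of_int n * of_real x))
        (at (of_real x))"
        using False by (auto intro!: derivative_eq_intros)
      from has_vector_derivative_real_field[OF this]
      have "((\<lambda>t. exp (\<i> * of_int n * of_real t) / (\<i> * of_int n)) has_vector_derivative exp (\<i> * of_int n * of_real x))
        (at x within {0..2 * pi})" by (rule has_vector_derivative_at_within)
      then show ?thesis by (simp add: cis_conv_exp mult.assoc)
    qed
  qed (auto intro!: continuous_intros)
  moreover have "cis (of_int n * (2 * pi)) = 1"
    by (metis Ints_of_int cis_multiple_2pi mult.commute)
  ultimately show ?thesis using False by simp
qed (simp add: scaleR_conv_of_real)

lemma integral_torus_product: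
  fixes f h :: "real \<Rightarrow> complex"
  assumes "continuous_on UNIV f" "continuous_on UNIV h"
  shows "(LINT x:torus|lborel. f (fst x) * h (snd x)) =
    (LINT t|lborel. indicator {0..2 * pi} t *\<^sub>R f t) * (LINT t|lborel. indicator {0..2 * pi} t *\<^sub>R h t)"
proof -
  let ?I = "{0..2 * pi}"
  have int: "integrable lborel (\<lambda>x. indicator torus x *\<^sub>R (f (fst x) * h (snd x)))"
    by (intro borel_integrable_compact compact_torus continuous_intros
        continuous_on_compose2[OF assms(1)] continuous_on_compose2[OF assms(2)]) auto
  have [simp]: "indicator torus (s, t) = (indicator ?I s * indicator ?I t :: real)" for s t
    by (auto simp: torus_def indicator_def)
  have "(LINT x:torus|lborel. f (fst x) * h (snd x))
    = (LINT x|(lborel \<Otimes>\<^sub>M lborel). indicator torus x *\<^sub>R (f (fst x) * h (snd x)))"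
    by (simp add: set_lebesgue_integral_def lborel_prod)
  also have "\<dots> = (LINT s|lborel. LINT t|lborel. (indicator ?I s *\<^sub>R f s) * (indicator ?I t *\<^sub>R h t))"
    using int by (subst lborel_pair.integral_fst' [symmetric]) (simp_all add: lborel_prod mult.assoc scaleR_conv_of_real mult_ac)
  also have "\<dots> = (LINT s|lborel. (indicator ?I s *\<^sub>R f s) * (LINT t|lborel. indicator ?I t *\<^sub>R h t))"
    by (simp only: integral_mult_right_zero)
  also have "\<dots> = (LINT t|lborel. indicator ?I t *\<^sub>R f t) * (LINT t|lborel. indicator ?I t *\<^sub>R h t)"
    by (simp only: integral_mult_left_zero)
  finally show ?thesis .
qed

lemma integral_torus_cis: "(LINT x:torus|lborel. cis (freq k \<bullet> x)) = (if k = 0 then 4 * pi\<^sup>2 else 0)"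
proof -
  have "cis (freq k \<bullet> x) = cis (of_int (fst k) * fst x) * cis (of_int (snd k) * snd x)" for x
    by (simp add: freq_def inner_prod_def cis_mult)
  then have "(LINT x:torus|lborel. cis (freq k \<bullet> x)) = (LINT t|lborel. indicator {0..2 * pi} t *\<^sub>R cis (of_int (fst k) * t))
    * (LINT t|lborel. indicator {0..2 * pi} t *\<^sub>R cis (of_int (snd k) * t))"
    using integral_torus_product[of "\<lambda>t. cis (of_int (fst k) * t)" "\<lambda>t. cis (of_int (snd k) * t)"]
      continuous_on_cis[OF continuous_on_mult_left[OF continuous_on_id]] by simp
  also have "\<dots> = (if k = 0 then 4 * pi\<^sup>2 else 0)"
    unfolding integral_cis_period by (simp add: prod_eq_iff power2_eq_square)
  finally show ?thesis .
qed

lemma set_integrable_torus: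
  fixes f :: "real \<times> real \<Rightarrow> 'b :: {banach, second_countable_topology}"
  assumes "continuous_on UNIV f"
  shows "set_integrable lborel torus f"
  unfolding set_integrable_def
  by (intro borel_integrable_compact compact_torus continuous_on_subset[OF assms]) simp

definition mode_size :: "real \<Rightarrow> int \<times> int \<Rightarrow> real" where
  "mode_size \<alpha> k = sqrt (1 + norm (freq k) powr (2 * \<alpha>))"

lemma mode_size_pos: "mode_size \<alpha> k > 0"
  by (simp add: mode_size_def add_pos_nonneg)

lemma mode_size_uminus [simp]: "mode_size \<alpha> (- k) = mode_size \<alpha> k"
  by (simp add: mode_size_def)

text \<open>Testing with cos and sin of frequency k and combining them to exp (- i k . x),
  orthogonality leaves a single term of the series. One null set serves for all k, since the
  exceptional set in the definition of the field does not depend on the test function.\<close>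

lemma fourier_coeff_gaussian_field:
  fixes g :: "int \<times> int \<Rightarrow> 'w \<Rightarrow> complex"
  assumes "is_gaussian_field \<alpha> P g \<Phi>"
  shows "AE \<omega> in P. \<forall>k. fourier_coeff (\<Phi> \<omega>) k = 1 / (2 * pi) * (g k \<omega> / of_real (mode_size \<alpha> k))"
proof -
  have "AE \<omega> in P. \<forall>f \<in> test_functions.
        ((\<lambda>k. 1 / (2 * pi) * (g k \<omega> / complex_of_real (mode_size \<alpha> k)) *
              (LINT x:torus|lborel. cis (freq k \<bullet> x) * complex_of_real (f x)))
          has_sum complex_of_real (\<Phi> \<omega> f)) UNIV"
    using assms unfolding is_gaussian_field_def mode_size_def by blast
  then show ?thesis
  proof eventually_elim
    fix \<omega>
    assume S: "\<forall>f \<in> test_functions.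
        ((\<lambda>k. 1 / (2 * pi) * (g k \<omega> / complex_of_real (mode_size \<alpha> k)) *
              (LINT x:torus|lborel. cis (freq k \<bullet> x) * complex_of_real (f x)))
          has_sum complex_of_real (\<Phi> \<omega> f)) UNIV"
    show "\<forall>k. fourier_coeff (\<Phi> \<omega>) k = 1 / (2 * pi) * (g k \<omega> / of_real (mode_size \<alpha> k))"
    proof
      fix k
      let ?c = "\<lambda>l. 1 / (2 * pi) * (g l \<omega> / complex_of_real (mode_size \<alpha> l))"
      let ?C = "\<lambda>l. LINT x:torus|lborel. cis (freq l \<bullet> x) * complex_of_real (cos (freq k \<bullet> x))"
      let ?S = "\<lambda>l. LINT x:torus|lborel. cis (freq l \<bullet> x) * complex_of_real (sin (freq k \<bullet> x))"
      have "((\<lambda>l. ?c l * ?C l + (- \<i>) * (?c l * ?S l)) has_sum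
        complex_of_real (\<Phi> \<omega> (\<lambda>x. cos (freq k \<bullet> x))) + (- \<i>) * complex_of_real (\<Phi> \<omega> (\<lambda>x. sin (freq k \<bullet> x)))) UNIV"
        using bspec[OF S cos_freq_test_function] bspec[OF S sin_freq_test_function]
        by (intro has_sum_add has_sum_cmult_right)
      moreover have "?C l + (- \<i>) * ?S l = (if l = k then 4 * pi\<^sup>2 else 0)" for l
      proof -
        have "?C l + (- \<i>) * ?S l = (LINT x:torus|lborel. cis (freq l \<bullet> x) * complex_of_real (cos (freq k \<bullet> x))
          + (- \<i>) * (cis (freq l \<bullet> x) * complex_of_real (sin (freq k \<bullet> x))))"
          unfolding set_integral_mult_right [symmetric]
          by (rule set_integral_add(2) [symmetric]) (intro set_integrable_torus continuous_intros)+
        also have "(\<lambda>x. cis (freq l \<bullet> x) * complex_of_real (cos (freq k \<bullet> x))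
          + (- \<i>) * (cis (freq l \<bullet> x) * complex_of_real (sin (freq k \<bullet> x)))) = (\<lambda>x. cis (freq (l - k) \<bullet> x))"
          by (simp add: fun_eq_iff complex_eq_iff inner_diff_left cos_diff sin_diff algebra_simps)
        finally show ?thesis unfolding integral_torus_cis by simp
      qed
      then have "?c l * ?C l + (- \<i>) * (?c l * ?S l) = (if l = k then ?c k * (4 * pi\<^sup>2) else 0)" for l
      proof -
        assume eq: "\<And>l. ?C l + (- \<i>) * ?S l = (if l = k then 4 * pi\<^sup>2 else 0)"
        have "c * a + n * (c * b) = c * (a + n * b)" for a b c n :: complex by (simp add: algebra_simps)
        then have "?c l * ?C l + (- \<i>) * (?c l * ?S l) = ?c l * (?C l + (- \<i>) * ?S l)" .
        then show ?thesis unfolding eq by simp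
      qed
      ultimately have "((\<lambda>l. if l = k then ?c k * (4 * pi\<^sup>2) else 0) has_sum
        complex_of_real (\<Phi> \<omega> (\<lambda>x. cos (freq k \<bullet> x))) + (- \<i>) * complex_of_real (\<Phi> \<omega> (\<lambda>x. sin (freq k \<bullet> x)))) UNIV"
        by (simp only:)
      moreover have "((\<lambda>l. if l = k then ?c k * (4 * pi\<^sup>2) else 0) has_sum ?c k * (4 * pi\<^sup>2)) UNIV"
        by (rule has_sum_finite_neutralI[of "{k}"]) auto
      ultimately have "complex_of_real (\<Phi> \<omega> (\<lambda>x. cos (freq k \<bullet> x))) + (- \<i>) * complex_of_real (\<Phi> \<omega> (\<lambda>x. sin (freq k \<bullet> x)))
        = ?c k * (4 * pi\<^sup>2)" by (rule has_sum_unique)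
      then show "fourier_coeff (\<Phi> \<omega>) k = ?c k"
        by (simp add: fourier_coeff_def)
    qed
  qed
qed

text \<open>The sign in the exponent is flipped because the inner product with g conjugates the
  weight.\<close>

definition field_weight :: "real \<Rightarrow> real \<times> real \<Rightarrow> int \<times> int \<Rightarrow> complex" where
  "field_weight \<alpha> x k = cis (- (freq k \<bullet> x)) / of_real (2 * pi * mode_size \<alpha> k)"

lemma fourier_proj_gaussian_field:
  fixes g :: "int \<times> int \<Rightarrow> 'w \<Rightarrow> complex"
  assumes "is_gaussian_field \<alpha> P g \<Phi>"
  shows "AE \<omega> in P. \<forall>N x. fourier_proj N (\<Phi> \<omega>) x = lin_form (modes N) (field_weight \<alpha> x) g \<omega>"
  using fourier_coeff_gaussian_field[OF assms]
proof eventually_elim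
  fix \<omega> assume *: "\<forall>k. fourier_coeff (\<Phi> \<omega>) k = 1 / (2 * pi) * (g k \<omega> / of_real (mode_size \<alpha> k))"
  have "Re (fourier_coeff (\<Phi> \<omega>) k * cis (freq k \<bullet> x)) = field_weight \<alpha> x k \<bullet> g k \<omega>" for k x
    using mode_size_pos[of \<alpha> k] unfolding *[rule_format] field_weight_def
    by (simp add: inner_complex_def Re_divide_of_real Im_divide_of_real field_simps)
  then show "\<forall>N x. fourier_proj N (\<Phi> \<omega>) x = lin_form (modes N) (field_weight \<alpha> x) g \<omega>"
    by (simp add: fourier_proj_def lin_form_def)
qed

lemma finite_modes: "finite (modes N)"
proof (rule finite_subset)
  show "modes N \<subseteq> {- int N..int N} \<times> {- int N..int N}"
  proof
    fix k assume "k \<in> modes N"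
    then have "norm (freq k) \<le> real N" by (simp add: modes_def)
    then have "\<bar>of_int (fst k)\<bar> \<le> real N" "\<bar>of_int (snd k)\<bar> \<le> real N"
      using norm_fst_le[of "of_int (fst k) :: real" "of_int (snd k) :: real"]
        norm_snd_le[of "of_int (snd k) :: real" "of_int (fst k) :: real"]
      by (simp_all add: freq_def)
    then have "\<bar>fst k\<bar> \<le> int N" "\<bar>snd k\<bar> \<le> int N"
      by linarith+
    then show "k \<in> {- int N..int N} \<times> {- int N..int N}"
      by (cases k) auto
  qed
qed simp

lemma modes_uminus: "k \<in> modes N \<Longrightarrow> - k \<in> modes N"
  by (simp add: modes_def)

lemma zero_in_modes: "0 \<in> modes N"
  by (simp add: modes_def)

definition covar :: "real \<Rightarrow> nat \<Rightarrow> real \<times> real \<Rightarrow> real \<times> real \<Rightarrow> real" where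
  "covar \<alpha> N x y = (\<Sum>k\<in>modes N. field_weight \<alpha> x k \<bullet> field_weight \<alpha> y k)"

lemma cmod_field_weight: "(cmod (field_weight \<alpha> x k))\<^sup>2 = 1 / (4 * pi\<^sup>2) * (1 / (1 + norm (freq k) powr (2 * \<alpha>)))"
  using mode_size_pos[of \<alpha> k]
  by (simp add: field_weight_def norm_divide power_divide power_mult_distrib mode_size_def norm_mult
      real_sqrt_pow2 add_nonneg_nonneg)

lemma sum_cmod_field_weight: "(\<Sum>k\<in>modes N. (cmod (field_weight \<alpha> x k))\<^sup>2) = sigma_tilde_sq \<alpha> N"
  by (simp only: cmod_field_weight sigma_tilde_sq_def sum_distrib_left)

lemma field_weight_uminus: "field_weight \<alpha> x (- k) = cnj (field_weight \<alpha> x k)"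
  by (simp add: field_weight_def cis_cnj)

lemma field_weight_0: "field_weight \<alpha> x 0 = 1 / (2 * pi)"
  by (simp add: field_weight_def mode_size_def)

lemma covar_commute: "covar \<alpha> N x y = covar \<alpha> N y x"
  by (simp add: covar_def inner_commute)

lemma sigma_tilde_sq_pos: "sigma_tilde_sq \<alpha> N > 0"
  unfolding sigma_tilde_sq_def
  by (intro mult_pos_pos sum_pos finite_modes)
    (use zero_in_modes in \<open>auto intro!: divide_pos_pos add_pos_nonneg\<close>)

lemma abs_covar_le: "\<bar>covar \<alpha> N x y\<bar> \<le> sigma_tilde_sq \<alpha> N"
proof -
  have "\<bar>covar \<alpha> N x y\<bar> \<le> (\<Sum>k\<in>modes N. \<bar>field_weight \<alpha> x k \<bullet> field_weight \<alpha> y k\<bar>)"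
    unfolding covar_def by (rule sum_abs)
  also have "\<dots> \<le> (\<Sum>k\<in>modes N. (cmod (field_weight \<alpha> x k))\<^sup>2)"
  proof (rule sum_mono)
    fix k
    have "(cmod (field_weight \<alpha> y k))\<^sup>2 = (cmod (field_weight \<alpha> x k))\<^sup>2" by (simp only: cmod_field_weight)
    then have "cmod (field_weight \<alpha> y k) = cmod (field_weight \<alpha> x k)" by simp
    then show "\<bar>field_weight \<alpha> x k \<bullet> field_weight \<alpha> y k\<bar> \<le> (cmod (field_weight \<alpha> x k))\<^sup>2"
      using Cauchy_Schwarz_ineq2[of "field_weight \<alpha> x k" "field_weight \<alpha> y k"]
      by (simp add: power2_eq_square)
  qed
  finally show ?thesis by (simp only: sum_cmod_field_weight)
qed

text \<open>The covariance is the real part of a trigonometric polynomial in \<open>x\<close>, to which Parseval applies.\<close>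

lemma integral_covar_sq:
  "(LINT x:torus|lborel. (covar \<alpha> N x y)\<^sup>2) \<le> sigma_tilde_sq \<alpha> N"
proof -
  define d where "d k = 1 / (4 * pi\<^sup>2) * (1 / (1 + norm (freq k) powr (2 * \<alpha>)))" for k
  define \<Gamma> where "\<Gamma> x = (\<Sum>k\<in>modes N. complex_of_real (d k) * cis (freq k \<bullet> (x - y)))" for x
  have d: "0 \<le> d k" "d k \<le> 1 / (4 * pi\<^sup>2)" for k
    unfolding d_def by (auto intro!: mult_right_le_one_le divide_le_eq_1_pos[THEN iffD2] add_pos_nonneg
        mult_nonneg_nonneg divide_nonneg_nonneg add_nonneg_nonneg simp del: times_divide_eq_left times_divide_eq_right)
  have "field_weight \<alpha> x k \<bullet> field_weight \<alpha> y k = Re (complex_of_real (d k) * cis (freq k \<bullet> (x - y)))" for x k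
  proof -
    have "field_weight \<alpha> x k \<bullet> field_weight \<alpha> y k
      = cos (freq k \<bullet> x - freq k \<bullet> y) / (2 * pi * mode_size \<alpha> k)\<^sup>2"
      by (simp add: field_weight_def inner_complex_def cos_diff Re_divide_of_real Im_divide_of_real
          power2_eq_square add_divide_distrib)
    also have "\<dots> = d k * cos (freq k \<bullet> (x - y))"
      by (simp add: d_def mode_size_def power_mult_distrib inner_diff_right add_nonneg_nonneg)
    finally show ?thesis by simp
  qed
  then have covar: "covar \<alpha> N x y = Re (\<Gamma> x)" for x by (simp add: covar_def \<Gamma>_def)
  have cont: "continuous_on UNIV \<Gamma>" unfolding \<Gamma>_def by (intro continuous_intros)
  \<comment> \<open>Replacing the squared real part by the squared modulus gives a double sum of
    characters, which can be integrated term by term.\<close>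
  have "(LINT x:torus|lborel. (covar \<alpha> N x y)\<^sup>2) \<le> (LINT x:torus|lborel. Re (\<Gamma> x * cnj (\<Gamma> x)))"
    unfolding covar
  proof (rule set_integral_mono)
    show "(Re (\<Gamma> x))\<^sup>2 \<le> Re (\<Gamma> x * cnj (\<Gamma> x))" for x
      by (simp add: power2_eq_square)
  qed (intro set_integrable_torus continuous_intros cont)+
  also have "\<dots> = Re (LINT x:torus|lborel. \<Gamma> x * cnj (\<Gamma> x))"
    using set_integrable_torus[of "\<lambda>x. \<Gamma> x * cnj (\<Gamma> x)", OF continuous_on_mult[OF cont continuous_on_cnj[OF cont]]]
    unfolding set_lebesgue_integral_def set_integrable_def
    by (subst integral_Re [symmetric]) (auto simp del: times_complex.simps)
  also have "(LINT x:torus|lborel. \<Gamma> x * cnj (\<Gamma> x)) = (LINT x:torus|lborel.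
      \<Sum>k\<in>modes N. \<Sum>l\<in>modes N. complex_of_real (d k * d l) * cis (freq (l - k) \<bullet> y) * cis (freq (k - l) \<bullet> x))"
    unfolding \<Gamma>_def cnj_sum sum_product
    by (intro set_lebesgue_integral_cong)
      (auto simp: cis_cnj cis_mult inner_diff_left inner_diff_right algebra_simps intro!: sum.cong)
  also have "\<dots> = (\<Sum>k\<in>modes N. \<Sum>l\<in>modes N. complex_of_real (d k * d l) * cis (freq (l - k) \<bullet> y) *
      (LINT x:torus|lborel. cis (freq (k - l) \<bullet> x)))"
  proof -
    have "integrable lborel (\<lambda>x. indicator torus x *\<^sub>R (c * cis (\<xi> \<bullet> x)))" for c \<xi>
      by (intro borel_integrable_compact compact_torus continuous_intros)
    moreover have "(LINT x|lborel. indicator torus x *\<^sub>R (c * cis (\<xi> \<bullet> x))) = c * (LINT x|lborel. indicator torus x *\<^sub>R cis (\<xi> \<bullet> x))" for c \<xi>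
      unfolding mult_scaleR_right [symmetric] by (rule integral_mult_right_zero)
    ultimately show ?thesis
      unfolding set_lebesgue_integral_def scaleR_sum_right
      by (simp add: Bochner_Integration.integral_sum del: freq_simps)
  qed
  also have "\<dots> = (\<Sum>k\<in>modes N. \<Sum>l\<in>modes N. if l = k then of_real (4 * pi\<^sup>2 * (d k)\<^sup>2) else 0)"
  proof -
    have "complex_of_real (d k * d l) * cis (freq (l - k) \<bullet> y) * (LINT x:torus|lborel. cis (freq (k - l) \<bullet> x))
      = (if l = k then of_real (4 * pi\<^sup>2 * (d k)\<^sup>2) else 0)" for k l
      unfolding integral_torus_cis by (cases "l = k") (simp_all add: power2_eq_square)
    then show ?thesis by (simp only:)
  qed
  also have "\<dots> = of_real (\<Sum>k\<in>modes N. 4 * pi\<^sup>2 * (d k)\<^sup>2)"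
    using finite_modes by simp
  also have "Re \<dots> = (\<Sum>k\<in>modes N. (4 * pi\<^sup>2 * d k) * d k)"
    by (simp add: power2_eq_square mult.assoc)
  \<comment> \<open>Since \<open>4 * pi\<^sup>2 * d k\<close> is at most 1, the bound stays linear
    in the variance instead of quadratic. The second moment estimate rests on this gain.\<close>
  also have "\<dots> \<le> (\<Sum>k\<in>modes N. 1 * d k)"
    using d by (intro sum_mono mult_right_mono) (auto simp: field_simps)
  also have "\<dots> = sigma_tilde_sq \<alpha> N"
    by (simp add: d_def sigma_tilde_sq_def sum_distrib_left)
  finally show ?thesis .
qed

section \<open>The energy of the truncated field\<close>

text \<open>A measure space of its own rather than a set integral, so that products with P and with
  a second copy of the torus can be formed for Fubini.\<close>

definition torus_measure :: "(real \<times> real) measure" where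
  "torus_measure = restrict_space lborel torus"

lemma space_torus_measure [simp]: "space torus_measure = torus"
  by (simp add: torus_measure_def space_restrict_space)

lemma sets_torus_measure [measurable_cong]: "sets torus_measure = sets (restrict_space borel torus)"
  by (simp add: torus_measure_def sets_restrict_space)

lemma integral_torus_measure:
  fixes f :: "real \<times> real \<Rightarrow> 'b :: {banach, second_countable_topology}"
  shows "(\<integral>x. f x \<partial>torus_measure) = (LINT x:torus|lborel. f x)"
  unfolding torus_measure_def set_lebesgue_integral_def by (rule integral_restrict_space) simp

lemma emeasure_torus: "emeasure torus_measure torus = ennreal (4 * pi\<^sup>2)"
proof -
  have "emeasure torus_measure torus = emeasure lborel torus"
    by (simp add: torus_measure_def emeasure_restrict_space)
  also have "\<dots> = ennreal (4 * pi\<^sup>2)"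
    unfolding torus_eq_cbox by (subst emeasure_lborel_cbox) (auto simp: Basis_prod_def power2_eq_square)
  finally show ?thesis .
qed

lemma finite_measure_torus_measure: "finite_measure torus_measure"
  by (rule finite_measureI) (simp add: emeasure_torus)

lemma measure_torus: "measure torus_measure torus = 4 * pi\<^sup>2"
  by (simp add: measure_def emeasure_torus)

lemma measurable_torus_measure:
  "f \<in> borel_measurable borel \<Longrightarrow> f \<in> borel_measurable torus_measure"
  unfolding torus_measure_def by (rule measurable_restrict_space1) simp

text \<open>The bound C on the absolute moments, uniform in x, together with finiteness of T gives
  integrability on the product; the rest is Fubini.\<close>

lemma
  fixes f :: "'a \<Rightarrow> 'b \<Rightarrow> real"
  assumes T: "finite_measure T" and P: "sigma_finite_measure P"
    and f [measurable]: "(\<lambda>(x, \<omega>). f x \<omega>) \<in> borel_measurable (T \<Otimes>\<^sub>M P)"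
    and int: "\<And>x. x \<in> space T \<Longrightarrow> integrable P (f x)"
    and bound: "\<And>x. x \<in> space T \<Longrightarrow> (\<integral>\<omega>. \<bar>f x \<omega>\<bar> \<partial>P) \<le> C"
  shows integrable_integral_swap: "integrable P (\<lambda>\<omega>. \<integral>x. f x \<omega> \<partial>T)"
    and integral_swap: "(\<integral>\<omega>. (\<integral>x. f x \<omega> \<partial>T) \<partial>P) = (\<integral>x. (\<integral>\<omega>. f x \<omega> \<partial>P) \<partial>T)"
proof -
  interpret T: finite_measure T by fact
  interpret P: sigma_finite_measure P by fact
  interpret TP: pair_sigma_finite T P ..
  have "integrable (T \<Otimes>\<^sub>M P) (\<lambda>(x, \<omega>). f x \<omega>)"
  proof (rule TP.Fubini_integrable)
    show "integrable T (\<lambda>x. \<integral>\<omega>. norm (case (x, \<omega>) of (x, \<omega>) \<Rightarrow> f x \<omega>) \<partial>P)"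
    proof (rule T.integrable_const_bound[where B = C])
      show "AE x in T. norm (\<integral>\<omega>. norm (case (x, \<omega>) of (x, \<omega>) \<Rightarrow> f x \<omega>) \<partial>P) \<le> C"
        using bound by (intro AE_I2) simp
    qed measurable
    show "AE x in T. integrable P (\<lambda>\<omega>. case (x, \<omega>) of (x, \<omega>) \<Rightarrow> f x \<omega>)"
      using int by simp
  qed fact
  then show "integrable P (\<lambda>\<omega>. \<integral>x. f x \<omega> \<partial>T)"
    "(\<integral>\<omega>. (\<integral>x. f x \<omega> \<partial>T) \<partial>P) = (\<integral>x. (\<integral>\<omega>. f x \<omega> \<partial>P) \<partial>T)"
    by (rule TP.integrable_snd, rule TP.Fubini_integral)
qed

lemma abs_mult_le_squares: "\<bar>a * b\<bar> \<le> a * a + b * b" for a b :: real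
proof -
  have "2 * (\<bar>a\<bar> * \<bar>b\<bar>) \<le> a * a + b * b"
    using sum_squares_bound[of "\<bar>a\<bar>" "\<bar>b\<bar>"] by (simp add: power2_eq_square mult.assoc)
  moreover have "0 \<le> \<bar>a\<bar> * \<bar>b\<bar>" by simp
  ultimately show ?thesis unfolding abs_mult by linarith
qed

lemma field_weight_measurable [measurable]: "(\<lambda>x. field_weight \<alpha> x k) \<in> borel_measurable torus_measure"
  unfolding field_weight_def
  by (intro measurable_torus_measure borel_measurable_continuous_onI continuous_intros)
    (use mode_size_pos in \<open>auto simp: less_imp_neq [symmetric]\<close>)

text \<open>Without a term j = 0 the mean under the unshifted law is 0. The term j = 1 lets this
  family contain all of \<open>V_tilde\<close>, including its quadratic part.\<close>

definition even_chaos :: "(nat \<Rightarrow> real) \<Rightarrow> nat \<Rightarrow> real \<Rightarrow> real poly" where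
  "even_chaos b m v = (\<Sum>j=1..m. smult (b j) (hermite_poly (2 * j) v))"

lemma poly_even_chaos: "poly (even_chaos b m v) y = (\<Sum>j=1..m. b j * hermite (2 * j) y v)"
  by (simp add: even_chaos_def poly_sum hermite_eq_poly)

context gaussian_field_coefficients
begin

definition field :: "real \<Rightarrow> nat \<Rightarrow> real \<times> real \<Rightarrow> 'w \<Rightarrow> real" where
  "field \<alpha> N x = lin_form (modes N) (field_weight \<alpha> x) g"

text \<open>This is the real part of \<open>g 0\<close>, written as a form over
  \<open>modes N\<close> so that it can be paired with the field.\<close>

definition zero_mode :: "nat \<Rightarrow> 'w \<Rightarrow> real" where
  "zero_mode N = lin_form (modes N) (\<lambda>k. if k = 0 then 1 else 0) g"

lemma jointly_gaussian_field:
  "jointly_gaussian P (field \<alpha> N x) (field \<alpha> N y) (sigma_tilde_sq \<alpha> N) (covar \<alpha> N x y) (sigma_tilde_sq \<alpha> N)"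
  using jointly_gaussian_lin_form[OF finite_modes modes_uminus, of N "field_weight \<alpha> x" "field_weight \<alpha> y"]
  by (simp add: field_weight_uminus sum_cmod_field_weight field_def covar_def)

text \<open>The two weights overlap only at k = 0, so the covariance is the same at every x: tilting
  with parameter t shifts the whole field by the constant t / (2 pi).\<close>

lemma jointly_gaussian_zero_mode:
  "jointly_gaussian P (field \<alpha> N x) (zero_mode N) (sigma_tilde_sq \<alpha> N) (1 / (2 * pi)) 1"
proof -
  let ?e = "\<lambda>k :: int \<times> int. if k = 0 then 1 else 0 :: complex"
  have "field_weight \<alpha> x k \<bullet> ?e k = (if k = 0 then 1 / (2 * pi) else 0)" for k
    by (simp add: field_weight_0 inner_complex_def)
  then have "(\<Sum>k\<in>modes N. field_weight \<alpha> x k \<bullet> ?e k) = 1 / (2 * pi)"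
    using zero_in_modes finite_modes by (simp only: sum.delta) simp
  moreover have "(cmod (?e k))\<^sup>2 = (if k = 0 then 1 else 0)" for k by simp
  then have "(\<Sum>k\<in>modes N. (cmod (?e k))\<^sup>2) = 1"
    using zero_in_modes finite_modes by (simp only: sum.delta) simp
  moreover have "?e (- k) = cnj (?e k)" for k by simp
  ultimately show ?thesis
    using jointly_gaussian_lin_form[OF finite_modes modes_uminus, of N "field_weight \<alpha> x" ?e]
    unfolding field_def zero_mode_def by (simp only: field_weight_uminus sum_cmod_field_weight)
qed

lemma field_measurable [measurable]: "field \<alpha> N x \<in> borel_measurable P"
  by (simp add: field_def)

lemma zero_mode_measurable [measurable]: "zero_mode N \<in> borel_measurable P"
  by (simp add: zero_mode_def)

lemma continuous_on_field: "continuous_on A (\<lambda>x. field \<alpha> N x \<omega>)"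
  unfolding field_def lin_form_def field_weight_def
  by (intro continuous_intros) (use mode_size_pos in \<open>auto simp: less_imp_neq [symmetric]\<close>)

lemma field_jointly_measurable:
  "(\<lambda>(x, \<omega>). field \<alpha> N x \<omega>) \<in> borel_measurable (torus_measure \<Otimes>\<^sub>M P)"
  unfolding field_def lin_form_def by measurable

lemma
  shows integrable_tilted_chaos:
      "integrable P (\<lambda>\<omega>. exp (t * zero_mode N \<omega> - t\<^sup>2 / 2) * poly p (field \<alpha> N x \<omega>))"
    and integral_tilted_chaos:
      "(\<integral>\<omega>. exp (t * zero_mode N \<omega> - t\<^sup>2 / 2) * poly (even_chaos b m (sigma_tilde_sq \<alpha> N)) (field \<alpha> N x \<omega>) \<partial>P)
        = (\<Sum>j=1..m. b j * (t / (2 * pi)) ^ (2 * j))"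
proof -
  note J = jointly_gaussian_zero_mode[of \<alpha> N x]
  have int: "integrable P (\<lambda>\<omega>. exp (t * zero_mode N \<omega> - t\<^sup>2 / 2) * poly p (field \<alpha> N x \<omega>))" for p
  proof (rule Bochner_Integration.integrable_bound)
    show "integrable P (\<lambda>\<omega>. poly p (field \<alpha> N x \<omega>) * poly 1 (zero_mode N \<omega>) *
        exp (0 * \<bar>field \<alpha> N x \<omega>\<bar> + \<bar>t\<bar> * \<bar>zero_mode N \<omega>\<bar>))"
      by (rule integrable_poly_poly_exp[OF J, of p 1 0 "\<bar>t\<bar>"])
    have tz: "t * z - t\<^sup>2 / 2 \<le> \<bar>t\<bar> * \<bar>z\<bar>" for z
      using abs_ge_self[of "t * z"] zero_le_power2[of t] unfolding abs_mult by linarith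
    show "AE \<omega> in P. norm (exp (t * zero_mode N \<omega> - t\<^sup>2 / 2) * poly p (field \<alpha> N x \<omega>))
      \<le> norm (poly p (field \<alpha> N x \<omega>) * poly 1 (zero_mode N \<omega>) *
        exp (0 * \<bar>field \<alpha> N x \<omega>\<bar> + \<bar>t\<bar> * \<bar>zero_mode N \<omega>\<bar>))"
      by (intro AE_I2) (auto simp: abs_mult mult.commute[of "exp _"] tz intro!: mult_left_mono)
  qed simp
  then show "integrable P (\<lambda>\<omega>. exp (t * zero_mode N \<omega> - t\<^sup>2 / 2) * poly p (field \<alpha> N x \<omega>))" .
  have "(\<integral>\<omega>. exp (t * zero_mode N \<omega> - t\<^sup>2 / 2) * poly (even_chaos b m (sigma_tilde_sq \<alpha> N)) (field \<alpha> N x \<omega>) \<partial>P)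
    = (\<integral>\<omega>. (\<Sum>j=1..m. b j * (exp (t * zero_mode N \<omega> - t\<^sup>2 / 2) * hermite (2 * j) (field \<alpha> N x \<omega>) (sigma_tilde_sq \<alpha> N))) \<partial>P)"
    by (simp add: poly_even_chaos sum_distrib_left mult.left_commute)
  also have "\<dots> = (\<Sum>j=1..m. b j * (t * (1 / (2 * pi))) ^ (2 * j))"
    using int integral_hermite_exp_tilt[OF J, of t]
    by (subst Bochner_Integration.integral_sum) (simp_all add: hermite_eq_poly)
  finally show "(\<integral>\<omega>. exp (t * zero_mode N \<omega> - t\<^sup>2 / 2) * poly (even_chaos b m (sigma_tilde_sq \<alpha> N)) (field \<alpha> N x \<omega>) \<partial>P)
        = (\<Sum>j=1..m. b j * (t / (2 * pi)) ^ (2 * j))" by simp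
qed

lemma
  shows integrable_poly_field_poly_field: "integrable P (\<lambda>\<omega>. poly p (field \<alpha> N x \<omega>) * poly q (field \<alpha> N y \<omega>))"
    and integral_chaos_chaos:
      "(\<integral>\<omega>. poly (even_chaos b m (sigma_tilde_sq \<alpha> N)) (field \<alpha> N x \<omega>) *
            poly (even_chaos b m (sigma_tilde_sq \<alpha> N)) (field \<alpha> N y \<omega>) \<partial>P)
        = (\<Sum>j=1..m. (b j)\<^sup>2 * (fact (2 * j) * covar \<alpha> N x y ^ (2 * j)))"
proof -
  note J = jointly_gaussian_field[of \<alpha> N x y]
  let ?v = "sigma_tilde_sq \<alpha> N"
  have int: "integrable P (\<lambda>\<omega>. poly p (field \<alpha> N x \<omega>) * poly q (field \<alpha> N y \<omega>))" for p q
    using integrable_poly_poly_exp[OF J, of p q 0 0] by simp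
  then show "integrable P (\<lambda>\<omega>. poly p (field \<alpha> N x \<omega>) * poly q (field \<alpha> N y \<omega>))" .
  have "(\<integral>\<omega>. poly (even_chaos b m ?v) (field \<alpha> N x \<omega>) * poly (even_chaos b m ?v) (field \<alpha> N y \<omega>) \<partial>P)
    = (\<integral>\<omega>. (\<Sum>i=1..m. \<Sum>j=1..m. b i * b j * (hermite (2 * i) (field \<alpha> N x \<omega>) ?v * hermite (2 * j) (field \<alpha> N y \<omega>) ?v)) \<partial>P)"
    by (simp add: poly_even_chaos sum_product mult.assoc mult.left_commute)
  also have "\<dots> = (\<Sum>i=1..m. \<Sum>j=1..m. b i * b j * (if 2 * i = 2 * j then fact (2 * j) * covar \<alpha> N x y ^ (2 * j) else 0))"
    using int integral_hermite_hermite[OF jointly_gaussian_swap[OF J]]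
    by (simp add: hermite_eq_poly Bochner_Integration.integral_sum Bochner_Integration.integrable_sum)
  also have "\<dots> = (\<Sum>i=1..m. (b i)\<^sup>2 * (fact (2 * i) * covar \<alpha> N x y ^ (2 * i)))"
    by (intro sum.cong refl) (simp add: if_distrib power2_eq_square cong: if_cong)
  finally show "(\<integral>\<omega>. poly (even_chaos b m ?v) (field \<alpha> N x \<omega>) * poly (even_chaos b m ?v) (field \<alpha> N y \<omega>) \<partial>P)
        = (\<Sum>j=1..m. (b j)\<^sup>2 * (fact (2 * j) * covar \<alpha> N x y ^ (2 * j)))" .
qed

definition energy :: "real \<Rightarrow> real poly \<Rightarrow> nat \<Rightarrow> 'w \<Rightarrow> real" where
  "energy \<alpha> p N \<omega> = (\<integral>x. poly p (field \<alpha> N x \<omega>) \<partial>torus_measure)"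

lemma energy_measurable [measurable]: "energy \<alpha> p N \<in> borel_measurable P"
proof -
  interpret T: finite_measure torus_measure by (rule finite_measure_torus_measure)
  have "(\<lambda>(\<omega>, x). poly p (field \<alpha> N x \<omega>)) \<in> borel_measurable (P \<Otimes>\<^sub>M torus_measure)"
    using borel_measurable_poly[OF measurable_compose[OF measurable_pair_swap' field_jointly_measurable], of p]
    by (simp add: split_beta')
  then show ?thesis unfolding energy_def [abs_def]
    by (rule T.borel_measurable_lebesgue_integral)
qed

lemma
  shows integrable_tilted_energy:
      "integrable P (\<lambda>\<omega>. exp (t * zero_mode N \<omega> - t\<^sup>2 / 2) * energy \<alpha> (even_chaos b m (sigma_tilde_sq \<alpha> N)) N \<omega>)"
    and integral_tilted_energy:
      "(\<integral>\<omega>. exp (t * zero_mode N \<omega> - t\<^sup>2 / 2) * energy \<alpha> (even_chaos b m (sigma_tilde_sq \<alpha> N)) N \<omega> \<partial>P)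
        = 4 * pi\<^sup>2 * (\<Sum>j=1..m. b j * (t / (2 * pi)) ^ (2 * j))"
proof -
  let ?p = "even_chaos b m (sigma_tilde_sq \<alpha> N)" and ?W = "\<lambda>\<omega>. exp (t * zero_mode N \<omega> - t\<^sup>2 / 2)"
  \<comment> \<open>From |W Y| <= W^2 + Y^2. Neither expectation depends on x, which gives the
    uniform bound needed for interchanging the integrals.\<close>
  define C where "C = (\<integral>\<omega>. (?W \<omega>)\<^sup>2 \<partial>P) + (\<Sum>j=1..m. (b j)\<^sup>2 * (fact (2 * j) * sigma_tilde_sq \<alpha> N ^ (2 * j)))"
  \<comment> \<open>Up to the constant \<open>exp (t\<^sup>2)\<close>, the squared tilt is the tilt
    with parameter 2 t.\<close>
  have W2: "integrable P (\<lambda>\<omega>. (?W \<omega>)\<^sup>2)"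
    using integrable_mult_right[OF integrable_tilted_chaos[of "2 * t" N 1 \<alpha> 0], of "exp (t\<^sup>2)"]
    by (simp add: power2_eq_square mult_exp_exp algebra_simps)
  have meas: "(\<lambda>(x, \<omega>). ?W \<omega> * poly ?p (field \<alpha> N x \<omega>)) \<in> borel_measurable (torus_measure \<Otimes>\<^sub>M P)"
    using borel_measurable_poly[OF field_jointly_measurable] by (simp add: split_beta')
  have bound: "(\<integral>\<omega>. \<bar>?W \<omega> * poly ?p (field \<alpha> N x \<omega>)\<bar> \<partial>P) \<le> C" for x
  proof -
    have "(\<integral>\<omega>. \<bar>?W \<omega> * poly ?p (field \<alpha> N x \<omega>)\<bar> \<partial>P)
      \<le> (\<integral>\<omega>. (?W \<omega>)\<^sup>2 + poly ?p (field \<alpha> N x \<omega>) * poly ?p (field \<alpha> N x \<omega>) \<partial>P)"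
    proof (rule integral_mono)
      fix \<omega>
      show "\<bar>?W \<omega> * poly ?p (field \<alpha> N x \<omega>)\<bar> \<le> (?W \<omega>)\<^sup>2 + poly ?p (field \<alpha> N x \<omega>) * poly ?p (field \<alpha> N x \<omega>)"
        unfolding power2_eq_square by (rule abs_mult_le_squares)
    qed (intro integrable_abs integrable_tilted_chaos Bochner_Integration.integrable_add W2
        integrable_poly_field_poly_field)+
    also have "\<dots> = C"
      using sum_cmod_field_weight[where \<alpha> = \<alpha> and x = x and N = N]
      by (subst Bochner_Integration.integral_add[OF W2 integrable_poly_field_poly_field])
        (simp add: C_def integral_chaos_chaos covar_def power2_norm_eq_inner)
    finally show ?thesis .
  qed
  have E: "?W \<omega> * energy \<alpha> ?p N \<omega> = (\<integral>x. ?W \<omega> * poly ?p (field \<alpha> N x \<omega>) \<partial>torus_measure)" for \<omega>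
    by (simp add: energy_def)
  note F = finite_measure_torus_measure sigma_finite_measure_axioms meas integrable_tilted_chaos bound
  show "integrable P (\<lambda>\<omega>. ?W \<omega> * energy \<alpha> ?p N \<omega>)"
    unfolding E by (rule integrable_integral_swap[OF F])
  have "(\<integral>\<omega>. ?W \<omega> * energy \<alpha> ?p N \<omega> \<partial>P) = (\<integral>x. (\<integral>\<omega>. ?W \<omega> * poly ?p (field \<alpha> N x \<omega>) \<partial>P) \<partial>torus_measure)"
    unfolding E by (rule integral_swap[OF F])
  then show "(\<integral>\<omega>. ?W \<omega> * energy \<alpha> ?p N \<omega> \<partial>P) = 4 * pi\<^sup>2 * (\<Sum>j=1..m. b j * (t / (2 * pi)) ^ (2 * j))"
    by (simp add: integral_tilted_chaos measure_torus)
qed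

text \<open>The square is a double integral over the torus, and orthogonality leaves for each j the
  power 2 j of the covariance. Two of these factors are kept for Parseval in one variable, which
  costs one power of the variance; bounding the other 2 j - 2 by the variance yields the exponent 2
  j - 1.\<close>

lemma
  shows integrable_energy_sq: "integrable P (\<lambda>\<omega>. (energy \<alpha> (even_chaos b m (sigma_tilde_sq \<alpha> N)) N \<omega>)\<^sup>2)"
    and integral_energy_sq_le: "(\<integral>\<omega>. (energy \<alpha> (even_chaos b m (sigma_tilde_sq \<alpha> N)) N \<omega>)\<^sup>2 \<partial>P)
      \<le> 4 * pi\<^sup>2 * (\<Sum>j=1..m. (b j)\<^sup>2 * fact (2 * j) * sigma_tilde_sq \<alpha> N ^ (2 * j - 1))"
proof -
  let ?v = "sigma_tilde_sq \<alpha> N"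
  let ?p = "even_chaos b m ?v" and ?T = "torus_measure \<Otimes>\<^sub>M torus_measure"
  interpret T: finite_measure torus_measure by (rule finite_measure_torus_measure)
  interpret TT: pair_sigma_finite torus_measure torus_measure ..
  have fin: "finite_measure ?T" by (rule finite_measure_pair_measure) (rule finite_measure_torus_measure)+
  define C where "C = (\<Sum>j=1..m. (b j)\<^sup>2 * (fact (2 * j) * ?v ^ (2 * j)))"
  have cv: "covar \<alpha> N x x = ?v" for x
    using sum_cmod_field_weight[where \<alpha> = \<alpha> and x = x and N = N] by (simp add: covar_def power2_norm_eq_inner)
  have meas: "(\<lambda>(z, \<omega>). poly ?p (field \<alpha> N (fst z) \<omega>) * poly ?p (field \<alpha> N (snd z) \<omega>)) \<in> borel_measurable (?T \<Otimes>\<^sub>M P)"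
  proof -
    have "(\<lambda>z. (fst (fst z), snd z)) \<in> measurable (?T \<Otimes>\<^sub>M P) (torus_measure \<Otimes>\<^sub>M P)"
      "(\<lambda>z. (snd (fst z), snd z)) \<in> measurable (?T \<Otimes>\<^sub>M P) (torus_measure \<Otimes>\<^sub>M P)"
      by measurable
    from this[THEN measurable_compose, OF borel_measurable_poly[OF field_jointly_measurable]]
    show ?thesis by (simp add: split_beta')
  qed
  have bound: "(\<integral>\<omega>. \<bar>poly ?p (field \<alpha> N (fst z) \<omega>) * poly ?p (field \<alpha> N (snd z) \<omega>)\<bar> \<partial>P) \<le> 2 * C" for z
  proof -
    obtain x y where z: "z = (x, y)" by (cases z)
    have "(\<integral>\<omega>. \<bar>poly ?p (field \<alpha> N x \<omega>) * poly ?p (field \<alpha> N y \<omega>)\<bar> \<partial>P)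
      \<le> (\<integral>\<omega>. poly ?p (field \<alpha> N x \<omega>) * poly ?p (field \<alpha> N x \<omega>) + poly ?p (field \<alpha> N y \<omega>) * poly ?p (field \<alpha> N y \<omega>) \<partial>P)"
    proof (rule integral_mono)
      fix \<omega>
      show "\<bar>poly ?p (field \<alpha> N x \<omega>) * poly ?p (field \<alpha> N y \<omega>)\<bar> \<le>
        poly ?p (field \<alpha> N x \<omega>) * poly ?p (field \<alpha> N x \<omega>) + poly ?p (field \<alpha> N y \<omega>) * poly ?p (field \<alpha> N y \<omega>)"
        by (rule abs_mult_le_squares)
    qed (intro integrable_abs Bochner_Integration.integrable_add integrable_poly_field_poly_field)+
    also have "\<dots> = 2 * C"
      by (subst Bochner_Integration.integral_add[OF integrable_poly_field_poly_field integrable_poly_field_poly_field])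
        (simp add: C_def integral_chaos_chaos cv)
    finally show ?thesis by (simp add: z)
  qed
  have E: "(energy \<alpha> ?p N \<omega>)\<^sup>2 = (\<integral>z. poly ?p (field \<alpha> N (fst z) \<omega>) * poly ?p (field \<alpha> N (snd z) \<omega>) \<partial>?T)" for \<omega>
  proof -
    let ?f = "\<lambda>x. poly ?p (field \<alpha> N x \<omega>)"
    have cont: "continuous_on A ?f" for A
      using continuous_on_field[of A \<alpha> N \<omega>] by (rule continuous_on_poly)
    have f [measurable]: "?f \<in> borel_measurable torus_measure"
      by (intro measurable_torus_measure borel_measurable_continuous_onI cont)
    have "bounded (?f ` torus)"
      by (intro compact_imp_bounded compact_continuous_image compact_torus cont)
    then obtain B where B: "\<And>x. x \<in> torus \<Longrightarrow> \<bar>?f x\<bar> \<le> B" by (auto simp: bounded_iff)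
    have "integrable ?T (\<lambda>z. ?f (fst z) * ?f (snd z))"
    proof (rule finite_measure.integrable_const_bound[OF fin, where B = "B * B"])
      show "AE z in ?T. norm (?f (fst z) * ?f (snd z)) \<le> B * B"
      proof (rule AE_I2)
        fix z assume "z \<in> space ?T"
        then have "\<bar>?f (fst z)\<bar> \<le> B" "\<bar>?f (snd z)\<bar> \<le> B" using B by (auto simp: space_pair_measure)
        then show "norm (?f (fst z) * ?f (snd z)) \<le> B * B"
          unfolding real_norm_def abs_mult by (intro mult_mono) (auto intro: order_trans[OF abs_ge_zero])
      qed
    qed measurable
    then have "(\<integral>z. ?f (fst z) * ?f (snd z) \<partial>?T) = (\<integral>x. (\<integral>y. ?f x * ?f y \<partial>torus_measure) \<partial>torus_measure)"
      by (subst TT.integral_fst' [symmetric]) simp_all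
    then show ?thesis by (simp add: energy_def power2_eq_square)
  qed
  note F = fin sigma_finite_measure_axioms meas integrable_poly_field_poly_field bound
  show "integrable P (\<lambda>\<omega>. (energy \<alpha> ?p N \<omega>)\<^sup>2)"
    unfolding E by (rule integrable_integral_swap[OF F])
  have covar_meas: "(\<lambda>z. covar \<alpha> N (fst z) (snd z)) \<in> borel_measurable ?T"
    unfolding covar_def by measurable
  have int: "integrable ?T (\<lambda>z. (covar \<alpha> N (fst z) (snd z)) ^ k)" for k
    using abs_covar_le[of \<alpha> N] covar_meas
    by (intro finite_measure.integrable_const_bound[OF fin, where B = "?v ^ k"])
      (auto simp: power_abs intro!: AE_I2 power_mono)
  have "(\<integral>\<omega>. (energy \<alpha> ?p N \<omega>)\<^sup>2 \<partial>P)
    = (\<integral>z. (\<Sum>j=1..m. (b j)\<^sup>2 * (fact (2 * j) * covar \<alpha> N (fst z) (snd z) ^ (2 * j))) \<partial>?T)"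
    unfolding E by (subst integral_swap[OF F]) (simp add: integral_chaos_chaos)
  also have "\<dots> \<le> (\<integral>z. (\<Sum>j=1..m. (b j)\<^sup>2 * fact (2 * j) * ?v ^ (2 * j - 2)) * (covar \<alpha> N (fst z) (snd z))\<^sup>2 \<partial>?T)"
  proof (rule integral_mono)
    show "(\<Sum>j=1..m. (b j)\<^sup>2 * (fact (2 * j) * covar \<alpha> N (fst z) (snd z) ^ (2 * j))) \<le>
      (\<Sum>j=1..m. (b j)\<^sup>2 * fact (2 * j) * ?v ^ (2 * j - 2)) * (covar \<alpha> N (fst z) (snd z))\<^sup>2" for z
      unfolding sum_distrib_right
    proof (rule sum_mono)
      fix j assume j: "j \<in> {1..m}"
      let ?c = "covar \<alpha> N (fst z) (snd z)"
      have "?c ^ (2 * j) = \<bar>?c\<bar> ^ (2 * j - 2) * ?c\<^sup>2"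
        using j by (cases j) (simp_all add: power_even_abs power2_eq_square)
      also have "\<dots> \<le> ?v ^ (2 * j - 2) * ?c\<^sup>2"
        using abs_covar_le by (intro mult_right_mono power_mono) auto
      finally have "(b j)\<^sup>2 * (fact (2 * j) * ?c ^ (2 * j)) \<le> (b j)\<^sup>2 * (fact (2 * j) * (?v ^ (2 * j - 2) * ?c\<^sup>2))"
        by (intro mult_left_mono) auto
      then show "(b j)\<^sup>2 * (fact (2 * j) * ?c ^ (2 * j)) \<le> (b j)\<^sup>2 * fact (2 * j) * ?v ^ (2 * j - 2) * ?c\<^sup>2"
        by (simp add: mult.assoc)
    qed
  qed (intro Bochner_Integration.integrable_sum integrable_mult_right int)+
  also have "\<dots> = (\<Sum>j=1..m. (b j)\<^sup>2 * fact (2 * j) * ?v ^ (2 * j - 2)) * (\<integral>z. (covar \<alpha> N (fst z) (snd z))\<^sup>2 \<partial>?T)"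
    by simp
  also have "(\<integral>z. (covar \<alpha> N (fst z) (snd z))\<^sup>2 \<partial>?T) = (\<integral>x. (\<integral>y. (covar \<alpha> N y x)\<^sup>2 \<partial>torus_measure) \<partial>torus_measure)"
    using int by (subst TT.integral_fst' [symmetric]) (simp_all add: covar_commute)
  also have "\<dots> \<le> (\<integral>x. ?v \<partial>torus_measure)"
  proof (rule integral_mono)
    show "integrable torus_measure (\<lambda>x. \<integral>y. (covar \<alpha> N y x)\<^sup>2 \<partial>torus_measure)"
      using TT.integrable_fst'[OF int[of 2]] by (simp add: covar_commute)
  qed (simp_all add: integral_torus_measure integral_covar_sq)
  finally have "(\<integral>\<omega>. (energy \<alpha> ?p N \<omega>)\<^sup>2 \<partial>P) \<le>
      (\<Sum>j=1..m. (b j)\<^sup>2 * fact (2 * j) * ?v ^ (2 * j - 2)) * (4 * pi\<^sup>2 * ?v)"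
    using sigma_tilde_sq_pos[of \<alpha> N] by (simp add: measure_torus mult_left_mono sum_nonneg)
  also have "\<dots> = 4 * pi\<^sup>2 * (\<Sum>j=1..m. (b j)\<^sup>2 * fact (2 * j) * (?v ^ (2 * j - 2) * ?v))"
    by (simp add: sum_distrib_left sum_distrib_right mult_ac)
  also have "\<dots> = 4 * pi\<^sup>2 * (\<Sum>j=1..m. (b j)\<^sup>2 * fact (2 * j) * ?v ^ (2 * j - 1))"
    by (intro arg_cong2[of _ _ _ _ "(*)"] sum.cong refl) (auto simp flip: power_Suc2 simp: Suc_diff_Suc numeral_2_eq_2)
  finally show "(\<integral>\<omega>. (energy \<alpha> ?p N \<omega>)\<^sup>2 \<partial>P)
      \<le> 4 * pi\<^sup>2 * (\<Sum>j=1..m. (b j)\<^sup>2 * fact (2 * j) * ?v ^ (2 * j - 1))" .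
qed

end

section \<open>Lower bounds for the partition function\<close>

lemma even_power_sum_zero_imp:
  assumes "\<And>h. (\<Sum>j=1..m. b j * h ^ (2 * j)) = (0 :: real)" and "1 \<le> m"
  shows "b 1 = 0"
proof -
  define q where "q = (\<Sum>j=1..m. monom (b j) (2 * j))"
  have "poly q h = 0" for h using assms(1)[of h] by (simp add: q_def poly_sum poly_monom)
  then have "q = 0" by (simp add: poly_eq_poly_eq_iff [symmetric] fun_eq_iff)
  then have "coeff q 2 = 0" by simp
  moreover have "coeff q 2 = (\<Sum>j=1..m. if j = 1 then b j else 0)"
    unfolding q_def coeff_sum by (intro sum.cong) auto
  ultimately show ?thesis using assms(2) by simp
qed

context gaussian_field_coefficients
begin

lemma integrable_poly_field_torus: "integrable torus_measure (\<lambda>x. poly p (field \<alpha> N x \<omega>))"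
proof -
  have "set_integrable lborel torus (\<lambda>x. poly p (field \<alpha> N x \<omega>))"
    using continuous_on_field[of UNIV \<alpha> N \<omega>] by (intro set_integrable_torus continuous_on_poly)
  then show ?thesis
    unfolding torus_measure_def set_integrable_def by (subst integrable_restrict_space) auto
qed

context
  fixes \<alpha> :: real and b :: "nat \<Rightarrow> real" and m N :: nat and C :: real
  assumes lower: "\<And>y. - C \<le> poly (even_chaos b m (sigma_tilde_sq \<alpha> N)) y"
begin

lemma energy_ge: "- (4 * pi\<^sup>2 * C) \<le> energy \<alpha> (even_chaos b m (sigma_tilde_sq \<alpha> N)) N \<omega>"
proof -
  interpret T: finite_measure torus_measure by (rule finite_measure_torus_measure)
  have "(\<integral>x. - C \<partial>torus_measure) \<le> energy \<alpha> (even_chaos b m (sigma_tilde_sq \<alpha> N)) N \<omega>"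
    unfolding energy_def using lower by (intro integral_mono integrable_poly_field_torus) simp_all
  then show ?thesis by (simp add: measure_torus)
qed

text \<open>The constant C may depend on N: it secures integrability and appears in none of the
  estimates that follow.\<close>

lemma integrable_exp_energy:
  "integrable P (\<lambda>\<omega>. exp (- energy \<alpha> (even_chaos b m (sigma_tilde_sq \<alpha> N)) N \<omega>))"
proof (rule integrable_const_bound[where B = "exp (4 * pi\<^sup>2 * C)"])
  show "AE \<omega> in P. norm (exp (- energy \<alpha> (even_chaos b m (sigma_tilde_sq \<alpha> N)) N \<omega>)) \<le> exp (4 * pi\<^sup>2 * C)"
    using energy_ge by (intro AE_I2) (simp add: minus_le_iff)
qed simp

text \<open>Cameron--Martin in the zero mode combined with Jensen's inequality, the latter in the form
  \<open>exp y \<ge> exp c * (1 + y - c)\<close>. The field is shifted by the constant \<open>h\<close>.\<close>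

lemma ln_partition_ge:
  "- (4 * pi\<^sup>2) * (\<Sum>j=1..m. b j * h ^ (2 * j)) - 2 * pi\<^sup>2 * h\<^sup>2
    \<le> ln (\<integral>\<omega>. exp (- energy \<alpha> (even_chaos b m (sigma_tilde_sq \<alpha> N)) N \<omega>) \<partial>P)"
proof -
  let ?X = "energy \<alpha> (even_chaos b m (sigma_tilde_sq \<alpha> N)) N" and ?t = "2 * pi * h"
  let ?Z = "zero_mode N"
  let ?W = "\<lambda>\<omega>. exp (?t * ?Z \<omega> - ?t\<^sup>2 / 2)"
  \<comment> \<open>\<open>exp (- ?X \<omega>)\<close> is the tilt times exp of this exponent. The
    number \<open>?c\<close> is its mean under the tilted law, where - t^2 + t^2 / 2 = - 2 pi^2 h^2
    for t = 2 pi h; hence the linear term in exp y >= exp c (1 + y - c) integrates to 0.\<close>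
  let ?y = "\<lambda>\<omega>. - ?X \<omega> - ?t * ?Z \<omega> + ?t\<^sup>2 / 2"
  let ?c = "- (4 * pi\<^sup>2) * (\<Sum>j=1..m. b j * h ^ (2 * j)) - 2 * pi\<^sup>2 * h\<^sup>2"
  \<comment> \<open>The zero mode paired with itself is obtained by giving the field the coefficient
    0. The tilt formula for k = 0 and k = 1 then yields the mass of the tilt and the tilted mean of
    the zero mode.\<close>
  note J = jointly_gaussian_zero_mode[of \<alpha> N 0]
  have J: "jointly_gaussian P ?Z ?Z 1 1 1"
    using J unfolding jointly_gaussian_def
  proof (intro conjI allI)
    fix s t :: real
    assume *: "field \<alpha> N 0 \<in> borel_measurable P \<and> ?Z \<in> borel_measurable P \<and>
      (\<forall>s t. integrable P (\<lambda>\<omega>. exp (s * field \<alpha> N 0 \<omega> + t * ?Z \<omega>)) \<and>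
        (\<integral>\<omega>. exp (s * field \<alpha> N 0 \<omega> + t * ?Z \<omega>) \<partial>P) =
          exp ((sigma_tilde_sq \<alpha> N * s\<^sup>2 + 2 * (1 / (2 * pi)) * s * t + 1 * t\<^sup>2) / 2))"
    have "s * ?Z \<omega> + t * ?Z \<omega> = 0 * field \<alpha> N 0 \<omega> + (s + t) * ?Z \<omega>" for \<omega> by (simp add: ring_distribs)
    moreover have "1 * s\<^sup>2 + 2 * 1 * s * t + 1 * t\<^sup>2 =
      sigma_tilde_sq \<alpha> N * 0\<^sup>2 + 2 * (1 / (2 * pi)) * 0 * (s + t) + 1 * (s + t)\<^sup>2"
      by (simp add: power2_sum)
    ultimately show "integrable P (\<lambda>\<omega>. exp (s * ?Z \<omega> + t * ?Z \<omega>))"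
      "(\<integral>\<omega>. exp (s * ?Z \<omega> + t * ?Z \<omega>) \<partial>P) = exp ((1 * s\<^sup>2 + 2 * 1 * s * t + 1 * t\<^sup>2) / 2)"
      using * by (simp_all only:)
  qed simp_all
  have EW: "(\<integral>\<omega>. ?W \<omega> \<partial>P) = 1"
    using integral_hermite_exp_tilt[OF J, of ?t 0] by simp
  have EWZ: "(\<integral>\<omega>. ?W \<omega> * ?Z \<omega> \<partial>P) = ?t"
    using integral_hermite_exp_tilt[OF J, of ?t 1] unfolding hermite_1 by simp
  have W: "integrable P ?W"
    using integrable_tilted_chaos[of ?t N 1 \<alpha> 0] by simp
  have WZ: "integrable P (\<lambda>\<omega>. ?W \<omega> * ?Z \<omega>)"
    using EWZ not_integrable_integral_eq[of P "\<lambda>\<omega>. ?W \<omega> * ?Z \<omega>"]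
      integrable_times_poly_exp[of ?Z P "\<lambda>_. 1" "[:0, 1:]" 0 ?t "?t\<^sup>2 / 2"]
      integrable_exp_abs[OF J, of _ 0] by (simp add: mult.commute)
  note WX = integrable_tilted_energy[of ?t N \<alpha> b m] and EWX = integral_tilted_energy[of ?t N \<alpha> b m]
  have "exp (- ?X \<omega>) \<ge> exp ?c * (1 - ?c) * ?W \<omega> + exp ?c * (- (?W \<omega> * ?X \<omega>) - ?t * (?W \<omega> * ?Z \<omega>) + ?t\<^sup>2 / 2 * ?W \<omega>)" for \<omega>
  proof -
    have "1 + (?y \<omega> - ?c) \<le> exp (?y \<omega> - ?c)" by (rule exp_ge_add_one_self)
    then have "(?W \<omega> * exp ?c) * (1 + (?y \<omega> - ?c)) \<le> (?W \<omega> * exp ?c) * exp (?y \<omega> - ?c)"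
      by (rule mult_left_mono) simp
    also have "\<dots> = exp (- ?X \<omega>)" by (simp add: mult_exp_exp)
    finally show ?thesis by (simp add: algebra_simps)
  qed
  then have "(\<integral>\<omega>. exp ?c * (1 - ?c) * ?W \<omega> + exp ?c * (- (?W \<omega> * ?X \<omega>) - ?t * (?W \<omega> * ?Z \<omega>) + ?t\<^sup>2 / 2 * ?W \<omega>) \<partial>P)
      \<le> (\<integral>\<omega>. exp (- ?X \<omega>) \<partial>P)"
    by (intro integral_mono integrable_exp_energy Bochner_Integration.integrable_add integrable_mult_right
        Bochner_Integration.integrable_diff Bochner_Integration.integrable_minus W WX WZ)
  moreover have "(\<integral>\<omega>. exp ?c * (1 - ?c) * ?W \<omega> + exp ?c * (- (?W \<omega> * ?X \<omega>) - ?t * (?W \<omega> * ?Z \<omega>) + ?t\<^sup>2 / 2 * ?W \<omega>) \<partial>P)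
    = exp ?c * (1 - ?c) + exp ?c * (- (4 * pi\<^sup>2 * (\<Sum>j=1..m. b j * (?t / (2 * pi)) ^ (2 * j))) - ?t * ?t + ?t\<^sup>2 / 2)"
    using W WX WZ by (simp add: EW EWX EWZ del: exp_diff)
  moreover have "\<dots> = exp ?c"
    by (simp add: power2_eq_square algebra_simps)
  ultimately have "exp ?c \<le> (\<integral>\<omega>. exp (- ?X \<omega>) \<partial>P)" by simp
  moreover from this have "0 < (\<integral>\<omega>. exp (- ?X \<omega>) \<partial>P)" by (rule order_less_le_trans[OF exp_gt_zero])
  ultimately have "ln (exp ?c) \<le> ln (\<integral>\<omega>. exp (- ?X \<omega>) \<partial>P)" by (subst ln_le_cancel_iff) simp_all
  then show ?thesis unfolding ln_exp .
qed

lemma partition_gt_1: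
  assumes "b 1 \<noteq> 0" and "1 \<le> m"
  shows "1 < (\<integral>\<omega>. exp (- energy \<alpha> (even_chaos b m (sigma_tilde_sq \<alpha> N)) N \<omega>) \<partial>P)"
proof -
  let ?X = "energy \<alpha> (even_chaos b m (sigma_tilde_sq \<alpha> N)) N"
  have "(\<Sum>j=1..m. b j * 0 ^ (2 * j)) = 0" by (intro sum.neutral) auto
  then have X: "integrable P ?X" and EX: "(\<integral>\<omega>. ?X \<omega> \<partial>P) = 0"
    using integrable_tilted_energy[of 0 N \<alpha> b m] integral_tilted_energy[of 0 N \<alpha> b m] by simp_all
  \<comment> \<open>As the energy has mean 0, the partition function minus 1 is the integral of the
    nonnegative function exp (- x) - 1 + x of the energy, which vanishes only at x = 0.\<close>
  have int: "integrable P (\<lambda>\<omega>. exp (- ?X \<omega>) - 1 + ?X \<omega>)"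
    by (intro Bochner_Integration.integrable_add Bochner_Integration.integrable_diff integrable_exp_energy X) simp
  have nn: "0 \<le> exp (- ?X \<omega>) - 1 + ?X \<omega>" for \<omega>
    using exp_ge_add_one_self[of "- ?X \<omega>"] by linarith
  have eq: "(\<integral>\<omega>. exp (- ?X \<omega>) - 1 + ?X \<omega> \<partial>P) = (\<integral>\<omega>. exp (- ?X \<omega>) \<partial>P) - 1"
    using integrable_exp_energy X EX by (simp add: prob_space)
  have "(\<integral>\<omega>. exp (- ?X \<omega>) - 1 + ?X \<omega> \<partial>P) \<noteq> 0"
  proof
    assume "(\<integral>\<omega>. exp (- ?X \<omega>) - 1 + ?X \<omega> \<partial>P) = 0"
    then have "AE \<omega> in P. exp (- ?X \<omega>) - 1 + ?X \<omega> = 0"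
      using integral_nonneg_eq_0_iff_AE[OF int] nn by simp
    then have ae: "AE \<omega> in P. ?X \<omega> = 0"
    proof eventually_elim
      fix \<omega> assume *: "exp (- ?X \<omega>) - 1 + ?X \<omega> = 0"
      show "?X \<omega> = 0"
        using exp_minus_greater[of "?X \<omega>"] * by fastforce
    qed
    have "(\<Sum>j=1..m. b j * h ^ (2 * j)) = 0" for h
    proof -
      have "(\<integral>\<omega>. exp (2 * pi * h * zero_mode N \<omega> - (2 * pi * h)\<^sup>2 / 2) * ?X \<omega> \<partial>P) = (\<integral>\<omega>. 0 \<partial>P)"
        by (rule integral_cong_AE) (use ae in \<open>auto elim: eventually_mono\<close>)
      then show ?thesis using integral_tilted_energy[of "2 * pi * h" N \<alpha> b m] by simp
    qed
    then show False using even_power_sum_zero_imp[of b m] assms by blast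
  qed
  moreover have "0 \<le> (\<integral>\<omega>. exp (- ?X \<omega>) - 1 + ?X \<omega> \<partial>P)" by (rule Bochner_Integration.integral_nonneg) (rule nn)
  ultimately show ?thesis using eq by linarith
qed

end

end

section \<open>Convergence of the variances\<close>

text \<open>Normal moments make the mean an explicit polynomial in the variance, from which
  continuity in v can be read off.\<close>

lemma gauss_mean_poly:
  assumes "v > 0"
  shows "gauss_mean v (poly p) = (\<Sum>i\<le>degree p. coeff p i *
    (if even i then fact i / ((2 / v) ^ (i div 2) * fact (i div 2)) else 0))"
proof -
  have s: "sqrt v > 0" using assms by simp
  have "(\<integral>x. normal_density 0 (sqrt v) x * x ^ i \<partial>lborel) =
    (if even i then fact i / ((2 / v) ^ (i div 2) * fact (i div 2)) else 0)" for i
    using integral_normal_moment_even[OF s, of 0 "i div 2"] integral_normal_moment_odd[OF s, of 0 "i div 2"] assms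
    by (cases "even i") simp_all
  moreover have "integrable lborel (\<lambda>x. normal_density 0 (sqrt v) x * x ^ i)" for i
    using integrable_normal_moment[OF s, of 0 i] by simp
  moreover have "gauss_mean v (poly p) = (\<integral>x. (\<Sum>i\<le>degree p. coeff p i * (normal_density 0 (sqrt v) x * x ^ i)) \<partial>lborel)"
    unfolding gauss_mean_def
    by (subst integral_density) (auto simp: poly_altdef sum_distrib_left mult_ac intro!: Bochner_Integration.integral_cong)
  ultimately show ?thesis by (simp add: Bochner_Integration.integral_sum)
qed

lemma tendsto_gauss_mean_poly:
  assumes "(f \<longlongrightarrow> v) F" "v > 0"
  shows "((\<lambda>n. gauss_mean (f n) (poly p)) \<longlongrightarrow> gauss_mean v (poly p)) F"
proof -
  have "\<forall>\<^sub>F n in F. f n > 0" using assms by (rule order_tendstoD)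
  then have "\<forall>\<^sub>F n in F. (\<Sum>i\<le>degree p. coeff p i *
    (if even i then fact i / ((2 / f n) ^ (i div 2) * fact (i div 2)) else 0)) = gauss_mean (f n) (poly p)"
    by eventually_elim (simp add: gauss_mean_poly)
  moreover have "((\<lambda>n. \<Sum>i\<le>degree p. coeff p i *
    (if even i then fact i / ((2 / f n) ^ (i div 2) * fact (i div 2)) else 0)) \<longlongrightarrow> gauss_mean v (poly p)) F"
    unfolding gauss_mean_poly[OF assms(2)]
  proof (intro tendsto_intros)
    show "((\<lambda>n. if even i then fact i / ((2 / f n) ^ (i div 2) * fact (i div 2)) else 0) \<longlongrightarrow>
      (if even i then fact i / ((2 / v) ^ (i div 2) * fact (i div 2)) else 0)) F" for i
      using assms by (cases "even i") (auto intro!: tendsto_intros)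
  qed
  ultimately show ?thesis by (rule Lim_transform_eventually[rotated])
qed

text \<open>The singularity |x|^(-2 alpha) in the plane is dominated by |x_1|^(-alpha)
  |x_2|^(-alpha), whose factors are integrable near 0 on the line for alpha < 1; no polar
  coordinates are needed. The cut at 2 leaves room for the grid cells of the modes, whose
  coordinates are at most (N + 1) / N in modulus.\<close>

definition inv_powr :: "real \<Rightarrow> real \<Rightarrow> real" where
  "inv_powr \<alpha> t = (if \<bar>t\<bar> \<le> 2 then \<bar>t\<bar> powr - \<alpha> else 0)"

lemma inv_powr_nonneg: "0 \<le> inv_powr \<alpha> t"
  by (simp add: inv_powr_def)

lemma inv_powr_measurable [measurable]: "inv_powr \<alpha> \<in> borel_measurable borel"
  unfolding inv_powr_def [abs_def] by measurable

lemma integrable_inv_powr: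
  assumes "\<alpha> < 1"
  shows "integrable lborel (inv_powr \<alpha>)"
proof -
  have "(\<lambda>t. t powr - \<alpha>) integrable_on {0..2 :: real}"
    by (rule integrable_on_powr_from_0) (use assms in auto)
  then have "(\<lambda>t. t powr - \<alpha>) absolutely_integrable_on {0..2 :: real}"
    by (subst absolutely_integrable_on_iff_nonneg) auto
  then have "integrable lebesgue (\<lambda>t. indicator {0..2} t * t powr - \<alpha> :: real)"
    by (simp add: set_integrable_def)
  then have 1: "integrable lborel (\<lambda>t. indicator {0..2} t * t powr - \<alpha> :: real)"
    by (subst (asm) integrable_completion) simp_all
  from lborel_integrable_real_affine[OF this, of "-1" 0]
  have 2: "integrable lborel (\<lambda>t. indicator {0..2} (- t) * (- t) powr - \<alpha> :: real)" by simp
  have "inv_powr \<alpha> = (\<lambda>t. indicator {0..2} t * t powr - \<alpha> + indicator {0..2} (- t) * (- t) powr - \<alpha>)"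
    by (auto simp: inv_powr_def indicator_def fun_eq_iff)
  then show ?thesis using Bochner_Integration.integrable_add[OF 1 2] by simp
qed

lemma integrable_inv_powr_prod:
  assumes "\<alpha> < 1"
  shows "integrable lborel (\<lambda>x. inv_powr \<alpha> (fst x) * inv_powr \<alpha> (snd x))"
proof -
  have "integrable (lborel \<Otimes>\<^sub>M lborel) (\<lambda>x. inv_powr \<alpha> (fst x) * inv_powr \<alpha> (snd x))"
    using integrable_inv_powr[OF assms]
    by (intro lborel_pair.Fubini_integrable) (auto simp: abs_mult)
  then show ?thesis by (simp add: lborel_prod)
qed

text \<open>Half-open squares of side 1 / N partition the plane, and the index of a point is given
  by floors.\<close>

definition grid_cell :: "nat \<Rightarrow> int \<times> int \<Rightarrow> (real \<times> real) set" where
  "grid_cell N k = {of_int (fst k) / real N..<(of_int (fst k) + 1) / real N} \<times>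
     {of_int (snd k) / real N..<(of_int (snd k) + 1) / real N}"

lemma mem_grid_cell:
  assumes "N > 0"
  shows "x \<in> grid_cell N k \<longleftrightarrow> k = (\<lfloor>real N * fst x\<rfloor>, \<lfloor>real N * snd x\<rfloor>)"
proof -
  have "of_int i / real N \<le> t \<and> t < (of_int i + 1) / real N \<longleftrightarrow> i = \<lfloor>real N * t\<rfloor>" for i t
    using assms by (subst eq_commute, subst floor_eq_iff) (simp add: field_simps)
  then show ?thesis by (cases x, cases k) (auto simp: grid_cell_def)
qed

lemma grid_cell_borel [measurable]: "grid_cell N k \<in> sets borel"
  unfolding grid_cell_def by (intro borel_Times) auto

lemma emeasure_grid_cell:
  assumes "N > 0"
  shows "emeasure lborel (grid_cell N k) = ennreal (1 / (real N)\<^sup>2)"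
proof -
  have "emeasure lborel {of_int i / real N..<(of_int i + 1) / real N} = ennreal (1 / real N)" for i
    using assms by (simp add: divide_right_mono add_divide_distrib)
  then show ?thesis
    unfolding grid_cell_def lborel_prod [symmetric]
    using assms by (subst lborel.emeasure_pair_measure_Times) (auto simp: ennreal_mult [symmetric] power2_eq_square)
qed

text \<open>The step function behind \<open>sigma_N_sq\<close> as a Riemann sum: with cells of area
  N^(-2), the factor N^(2 alpha) produces N^(-2 (1 - alpha)), and inside the unit ball the values
  approach |x|^(-2 alpha).\<close>

definition lattice_step :: "real \<Rightarrow> nat \<Rightarrow> real \<times> real \<Rightarrow> real" where
  "lattice_step \<alpha> N x = (\<Sum>k\<in>modes N. real N powr (2 * \<alpha>) / (1 + norm (freq k) powr (2 * \<alpha>)) * indicator (grid_cell N k) x)"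

lemma sigma_N_sq_eq_integral:
  assumes "N > 0"
  shows "sigma_N_sq \<alpha> N = 1 / (4 * pi\<^sup>2) * (\<integral>x. lattice_step \<alpha> N x \<partial>lborel)"
proof -
  have int: "integrable lborel (indicator (grid_cell N k) :: _ \<Rightarrow> real)" for k
    using emeasure_grid_cell[OF assms, of k] by (simp add: integrable_indicator_iff)
  have "(\<integral>x. lattice_step \<alpha> N x \<partial>lborel)
    = (\<Sum>k\<in>modes N. real N powr (2 * \<alpha>) / (1 + norm (freq k) powr (2 * \<alpha>)) * (1 / (real N)\<^sup>2))"
    unfolding lattice_step_def using int emeasure_grid_cell[OF assms]
    by (subst Bochner_Integration.integral_sum) (simp_all add: measure_def mult.commute)
  also have "\<dots> = (\<Sum>k\<in>modes N. real N powr (- 2 * (1 - \<alpha>)) * (1 / (1 + norm (freq k) powr (2 * \<alpha>))))"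
  proof (intro sum.cong refl)
    have "real N powr (- 2 * (1 - \<alpha>)) = real N powr (2 * \<alpha>) * real N powr (- 2)"
      by (simp flip: powr_add)
    also have "real N powr (- 2) = 1 / (real N)\<^sup>2"
      using assms powr_realpow[of "real N" 2] by (simp add: powr_minus field_simps)
    finally show "real N powr (2 * \<alpha>) / (1 + norm (freq k) powr (2 * \<alpha>)) * (1 / (real N)\<^sup>2)
      = real N powr (- 2 * (1 - \<alpha>)) * (1 / (1 + norm (freq k) powr (2 * \<alpha>)))" for k by simp
  qed
  finally show ?thesis
    by (simp add: sigma_N_sq_def sigma_tilde_sq_def sum_distrib_left)
qed

definition grid_index :: "nat \<Rightarrow> real \<times> real \<Rightarrow> int \<times> int" where
  "grid_index N x = (\<lfloor>real N * fst x\<rfloor>, \<lfloor>real N * snd x\<rfloor>)"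

lemma lattice_step_eq:
  assumes "N > 0"
  shows "lattice_step \<alpha> N x = (if norm (freq (grid_index N x)) \<le> real N
    then real N powr (2 * \<alpha>) / (1 + norm (freq (grid_index N x)) powr (2 * \<alpha>)) else 0)"
proof -
  have "lattice_step \<alpha> N x = (\<Sum>k\<in>modes N. if k = grid_index N x then
      real N powr (2 * \<alpha>) / (1 + norm (freq k) powr (2 * \<alpha>)) else 0)"
    unfolding lattice_step_def
    by (intro sum.cong refl) (simp add: indicator_def mem_grid_cell[OF assms] grid_index_def)
  then show ?thesis using finite_modes by (simp add: modes_def)
qed

lemma tendsto_grid_index: "(\<lambda>n. freq (grid_index (Suc n) x) /\<^sub>R real (Suc n)) \<longlonglongrightarrow> x"
proof -
  have "(\<lambda>n. of_int \<lfloor>real (Suc n) * t\<rfloor> / real (Suc n)) \<longlonglongrightarrow> t" for t :: real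
  proof (rule tendsto_sandwich)
    have "t - 1 / real (Suc n) \<le> of_int \<lfloor>real (Suc n) * t\<rfloor> / real (Suc n)
      \<and> of_int \<lfloor>real (Suc n) * t\<rfloor> / real (Suc n) \<le> t" for n
    proof -
      have "real (Suc n) * t - 1 \<le> of_int \<lfloor>real (Suc n) * t\<rfloor>" "of_int \<lfloor>real (Suc n) * t\<rfloor> \<le> real (Suc n) * t"
        by linarith+
      then have "(real (Suc n) * t - 1) / real (Suc n) \<le> of_int \<lfloor>real (Suc n) * t\<rfloor> / real (Suc n)"
        "of_int \<lfloor>real (Suc n) * t\<rfloor> / real (Suc n) \<le> (real (Suc n) * t) / real (Suc n)"
        by (intro divide_right_mono; simp)+
      then show ?thesis by (simp add: diff_divide_distrib del: of_nat_Suc)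
    qed
    then show "\<forall>\<^sub>F n in sequentially. t - 1 / real (Suc n) \<le> of_int \<lfloor>real (Suc n) * t\<rfloor> / real (Suc n)"
      "\<forall>\<^sub>F n in sequentially. of_int \<lfloor>real (Suc n) * t\<rfloor> / real (Suc n) \<le> t" by auto
    show "(\<lambda>n. t - 1 / real (Suc n)) \<longlonglongrightarrow> t"
      using tendsto_diff[OF tendsto_const LIMSEQ_inverse_real_of_nat, of t] by (simp add: inverse_eq_divide)
  qed simp
  from tendsto_Pair[OF this[of "fst x"] this[of "snd x"]]
  show ?thesis by (simp add: freq_def grid_index_def divide_inverse mult.commute)
qed

text \<open>Both exceptions are null sets. At |x| = 1 the grid points may fall inside or outside the
  ball along the sequence; at 0 the steps blow up while \<open>powr\<close> gives the value
  0.\<close>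

lemma tendsto_lattice_step:
  assumes x: "x \<noteq> 0" "norm x \<noteq> 1" and \<alpha>: "0 < \<alpha>"
  shows "(\<lambda>n. lattice_step \<alpha> (Suc n) x) \<longlonglongrightarrow> indicator (cball 0 1) x *\<^sub>R (norm x powr (- 2 * \<alpha>))"
proof -
  define z where "z n = norm (freq (grid_index (Suc n) x) /\<^sub>R real (Suc n))" for n
  have z: "z \<longlonglongrightarrow> norm x" unfolding z_def by (intro tendsto_norm tendsto_grid_index)
  have zn: "norm (freq (grid_index (Suc n) x)) = real (Suc n) * z n" for n
    by (simp add: z_def del: of_nat_Suc)
  have z0: "z n \<ge> 0" for n by (simp add: z_def)
  \<comment> \<open>Dividing through by N^(2 alpha) turns the 1 in the denominator into a vanishing
    term.\<close>
  have eq: "lattice_step \<alpha> (Suc n) x = (if z n \<le> 1 then 1 / (real (Suc n) powr (- 2 * \<alpha>) + z n powr (2 * \<alpha>)) else 0)" for n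
  proof -
    have "real (Suc n) powr (2 * \<alpha>) / (1 + (real (Suc n) * z n) powr (2 * \<alpha>)) =
      1 / (real (Suc n) powr (- 2 * \<alpha>) + z n powr (2 * \<alpha>))"
      using z0[of n] by (simp add: powr_mult powr_minus field_simps del: of_nat_Suc)
    moreover have "real (Suc n) * z n \<le> real (Suc n) \<longleftrightarrow> z n \<le> 1"
      by (simp add: mult_le_cancel_left1 del: of_nat_Suc)
    ultimately show ?thesis by (simp add: lattice_step_eq zn del: of_nat_Suc)
  qed
  show ?thesis
  proof (cases "norm x < 1")
    case True
    have "(\<lambda>n. real (Suc n) powr (- 2 * \<alpha>)) \<longlonglongrightarrow> 0"
    proof (rule tendsto_neg_powr)
      show "filterlim (\<lambda>n. real (Suc n)) at_top sequentially"
        by (rule filterlim_compose[OF filterlim_real_sequentially filterlim_Suc])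
    qed (use \<alpha> in simp)
    then have "(\<lambda>n. 1 / (real (Suc n) powr (- 2 * \<alpha>) + z n powr (2 * \<alpha>))) \<longlonglongrightarrow> 1 / (0 + norm x powr (2 * \<alpha>))"
      using x by (intro tendsto_intros z) auto
    moreover have "\<forall>\<^sub>F n in sequentially. z n < 1" using z True by (rule order_tendstoD)
    then have "\<forall>\<^sub>F n in sequentially. 1 / (real (Suc n) powr (- 2 * \<alpha>) + z n powr (2 * \<alpha>)) = lattice_step \<alpha> (Suc n) x"
      by eventually_elim (simp add: eq)
    ultimately show ?thesis using True
      by (simp add: Lim_transform_eventually powr_minus inverse_eq_divide)
  next
    case False
    then have "\<forall>\<^sub>F n in sequentially. 1 < z n" using z x by (intro order_tendstoD) auto
    then have "\<forall>\<^sub>F n in sequentially. 0 = lattice_step \<alpha> (Suc n) x"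
      by eventually_elim (simp add: eq)
    from Lim_transform_eventually[OF tendsto_const this]
    have "(\<lambda>n. lattice_step \<alpha> (Suc n) x) \<longlonglongrightarrow> 0" .
    moreover have "x \<notin> cball 0 1" using False x by simp
    ultimately show ?thesis by simp
  qed
qed

text \<open>With rho the norm of the grid index, N |x_i| <= rho + 1 for both coordinates, and (rho +
  1)^(2 alpha) <= 2^2 (1 + rho^(2 alpha)) explains the factor 4. Zero coordinates are excluded
  because \<open>inv_powr\<close> takes the value 0 there.\<close>

lemma lattice_step_le:
  assumes \<alpha>: "0 < \<alpha>" "\<alpha> < 1" and N: "N > 0" and x: "fst x \<noteq> 0" "snd x \<noteq> 0"
  shows "\<bar>lattice_step \<alpha> N x\<bar> \<le> 4 * (inv_powr \<alpha> (fst x) * inv_powr \<alpha> (snd x))"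
proof (cases "norm (freq (grid_index N x)) \<le> real N")
  case True
  define \<rho> where "\<rho> = norm (freq (grid_index N x))"
  have abs: "\<bar>of_int (fst (grid_index N x))\<bar> \<le> \<rho>" "\<bar>of_int (snd (grid_index N x))\<bar> \<le> \<rho>"
    using norm_fst_le[of "of_int (fst (grid_index N x)) :: real" "of_int (snd (grid_index N x)) :: real"]
      norm_snd_le[of "of_int (snd (grid_index N x)) :: real" "of_int (fst (grid_index N x)) :: real"]
    by (simp_all add: \<rho>_def freq_def)
  have fl: "\<bar>s\<bar> \<le> \<bar>of_int \<lfloor>s\<rfloor>\<bar> + 1" for s :: real by linarith
  have le: "real N * \<bar>fst x\<bar> \<le> \<rho> + 1" "real N * \<bar>snd x\<bar> \<le> \<rho> + 1"
    using abs fl[of "real N * fst x"] fl[of "real N * snd x"] by (simp_all add: grid_index_def abs_mult)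
  have \<rho>: "0 \<le> \<rho>" "\<rho> \<le> real N" using True by (simp_all add: \<rho>_def)
  have "t \<le> 2" if "real N * t \<le> \<rho> + 1" for t
  proof -
    have "1 \<le> real N" using N by simp
    then have "real N * t \<le> real N * 2" using that \<rho>(2) by linarith
    then show ?thesis using N by simp
  qed
  with le have small: "\<bar>fst x\<bar> \<le> 2" "\<bar>snd x\<bar> \<le> 2" by auto
  have "real N powr (2 * \<alpha>) * (\<bar>fst x\<bar> powr \<alpha> * \<bar>snd x\<bar> powr \<alpha>)
    = (real N * \<bar>fst x\<bar>) powr \<alpha> * (real N * \<bar>snd x\<bar>) powr \<alpha>"
  proof -
    have "real N powr (2 * \<alpha>) = real N powr \<alpha> * real N powr \<alpha>" by (simp flip: powr_add)
    then show ?thesis by (simp add: powr_mult)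
  qed
  also have "\<dots> \<le> (\<rho> + 1) powr \<alpha> * (\<rho> + 1) powr \<alpha>"
    using le \<alpha> by (intro mult_mono powr_mono2) auto
  also have "\<dots> = (\<rho> + 1) powr (2 * \<alpha>)" by (simp flip: powr_add)
  also have "\<dots> \<le> (2 * max 1 \<rho>) powr (2 * \<alpha>)" using \<rho> \<alpha> by (intro powr_mono2) auto
  also have "\<dots> = 2 powr (2 * \<alpha>) * max 1 \<rho> powr (2 * \<alpha>)" by (simp add: powr_mult)
  also have "\<dots> \<le> 2 powr 2 * (1 + \<rho> powr (2 * \<alpha>))"
    using \<alpha> by (intro mult_mono powr_mono) (auto simp: max_def)
  finally have "real N powr (2 * \<alpha>) * (\<bar>fst x\<bar> powr \<alpha> * \<bar>snd x\<bar> powr \<alpha>) \<le> 4 * (1 + \<rho> powr (2 * \<alpha>))"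
    by simp
  moreover have "0 < 1 + \<rho> powr (2 * \<alpha>)" by (simp add: add_pos_nonneg)
  moreover have "0 < \<bar>fst x\<bar> powr \<alpha> * \<bar>snd x\<bar> powr \<alpha>" using x by simp
  ultimately have "real N powr (2 * \<alpha>) / (1 + \<rho> powr (2 * \<alpha>)) \<le> 4 * (1 / (\<bar>fst x\<bar> powr \<alpha> * \<bar>snd x\<bar> powr \<alpha>))"
    by (simp add: field_simps)
  also have "1 / (\<bar>fst x\<bar> powr \<alpha> * \<bar>snd x\<bar> powr \<alpha>) = inv_powr \<alpha> (fst x) * inv_powr \<alpha> (snd x)"
    using small by (simp add: inv_powr_def powr_minus divide_inverse)
  finally show ?thesis using True N by (simp add: lattice_step_eq \<rho>_def)
qed (use N in \<open>simp add: lattice_step_eq inv_powr_nonneg\<close>)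

text \<open>Dominated convergence for the step functions; the pointwise statements are restricted
  only on the unit circle and the coordinate axes, which are null.\<close>

lemma
  assumes \<alpha>: "0 < \<alpha>" "\<alpha> < 1"
  shows sigma_N_sq_tendsto: "sigma_N_sq \<alpha> \<longlonglongrightarrow> sigma_sq \<alpha>"
    and sigma_sq_pos: "sigma_sq \<alpha> > 0"
proof -
  let ?f = "\<lambda>x :: real \<times> real. indicator (cball 0 1) x *\<^sub>R (norm x powr (- 2 * \<alpha>))"
  let ?w = "\<lambda>x. 4 * (inv_powr \<alpha> (fst x) * inv_powr \<alpha> (snd x))"
  have "AE x in lborel. x \<notin> sphere (0 :: real \<times> real) 1"
    by (rule AE_not_in) (use negligible_sphere[of "0 :: real \<times> real" 1] in
      \<open>simp add: negligible_iff_null_sets null_sets_completion_iff borel_closed closed_sphere\<close>)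
  then have 1: "AE x in lborel. norm (x :: real \<times> real) \<noteq> 1" by simp
  have t: "AE t in lborel. t \<noteq> (0 :: real)" by (rule AE_lborel_singleton)
  have 2: "AE x in lborel. fst (x :: real \<times> real) \<noteq> 0 \<and> snd x \<noteq> 0"
  proof -
    have "AE x in (lborel \<Otimes>\<^sub>M lborel). fst (x :: real \<times> real) \<noteq> 0 \<and> snd x \<noteq> 0"
    proof (rule lborel_pair.AE_pair_measure)
      show "{x \<in> space (lborel \<Otimes>\<^sub>M lborel). fst (x :: real \<times> real) \<noteq> 0 \<and> snd x \<noteq> 0} \<in> sets (lborel \<Otimes>\<^sub>M lborel)"
        by measurable
    qed (use t in \<open>auto elim: eventually_mono\<close>)
    then show ?thesis unfolding lborel_prod .
  qed
  have meas: "lattice_step \<alpha> (Suc n) \<in> borel_measurable lborel" for n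
    unfolding lattice_step_def [abs_def] by simp
  have meas': "?f \<in> borel_measurable lborel"
    by (intro borel_measurable_scaleR borel_measurable_indicator powr_real_measurable) simp_all
  have lim: "AE x in lborel. (\<lambda>n. lattice_step \<alpha> (Suc n) x) \<longlonglongrightarrow> ?f x"
    using 1 2 by eventually_elim (rule tendsto_lattice_step, use \<alpha> in auto)
  have dom: "AE x in lborel. norm (lattice_step \<alpha> (Suc n) x) \<le> ?w x" for n
    using 2 by eventually_elim (unfold real_norm_def, rule lattice_step_le, use \<alpha> in auto)
  have w: "integrable lborel ?w" using integrable_inv_powr_prod[OF \<alpha>(2)] by simp
  note DC = meas' meas w lim dom
  have "(\<lambda>n. \<integral>x. lattice_step \<alpha> (Suc n) x \<partial>lborel) \<longlonglongrightarrow> (\<integral>x. ?f x \<partial>lborel)"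
    by (rule integral_dominated_convergence[OF DC])
  then have "(\<lambda>n. sigma_N_sq \<alpha> (Suc n)) \<longlonglongrightarrow> sigma_sq \<alpha>"
    unfolding sigma_sq_def set_lebesgue_integral_def
    by (simp only: sigma_N_sq_eq_integral zero_less_Suc) (intro tendsto_intros)
  then show "sigma_N_sq \<alpha> \<longlonglongrightarrow> sigma_sq \<alpha>" by (rule LIMSEQ_imp_Suc)
  have int: "integrable lborel ?f" by (rule integrable_dominated_convergence[OF DC])
  \<comment> \<open>A square inside the unit ball and off the origin, where the integrand is at
    least 1; its area 1 / 16 bounds the integral from below.\<close>
  let ?B = "cbox (1/4, 1/4) (1/2, 1/2) :: (real \<times> real) set"
  have "indicator ?B x \<le> ?f x" for x
  proof (cases "x \<in> ?B")
    case True
    have "norm x \<le> \<bar>fst x\<bar> + \<bar>snd x\<bar>" by (simp add: norm_prod_def sqrt_sum_squares_le_sum_abs)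
    moreover have "x \<noteq> 0" using True by (auto simp: cbox_Pair_eq prod_eq_iff)
    ultimately have "0 < norm x" "norm x \<le> 1" using True by (auto simp: cbox_Pair_eq)
    then have "1 \<le> norm x powr (- 2 * \<alpha>)"
      using \<alpha> powr_mono2'[of "- (2 * \<alpha>)" "norm x" 1] \<open>0 < norm x\<close> \<open>norm x \<le> 1\<close> by simp
    then show ?thesis using True \<open>norm x \<le> 1\<close> by simp
  qed simp
  then have "(\<integral>x. indicator ?B x \<partial>lborel) \<le> (\<integral>x. ?f x \<partial>lborel)"
    by (intro integral_mono int) (simp_all add: integrable_indicator_iff emeasure_lborel_cbox_eq)
  moreover have "(\<integral>x. indicator ?B x \<partial>lborel) = (1 / 16 :: real)"
    by (simp add: content_Pair)
  ultimately show "sigma_sq \<alpha> > 0"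
    unfolding sigma_sq_def set_lebesgue_integral_def by (intro mult_pos_pos) auto
qed

section \<open>Real-analysis lemmas\<close>

lemma even_degree_poly_bounded_below:
  fixes p :: "real poly"
  assumes "even (degree p)" and "lead_coeff p > 0"
  obtains C where "\<And>x. - C \<le> poly p x"
proof -
  obtain n1 where n1: "\<And>x. x \<ge> n1 \<Longrightarrow> poly p x \<ge> lead_coeff p"
    using poly_pinfty_gt_lc[OF assms(2)] by blast
  let ?q = "pcompose p [:0, -1:]"
  have "lead_coeff ?q = lead_coeff p * (-1) ^ degree p" by (subst lead_coeff_comp) auto
  then have "lead_coeff ?q > 0" using assms by simp
  from poly_pinfty_gt_lc[OF this] this obtain n2 where n2: "\<And>x. x \<ge> n2 \<Longrightarrow> poly p (- x) > 0"
    by (force simp: poly_pcompose)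
  have "bounded (poly p ` {- n2..n1})"
    by (intro compact_imp_bounded compact_continuous_image continuous_on_poly continuous_on_id compact_Icc)
  then obtain B where "\<forall>y \<in> poly p ` {- n2..n1}. norm y \<le> B"
    unfolding bounded_iff by (elim exE)
  then have B: "\<bar>poly p x\<bar> \<le> B" if "x \<in> {- n2..n1}" for x using that by auto
  have "- \<bar>B\<bar> \<le> poly p x" for x
  proof (cases "x \<in> {- n2..n1}")
    case True
    then show ?thesis using B[OF True] by linarith
  next
    case False
    then have "x \<ge> n1 \<or> - x \<ge> n2" by auto
    then have "0 < poly p x" using n1[of x] n2[of "- x"] assms(2) by auto
    then show ?thesis by linarith
  qed
  then show thesis by (rule that)
qed

text \<open>Hermite polynomials are monic, so b m is the leading coefficient whatever the
  variance.\<close>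

lemma even_chaos_bounded_below:
  assumes "b m > 0" "1 \<le> m"
  obtains C where "\<And>x. - C \<le> poly (even_chaos b m v) x"
proof -
  have "coeff (even_chaos b m v) (2 * m) = (\<Sum>j=1..m. if j = m then b m else 0)"
    unfolding even_chaos_def coeff_sum
    by (intro sum.cong refl) (auto simp: coeff_hermite_poly_self coeff_eq_0 degree_hermite_poly)
  then have coeff: "coeff (even_chaos b m v) (2 * m) = b m" using assms(2) by simp
  moreover have "degree (even_chaos b m v) \<le> 2 * m"
    unfolding even_chaos_def
    by (intro degree_sum_le order_trans[OF degree_smult_le]) (auto simp: degree_hermite_poly)
  ultimately have "degree (even_chaos b m v) = 2 * m"
    using assms(1) by (intro antisym le_degree) auto
  then have "even (degree (even_chaos b m v))" "lead_coeff (even_chaos b m v) > 0"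
    using coeff assms(1) by simp_all
  then show thesis using even_degree_poly_bounded_below that by metis
qed

lemma uniform_linear_lower_bound:
  fixes f h :: "nat \<Rightarrow> real"
  assumes pos: "\<And>n. n \<ge> 1 \<Longrightarrow> f n > 0" "\<And>n. n \<ge> 1 \<Longrightarrow> h n > 0"
    and ev: "\<forall>\<^sub>F n in sequentially. f n > d * h n" and "d > 0"
  shows "\<exists>c>0. \<forall>n\<ge>1. f n > c * h n"
proof -
  obtain n0 where n0: "\<And>n. n \<ge> n0 \<Longrightarrow> f n > d * h n"
    using ev by (auto simp: eventually_sequentially)
  \<comment> \<open>The ratios for the finitely many small n are halved to keep the final inequality
    strict.\<close>
  let ?S = "insert d ((\<lambda>n. f n / (2 * h n)) ` {1..n0})"
  define c where "c = Min ?S"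
  have "c > 0" unfolding c_def using pos \<open>d > 0\<close> by (subst Min_gr_iff) auto
  moreover have "f n > c * h n" if "n \<ge> 1" for n
  proof (cases "n \<le> n0")
    case True
    then have "c \<le> f n / (2 * h n)" unfolding c_def using that by (intro Min_le) auto
    then have "c * h n \<le> f n / 2" using pos(2)[OF that] by (simp add: field_simps)
    then show ?thesis using pos(1)[OF that] by linarith
  next
    case False
    have "c \<le> d" unfolding c_def by (intro Min_le) auto
    then have "c * h n \<le> d * h n" using pos(2)[OF that] by (intro mult_right_mono) auto
    then show ?thesis using n0[of n] False by linarith
  qed
  ultimately show ?thesis by blast
qed

text \<open>The hypothesis \<open>vanish\<close> expresses convergence to 0 in probability. Two
  successive subsequences give convergence to 0 almost everywhere of both F - f and the truncated F,
  so min (f x) 1 = 0 and f = 0; but then F - f keeps the integral 1. Passing to \<open>Suc n\<close>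
  avoids n = 0, where integrability is not assumed.\<close>

lemma not_converges_in_L1I:
  assumes F: "\<And>n. n \<ge> 1 \<Longrightarrow> integrable M (F n)"
    and one: "\<And>n. n \<ge> 1 \<Longrightarrow> (\<integral>x. F n x \<partial>M) = 1"
    and nonneg: "\<And>n x. F n x \<ge> 0"
    and vanish: "(\<lambda>n. \<integral>x. min (F n x) 1 \<partial>M) \<longlonglongrightarrow> 0"
    and M: "finite_measure M"
  shows "\<not> converges_in_L1 M F"
proof
  assume "converges_in_L1 M F"
  then obtain f where f: "integrable M f" and lim: "(\<lambda>n. \<integral>\<^sup>+ u. ennreal \<bar>F n u - f u\<bar> \<partial>M) \<longlonglongrightarrow> 0"
    by (auto simp: converges_in_L1_def)
  let ?u = "\<lambda>n x. F (Suc n) x - f x" and ?m = "\<lambda>n x. min (F (Suc n) x) 1"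
  have u: "integrable M (?u n)" for n using F f by simp
  have "(\<lambda>n. ennreal (\<integral>x. norm (?u n x) \<partial>M)) \<longlonglongrightarrow> 0"
    using LIMSEQ_Suc[OF lim] u by (simp add: nn_integral_eq_integral)
  then have lim': "(\<lambda>n. \<integral>x. norm (?u n x) \<partial>M) \<longlonglongrightarrow> 0"
    by (subst (asm) ennreal_tendsto_0_iff) auto
  obtain r :: "nat \<Rightarrow> nat" where r: "strict_mono r" "AE x in M. (\<lambda>n. ?u (r n) x) \<longlonglongrightarrow> 0"
    using tendsto_L1_AE_subseq[OF u lim'] by blast
  have m: "integrable M (?m (r n))" for n
    using F[of "Suc (r n)"] integrable_min[OF _ finite_measure.integrable_const[OF M, of 1]] by simp
  have "(\<lambda>n. \<integral>x. ?m (r n) x \<partial>M) \<longlonglongrightarrow> 0"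
    using LIMSEQ_subseq_LIMSEQ[OF LIMSEQ_Suc[OF vanish] r(1)] by (simp add: comp_def)
  then have "(\<lambda>n. \<integral>x. norm (?m (r n) x) \<partial>M) \<longlonglongrightarrow> 0" using nonneg by simp
  from tendsto_L1_AE_subseq[OF m this] obtain r' :: "nat \<Rightarrow> nat"
    where r': "strict_mono r'" "AE x in M. (\<lambda>n. ?m (r (r' n)) x) \<longlonglongrightarrow> 0" by blast
  have "AE x in M. f x = 0" using r(2) r'(2)
  proof eventually_elim
    fix x assume "(\<lambda>n. ?u (r n) x) \<longlonglongrightarrow> 0" and 0: "(\<lambda>n. ?m (r (r' n)) x) \<longlonglongrightarrow> 0"
    then have "(\<lambda>n. F (Suc (r n)) x) \<longlonglongrightarrow> f x" by (simp add: LIM_zero_iff)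
    then have "(\<lambda>n. F (Suc (r (r' n))) x) \<longlonglongrightarrow> f x"
      using LIMSEQ_subseq_LIMSEQ[OF _ r'(1)] by (fastforce simp: comp_def)
    then have "(\<lambda>n. ?m (r (r' n)) x) \<longlonglongrightarrow> min (f x) 1" by (intro tendsto_min tendsto_const)
    with 0 have "min (f x) 1 = 0" using LIMSEQ_unique by blast
    then show "f x = 0" by (auto simp: min_def split: if_splits)
  qed
  then have "(\<integral>x. f x \<partial>M) = 0" by (subst integral_cong_AE[where g = "\<lambda>_. 0"]) (use f in auto)
  then have "(\<integral>x. ?u n x \<partial>M) = 1" for n using F[of "Suc n"] one[of "Suc n"] f by simp
  then have "1 \<le> (\<integral>x. norm (?u n x) \<partial>M)" for n
    using integral_norm_bound[of M "?u n"] by simp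
  then show False using LIMSEQ_le_const[OF lim', of 1] by auto
qed

section \<open>Measurability of the Gibbs weight\<close>

lemma distribution_eval_measurable:
  assumes "f \<in> test_functions"
  shows "(\<lambda>u. u f) \<in> borel_measurable distribution_space"
  unfolding distribution_space_def
  by (intro measurable_restrict_space1 measurable_component_singleton assms)

lemma fourier_coeff_measurable [measurable]:
  "(\<lambda>u. fourier_coeff u k) \<in> borel_measurable distribution_space"
  unfolding fourier_coeff_def
  using distribution_eval_measurable[OF cos_freq_test_function[of k]]
    distribution_eval_measurable[OF sin_freq_test_function[of k]]
  by (intro borel_measurable_times borel_measurable_diff measurable_compose[OF _ borel_measurable_of_real]) simp_all

lemma fourier_proj_measurable:
  "(\<lambda>(u, x). fourier_proj N u x) \<in> borel_measurable (distribution_space \<Otimes>\<^sub>M torus_measure)"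
proof -
  have [measurable]: "(\<lambda>x. cis (freq k \<bullet> x)) \<in> borel_measurable torus_measure" for k
    by (intro measurable_torus_measure borel_measurable_continuous_onI continuous_intros)
  show ?thesis unfolding fourier_proj_def by measurable
qed

lemma exp_integral_fourier_proj_measurable:
  fixes p :: "real poly"
  shows "(\<lambda>u. exp (- (LINT x:torus|lborel. poly p (fourier_proj N u x)))) \<in> borel_measurable distribution_space"
proof -
  interpret T: finite_measure torus_measure by (rule finite_measure_torus_measure)
  have "(\<lambda>(u, x). poly p (fourier_proj N u x)) \<in> borel_measurable (distribution_space \<Otimes>\<^sub>M torus_measure)"
    using borel_measurable_poly[OF fourier_proj_measurable, of p] by (simp add: split_beta')
  from T.borel_measurable_lebesgue_integral[OF this] show ?thesis
    by (simp add: integral_torus_measure)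
qed

section \<open>Scaling of the chaos coefficients\<close>

text \<open>Since \<open>V_ren\<close> starts at degree 4, the slot j = 1 is free for the quadratic
  term of \<open>V_tilde\<close>.\<close>

definition chaos_coeff :: "real \<Rightarrow> real poly \<Rightarrow> nat \<Rightarrow> nat \<Rightarrow> real" where
  "chaos_coeff \<alpha> V N j = (if j = 1 then - 1 / 2
     else abar_N \<alpha> V N j * real N powr (- (2 * real j - 4) * (1 - \<alpha>)))"

lemma V_tilde_eq_even_chaos:
  assumes "m \<ge> 1"
  shows "V_tilde \<alpha> V m N = poly (even_chaos (chaos_coeff \<alpha> V N) m (sigma_tilde_sq \<alpha> N))"
proof
  fix y
  have "{1..m} = insert 1 {2..m}" using assms by auto
  then have "poly (even_chaos (chaos_coeff \<alpha> V N) m (sigma_tilde_sq \<alpha> N)) y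
    = - 1 / 2 * hermite 2 y (sigma_tilde_sq \<alpha> N) + V_ren \<alpha> V m N y"
    unfolding poly_even_chaos V_ren_def by (simp add: chaos_coeff_def)
  then show "V_tilde \<alpha> V m N y = poly (even_chaos (chaos_coeff \<alpha> V N) m (sigma_tilde_sq \<alpha> N)) y"
    by (simp add: V_tilde_def hermite_2)
qed

text \<open>Real powers of N become natural powers of r = N^(1 - alpha), so that orders of magnitude
  are compared by counting exponents.\<close>

lemma powr_scale:
  assumes "N \<ge> 1"
  shows "real N powr (4 * (1 - \<alpha>)) = (real N powr (1 - \<alpha>)) ^ 4"
    and "j \<ge> 2 \<Longrightarrow> real N powr (- (2 * real j - 4) * (1 - \<alpha>)) = 1 / (real N powr (1 - \<alpha>)) ^ (2 * j - 4)"
    and "sigma_tilde_sq \<alpha> N = sigma_N_sq \<alpha> N * (real N powr (1 - \<alpha>))\<^sup>2"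
proof -
  have pow: "(real N powr (1 - \<alpha>)) ^ k = real N powr (real k * (1 - \<alpha>))" for k
    using assms by (simp add: powr_power mult.commute)
  show "real N powr (4 * (1 - \<alpha>)) = (real N powr (1 - \<alpha>)) ^ 4" by (simp add: pow)
  show "real N powr (- (2 * real j - 4) * (1 - \<alpha>)) = 1 / (real N powr (1 - \<alpha>)) ^ (2 * j - 4)" if "j \<ge> 2"
    using that by (simp add: pow of_nat_diff powr_minus_divide [symmetric] left_diff_distrib)
  have "real N powr (- 2 * (1 - \<alpha>)) * (real N powr (1 - \<alpha>))\<^sup>2 = 1"
    using assms by (simp add: pow flip: powr_add)
  then show "sigma_tilde_sq \<alpha> N = sigma_N_sq \<alpha> N * (real N powr (1 - \<alpha>))\<^sup>2"
    by (simp add: sigma_N_sq_def mult_ac)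
qed

lemma sigma_N_sq_pos: "N \<ge> 1 \<Longrightarrow> sigma_N_sq \<alpha> N > 0"
  using sigma_tilde_sq_pos[of \<alpha> N] by (simp add: sigma_N_sq_def)

lemma abar_N_tendsto:
  assumes "0 < \<alpha>" "\<alpha> < 1"
  shows "(\<lambda>N. abar_N \<alpha> V N j) \<longlonglongrightarrow> abar \<alpha> V j"
  unfolding abar_N_def abar_def
  by (intro tendsto_intros tendsto_gauss_mean_poly sigma_N_sq_tendsto sigma_sq_pos assms)

text \<open>The derivative of order 2 m of V is the constant (2 m)! a_m, which averaging leaves
  unchanged. So the leading coefficient is positive for every N >= 1 and not merely for large
  N.\<close>

lemma abar_N_top:
  assumes V: "\<And>z. poly V z = (\<Sum>j\<le>m. a j * z ^ (2 * j))" and N: "N \<ge> 1"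
  shows "abar_N \<alpha> V N m = a m"
proof -
  have "V = (\<Sum>j\<le>m. monom (a j) (2 * j))"
    using V by (simp add: poly_eq_poly_eq_iff [symmetric] fun_eq_iff poly_sum poly_monom)
  then have coeff: "coeff V k = (\<Sum>j\<le>m. if 2 * j = k then a j else 0)" for k
    by (simp add: coeff_sum)
  have "coeff V (2 * m) = (\<Sum>j\<le>m. if j = m then a m else 0)"
    unfolding coeff by (intro sum.cong) auto
  then have top: "coeff V (2 * m) = a m" by simp
  have "coeff V (Suc (k + 2 * m)) = 0" for k
    unfolding coeff by (intro sum.neutral) auto
  then have "(pderiv ^^ (2 * m)) V = [:fact (2 * m) * a m:]"
    using top by (auto simp: poly_eq_iff coeff_higher_pderiv coeff_pCons pochhammer_fact split: nat.split)
  moreover have "gauss_mean (sigma_N_sq \<alpha> N) (poly [:c:]) = c" for c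
    using gauss_mean_poly[OF sigma_N_sq_pos[OF N], of \<alpha> "[:c:]"] by simp
  ultimately show ?thesis by (simp add: abar_N_def)
qed

text \<open>For the shift theta r with r = N^(1 - alpha), the factor r^(2 j) meets the scaling
  r^(-(2 j - 4)) of the coefficient: all terms with j >= 2 have the same order r^4.\<close>

lemma sum_chaos_coeff_power:
  assumes "m \<ge> 1" "N \<ge> 1"
  shows "(\<Sum>j=1..m. chaos_coeff \<alpha> V N j * (\<theta> * real N powr (1 - \<alpha>)) ^ (2 * j))
    = - 1 / 2 * (\<theta> * real N powr (1 - \<alpha>))\<^sup>2 + (real N powr (1 - \<alpha>)) ^ 4 * (\<Sum>j=2..m. abar_N \<alpha> V N j * \<theta> ^ (2 * j))"
proof -
  let ?r = "real N powr (1 - \<alpha>)"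
  have r: "?r > 0" using assms by simp
  have "chaos_coeff \<alpha> V N j * (\<theta> * ?r) ^ (2 * j) = ?r ^ 4 * (abar_N \<alpha> V N j * \<theta> ^ (2 * j))" if "j \<in> {2..m}" for j
  proof -
    have "?r ^ (2 * j) = ?r ^ 4 * ?r ^ (2 * j - 4)" using that by (simp flip: power_add)
    then show ?thesis
      using that r powr_scale(2)[OF assms(2), of j \<alpha>] by (simp add: chaos_coeff_def power_mult_distrib)
  qed
  then have "(\<Sum>j=2..m. chaos_coeff \<alpha> V N j * (\<theta> * ?r) ^ (2 * j)) = ?r ^ 4 * (\<Sum>j=2..m. abar_N \<alpha> V N j * \<theta> ^ (2 * j))"
    unfolding sum_distrib_left by (rule sum.cong[OF refl])
  moreover have "{1..m} = insert 1 {2..m}" using assms by auto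
  moreover have "chaos_coeff \<alpha> V N 1 = - 1 / 2" by (simp add: chaos_coeff_def)
  ultimately show ?thesis by simp
qed

lemma inverse_scale_tendsto:
  assumes "\<alpha> < 1"
  shows "(\<lambda>N. 1 / real N powr (1 - \<alpha>)) \<longlonglongrightarrow> 0"
proof -
  have "(\<lambda>N. real N powr - (1 - \<alpha>)) \<longlonglongrightarrow> 0"
    using assms by (intro tendsto_neg_powr filterlim_real_sequentially) auto
  then show ?thesis by (simp add: powr_minus_divide [symmetric])
qed

text \<open>With r = N^(1 - alpha), the variance is of order r^2 and the coefficients for j >= 2 are
  at most of order r^(-(2 j - 4)). So these terms are O(r^6) and the term j = 1 is O(r^2); division
  by r^8 leaves the powers of 1 / r displayed in \<open>?R\<close>.\<close>

lemma chaos_coeff_sq_sum_tendsto: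
  assumes \<alpha>: "0 < \<alpha>" "\<alpha> < 1" and m: "m \<ge> 1"
  shows "(\<lambda>N. (\<Sum>j=1..m. (chaos_coeff \<alpha> V N j)\<^sup>2 * fact (2 * j) * sigma_tilde_sq \<alpha> N ^ (2 * j - 1))
     / (real N powr (1 - \<alpha>)) ^ 8) \<longlonglongrightarrow> 0"
proof -
  let ?r = "\<lambda>N. real N powr (1 - \<alpha>)"
  note rinv = inverse_scale_tendsto[OF \<alpha>(2)]
  let ?R = "\<lambda>j N. if j = 1 then 1 / 4 * fact (2 * j) * sigma_N_sq \<alpha> N * (1 / ?r N) ^ 6
     else (abar_N \<alpha> V N j)\<^sup>2 * fact (2 * j) * sigma_N_sq \<alpha> N ^ (2 * j - 1) * (1 / ?r N)\<^sup>2"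
  have "(\<lambda>N. \<Sum>j=1..m. ?R j N) \<longlonglongrightarrow> (\<Sum>j=1..m. 0)"
  proof (rule tendsto_sum)
    fix j
    have "(\<lambda>N. 1 / 4 * fact (2 * j) * sigma_N_sq \<alpha> N * (1 / ?r N) ^ 6) \<longlonglongrightarrow> 1 / 4 * fact (2 * j) * sigma_sq \<alpha> * 0 ^ 6"
      "(\<lambda>N. (abar_N \<alpha> V N j)\<^sup>2 * fact (2 * j) * sigma_N_sq \<alpha> N ^ (2 * j - 1) * (1 / ?r N)\<^sup>2) \<longlonglongrightarrow>
        (abar \<alpha> V j)\<^sup>2 * fact (2 * j) * sigma_sq \<alpha> ^ (2 * j - 1) * 0\<^sup>2"
      by (intro tendsto_intros sigma_N_sq_tendsto abar_N_tendsto rinv \<alpha>)+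
    then show "?R j \<longlonglongrightarrow> 0" by (cases "j = 1") auto
  qed
  then have "(\<lambda>N. \<Sum>j=1..m. ?R j N) \<longlonglongrightarrow> 0" by simp
  moreover have "\<forall>\<^sub>F N in sequentially. (\<Sum>j=1..m. ?R j N) =
    (\<Sum>j=1..m. (chaos_coeff \<alpha> V N j)\<^sup>2 * fact (2 * j) * sigma_tilde_sq \<alpha> N ^ (2 * j - 1)) / ?r N ^ 8"
    using eventually_ge_at_top[of 1]
  proof eventually_elim
    fix N :: nat assume N: "N \<ge> 1"
    then have r: "?r N > 0" by simp
    have "?R j N = (chaos_coeff \<alpha> V N j)\<^sup>2 * fact (2 * j) * sigma_tilde_sq \<alpha> N ^ (2 * j - 1) / ?r N ^ 8"
      if j: "j \<in> {1..m}" for j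
    proof (cases "j = 1")
      case True
      have "?r N ^ 8 = ?r N ^ 6 * (?r N)\<^sup>2" by (simp flip: power_add)
      then show ?thesis using True r
        by (simp add: chaos_coeff_def powr_scale(3)[OF N, of \<alpha>] power_divide field_simps)
    next
      case False
      then have j2: "j \<ge> 2" using j by auto
      have "(?r N ^ (2 * j - 4))\<^sup>2 * ?r N ^ 8 = ?r N ^ ((2 * j - 4) * 2 + 8)" by (simp only: power_mult power_add)
      also have "(2 * j - 4) * 2 + 8 = 2 * (2 * j - 1) + 2" using j2 by simp
      also have "?r N ^ (2 * (2 * j - 1) + 2) = ((?r N)\<^sup>2) ^ (2 * j - 1) * (?r N)\<^sup>2" by (simp only: power_mult power_add)
      finally have "((?r N)\<^sup>2) ^ (2 * j - 1) / ((?r N ^ (2 * j - 4))\<^sup>2 * ?r N ^ 8) = (1 / ?r N)\<^sup>2"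
        using r by (simp add: power_divide)
      then have "(1 / ?r N)\<^sup>2 = ((?r N)\<^sup>2) ^ (2 * j - 1) / ((?r N ^ (2 * j - 4))\<^sup>2 * ?r N ^ 8)" by simp
      moreover have "chaos_coeff \<alpha> V N j = abar_N \<alpha> V N j * (1 / ?r N ^ (2 * j - 4))"
        unfolding chaos_coeff_def powr_scale(2)[OF N j2] using False by simp
      ultimately show ?thesis using False
        by (simp add: powr_scale(3)[OF N, of \<alpha>] power_divide power_mult_distrib)
    qed
    then show "(\<Sum>j=1..m. ?R j N) =
      (\<Sum>j=1..m. (chaos_coeff \<alpha> V N j)\<^sup>2 * fact (2 * j) * sigma_tilde_sq \<alpha> N ^ (2 * j - 1)) / ?r N ^ 8"
      unfolding sum_divide_distrib by (rule sum.cong[OF refl])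
  qed
  ultimately show ?thesis by (rule Lim_transform_eventually)
qed

theorem proposition1p12:
  fixes \<alpha> :: real and a :: "nat \<Rightarrow> real" and m :: nat and V :: "real poly"
    and P :: "'w measure" and g :: "int \<times> int \<Rightarrow> 'w \<Rightarrow> complex"
    and \<Phi> :: "'w \<Rightarrow> (real \<times> real \<Rightarrow> real) \<Rightarrow> real"
    and \<mu> :: "((real \<times> real \<Rightarrow> real) \<Rightarrow> real) measure"
  assumes "prob_space P"
    and "gaussian_coefficients P g"
    and "is_gaussian_field \<alpha> P g \<Phi>"
    and "\<mu> = distr P distribution_space \<Phi>"
    and "3 / 4 < \<alpha>" and "\<alpha> < 1"
    and "\<And>z. poly V z = (\<Sum>j\<le>m. a j * z ^ (2 * j))"
    and "2 * m \<ge> 4" and "a m > 0"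
    and "abar \<alpha> V 1 = 0"
    and "\<exists>\<theta>::real. (\<Sum>j=2..m. abar \<alpha> V j * \<theta> ^ (2 * (j - 2))) < 0"
  shows "(\<exists>c>0. \<forall>N\<ge>1. ln (partition_fn \<alpha> V m \<mu> N) > c * real N powr (4 * (1 - \<alpha>))) \<and>
         (\<forall>N\<ge>1. AE u in \<mu>. RN_deriv \<mu> (gibbs_measure \<alpha> V m \<mu> N) u
                            = ennreal (gibbs_density \<alpha> V m \<mu> N u)) \<and>
         \<not> converges_in_L1 \<mu> (gibbs_density \<alpha> V m \<mu>)"
proof -
  interpret gaussian_field_coefficients P g
    using assms(1,2) by (simp add: gaussian_field_coefficients_def gaussian_field_coefficients_axioms_def)
  have \<alpha>: "0 < \<alpha>" "\<alpha> < 1" and m: "m \<ge> 1" "m \<ge> 2" using assms by auto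
  have \<Phi> [measurable]: "\<Phi> \<in> measurable P distribution_space"
    using assms(3) by (simp add: is_gaussian_field_def)
  have \<mu>: "prob_space \<mu>" unfolding assms(4) by (rule prob_space_distr) (rule \<Phi>)
  interpret \<mu>: prob_space \<mu> by fact

  \<comment> \<open>Transfer from distributions to the Gaussian coefficients\<close>
  let ?r = "\<lambda>N. real N powr (1 - \<alpha>)"
  define p where "p N = even_chaos (chaos_coeff \<alpha> V N) m (sigma_tilde_sq \<alpha> N)" for N
  define X where "X N = energy \<alpha> (p N) N" for N
  have X_measurable [measurable]: "X N \<in> borel_measurable P" for N
    unfolding X_def by (rule energy_measurable)
  have weight_eq: "gibbs_weight \<alpha> V m N = (\<lambda>u. exp (- (LINT x:torus|lborel. poly (p N) (fourier_proj N u x))))" for N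
    unfolding gibbs_weight_def [abs_def] p_def V_tilde_eq_even_chaos[OF m(1)] ..
  have weight_meas': "gibbs_weight \<alpha> V m N \<in> borel_measurable distribution_space" for N
    unfolding weight_eq by (rule exp_integral_fourier_proj_measurable)
  then have weight_meas [measurable]: "gibbs_weight \<alpha> V m N \<in> borel_measurable \<mu>" for N
    by (simp add: assms(4))
  \<comment> \<open>This identity lets every integral against \<open>\<mu>\<close> be computed on P
    from the coefficients g.\<close>
  have weight_X: "AE \<omega> in P. \<forall>N. gibbs_weight \<alpha> V m N (\<Phi> \<omega>) = exp (- X N \<omega>)"
    using fourier_proj_gaussian_field[OF assms(3)]
    by eventually_elim (simp add: weight_eq X_def energy_def field_def integral_torus_measure del: split_paired_All)
  have Z: "partition_fn \<alpha> V m \<mu> N = (\<integral>\<omega>. exp (- X N \<omega>) \<partial>P)" for N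
  proof -
    have "partition_fn \<alpha> V m \<mu> N = (\<integral>\<omega>. gibbs_weight \<alpha> V m N (\<Phi> \<omega>) \<partial>P)"
      unfolding partition_fn_def assms(4) by (rule integral_distr[OF \<Phi> weight_meas'])
    also have "\<dots> = (\<integral>\<omega>. exp (- X N \<omega>) \<partial>P)"
      using weight_X weight_meas' by (intro integral_cong_AE) (auto elim: eventually_mono)
    finally show ?thesis .
  qed

  \<comment> \<open>Lower bound for the logarithm of the partition function\<close>
  have lower: "\<exists>C. \<forall>y. - C \<le> poly (p N) y" if N: "N \<ge> 1" for N
  proof -
    have "chaos_coeff \<alpha> V N m > 0"
      using m N assms(9) abar_N_top[OF assms(7) N, of \<alpha>] by (simp add: chaos_coeff_def)
    then show ?thesis unfolding p_def by (metis even_chaos_bounded_below m(1))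
  qed
  have int_X: "integrable P (\<lambda>\<omega>. exp (- X N \<omega>))" if "N \<ge> 1" for N
  proof -
    from lower[OF that] obtain C where "\<And>y. - C \<le> poly (p N) y" by blast
    then show ?thesis unfolding X_def p_def by (rule integrable_exp_energy)
  qed
  have Z_gt_1: "partition_fn \<alpha> V m \<mu> N > 1" if "N \<ge> 1" for N
  proof -
    from lower[OF that] obtain C where "\<And>y. - C \<le> poly (p N) y" by blast
    then show ?thesis unfolding Z X_def p_def
      by (rule partition_gt_1) (simp add: chaos_coeff_def, rule m(1))
  qed
  have ln_Z_ge: "- (4 * pi\<^sup>2) * (\<Sum>j=2..m. abar_N \<alpha> V N j * \<theta> ^ (2 * j)) * real N powr (4 * (1 - \<alpha>))
      \<le> ln (partition_fn \<alpha> V m \<mu> N)" if N: "N \<ge> 1" for N \<theta>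
  proof -
    from lower[OF that] obtain C where "\<And>y. - C \<le> poly (p N) y" by blast
    then have "- (4 * pi\<^sup>2) * (\<Sum>j=1..m. chaos_coeff \<alpha> V N j * (\<theta> * ?r N) ^ (2 * j)) - 2 * pi\<^sup>2 * (\<theta> * ?r N)\<^sup>2
      \<le> ln (partition_fn \<alpha> V m \<mu> N)"
      unfolding Z X_def p_def by (rule ln_partition_ge)
    then show ?thesis
      unfolding sum_chaos_coeff_power[OF m(1) N] powr_scale(1)[OF N] by (simp add: algebra_simps)
  qed
  \<comment> \<open>The hypothesis may be given at theta = 0, where \<open>0 ^ 0 = 1\<close> leaves
    the term j = 2, but a zero shift gains nothing: the exponent S carries the factor theta^4. The
    condition is open, so a nearby nonzero theta serves.\<close>
  obtain \<theta> where \<theta>: "\<theta> \<noteq> 0" "(\<Sum>j=2..m. abar \<alpha> V j * \<theta> ^ (2 * (j - 2))) < 0"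
  proof -
    let ?f = "\<lambda>\<theta>. \<Sum>j=2..m. abar \<alpha> V j * \<theta> ^ (2 * (j - 2))"
    obtain \<theta>0 where \<theta>0: "?f \<theta>0 < 0" using assms(11) by blast
    have "?f \<midarrow>\<theta>0\<rightarrow> ?f \<theta>0" by (intro tendsto_intros)
    then have "\<forall>\<^sub>F \<theta> in at \<theta>0. ?f \<theta> < 0" using \<theta>0 by (rule order_tendstoD)
    moreover have "\<forall>\<^sub>F \<theta> in at \<theta>0. \<theta> \<noteq> 0" by (rule eventually_neq_at_within)
    ultimately have "\<forall>\<^sub>F \<theta> in at \<theta>0. \<theta> \<noteq> 0 \<and> ?f \<theta> < 0" by eventually_elim simp
    then show thesis using that eventually_happens[of _ "at \<theta>0"] by auto
  qed
  define S where "S = (\<Sum>j=2..m. abar \<alpha> V j * \<theta> ^ (2 * j))"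
  have "S = \<theta> ^ 4 * (\<Sum>j=2..m. abar \<alpha> V j * \<theta> ^ (2 * (j - 2)))"
    unfolding S_def sum_distrib_left
  proof (rule sum.cong[OF refl])
    fix j assume "j \<in> {2..m}"
    then have "2 \<le> j" by simp
    then have "2 * j = 4 + 2 * (j - 2)" by arith
    then have "\<theta> ^ (2 * j) = \<theta> ^ 4 * \<theta> ^ (2 * (j - 2))" by (metis power_add)
    then show "abar \<alpha> V j * \<theta> ^ (2 * j) = \<theta> ^ 4 * (abar \<alpha> V j * \<theta> ^ (2 * (j - 2)))" by simp
  qed
  then have S: "S < 0" using \<theta> by (simp add: mult_pos_neg)
  have "(\<lambda>N. \<Sum>j=2..m. abar_N \<alpha> V N j * \<theta> ^ (2 * j)) \<longlonglongrightarrow> S"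
    unfolding S_def by (intro tendsto_intros abar_N_tendsto \<alpha>)
  then have "\<forall>\<^sub>F N in sequentially. (\<Sum>j=2..m. abar_N \<alpha> V N j * \<theta> ^ (2 * j)) < S / 2"
    using S by (intro order_tendstoD) auto
  \<comment> \<open>Half of the limit S is given up for the convergence of the coefficients, and 4
    pi^2 (- S / 2) = - 2 pi^2 S.\<close>
  then have "\<forall>\<^sub>F N in sequentially. ln (partition_fn \<alpha> V m \<mu> N) > (- 2 * pi\<^sup>2 * S) * real N powr (4 * (1 - \<alpha>))"
    using eventually_ge_at_top[of 1]
  proof eventually_elim
    fix N :: nat assume *: "(\<Sum>j=2..m. abar_N \<alpha> V N j * \<theta> ^ (2 * j)) < S / 2" and N: "N \<ge> 1"
    have "(- 2 * pi\<^sup>2 * S) * real N powr (4 * (1 - \<alpha>)) <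
      - (4 * pi\<^sup>2) * (\<Sum>j=2..m. abar_N \<alpha> V N j * \<theta> ^ (2 * j)) * real N powr (4 * (1 - \<alpha>))"
      using * N by (intro mult_strict_right_mono) (simp_all add: field_simps)
    also note ln_Z_ge[OF N]
    finally show "(- 2 * pi\<^sup>2 * S) * real N powr (4 * (1 - \<alpha>)) < ln (partition_fn \<alpha> V m \<mu> N)" .
  qed
  \<comment> \<open>At the finitely many small N the positivity of the logarithm comes from
    \<open>Z_gt_1\<close>.\<close>
  then have part1: "\<exists>c>0. \<forall>N\<ge>1. ln (partition_fn \<alpha> V m \<mu> N) > c * real N powr (4 * (1 - \<alpha>))"
    using ln_gt_zero[OF Z_gt_1] S
    by (intro uniform_linear_lower_bound[where d = "- 2 * pi\<^sup>2 * S"]) (auto simp: mult_less_0_iff)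
  have density_meas [measurable]: "gibbs_density \<alpha> V m \<mu> N \<in> borel_measurable \<mu>" for N
    unfolding gibbs_density_def [abs_def] by measurable
  have part2: "AE u in \<mu>. RN_deriv \<mu> (gibbs_measure \<alpha> V m \<mu> N) u = ennreal (gibbs_density \<alpha> V m \<mu> N u)" for N
  proof -
    have "AE u in \<mu>. ennreal (gibbs_density \<alpha> V m \<mu> N u) = RN_deriv \<mu> (gibbs_measure \<alpha> V m \<mu> N) u"
      by (rule \<mu>.RN_deriv_unique) (simp_all add: gibbs_measure_def)
    then show ?thesis by eventually_elim simp
  qed
  obtain c where c: "c > 0" and ln_Z: "\<And>N. N \<ge> 1 \<Longrightarrow> ln (partition_fn \<alpha> V m \<mu> N) > c * ?r N ^ 4"
  proof -
    obtain c where "c > 0" and *: "\<And>N. N \<ge> 1 \<Longrightarrow> ln (partition_fn \<alpha> V m \<mu> N) > c * real N powr (4 * (1 - \<alpha>))"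
      using part1 by blast
    have "ln (partition_fn \<alpha> V m \<mu> N) > c * ?r N ^ 4" if "N \<ge> 1" for N
      using *[OF that] unfolding powr_scale(1)[OF that] .
    then show thesis by (rule that[OF \<open>c > 0\<close>])
  qed

  \<comment> \<open>Vanishing of the truncated densities in mean\<close>
  have density_int: "integrable \<mu> (gibbs_density \<alpha> V m \<mu> N)" if N: "N \<ge> 1" for N
  proof -
    have "integrable P (\<lambda>\<omega>. gibbs_weight \<alpha> V m N (\<Phi> \<omega>)) \<longleftrightarrow> integrable P (\<lambda>\<omega>. exp (- X N \<omega>))"
      using weight_X weight_meas' by (intro integrable_cong_AE) (auto elim: eventually_mono)
    then have "integrable \<mu> (gibbs_weight \<alpha> V m N)"
      unfolding assms(4) using int_X[OF N] by (simp add: integrable_distr_eq[OF \<Phi> weight_meas'])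
    then show ?thesis unfolding gibbs_density_def [abs_def] by simp
  qed
  have density_one: "(\<integral>u. gibbs_density \<alpha> V m \<mu> N u \<partial>\<mu>) = 1" if N: "N \<ge> 1" for N
    using Z_gt_1[OF N] unfolding gibbs_density_def by (simp flip: partition_fn_def)
  have density_nonneg: "gibbs_density \<alpha> V m \<mu> N u \<ge> 0" for N u
  proof -
    have "partition_fn \<alpha> V m \<mu> N \<ge> 0" unfolding Z by (rule Bochner_Integration.integral_nonneg) simp
    then show ?thesis by (simp add: gibbs_density_def gibbs_weight_def)
  qed
  define q where "q N = 4 * pi\<^sup>2 * (\<Sum>j=1..m. (chaos_coeff \<alpha> V N j)\<^sup>2 * fact (2 * j) * sigma_tilde_sq \<alpha> N ^ (2 * j - 1))" for N
  have X_sq: "integrable P (\<lambda>\<omega>. (X N \<omega>)\<^sup>2)" "(\<integral>\<omega>. (X N \<omega>)\<^sup>2 \<partial>P) \<le> q N" for N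
    unfolding X_def p_def q_def by (rule integrable_energy_sq, rule integral_energy_sq_le)
  have vanish_le: "(\<integral>u. min (gibbs_density \<alpha> V m \<mu> N u) 1 \<partial>\<mu>) \<le> 2 / (c * ?r N ^ 4) + 4 / c\<^sup>2 * (q N / ?r N ^ 8)"
    if N: "N \<ge> 1" for N
  proof -
    define L where "L = c * ?r N ^ 4"
    have L: "L > 0" using c N by (simp add: L_def)
    have Zpos: "partition_fn \<alpha> V m \<mu> N > 0" using Z_gt_1[OF N] by simp
    \<comment> \<open>L is a lower bound for ln Z. If |x| <= L / 2, the density is at most exp (- L
      / 2) <= 2 / L; otherwise 1 <= 4 x^2 / L^2, as in Chebyshev's inequality.\<close>
    have pointwise: "min (inverse (partition_fn \<alpha> V m \<mu> N) * exp (- x)) 1 \<le> 2 / L + 4 / L\<^sup>2 * x\<^sup>2" for x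
    proof (cases "\<bar>x\<bar> \<le> L / 2")
      case True
      have "inverse (partition_fn \<alpha> V m \<mu> N) = exp (- ln (partition_fn \<alpha> V m \<mu> N))"
        using Zpos by (simp add: exp_minus)
      then have "inverse (partition_fn \<alpha> V m \<mu> N) * exp (- x) = exp (- ln (partition_fn \<alpha> V m \<mu> N) - x)"
        by (simp add: mult_exp_exp)
      also have "\<dots> \<le> exp (- L / 2)" using ln_Z[OF N] True by (simp add: L_def)
      also have "\<dots> \<le> 2 / L"
      proof -
        have "L / 2 \<le> exp (L / 2)" using exp_ge_add_one_self[of "L / 2"] by linarith
        then have "inverse (exp (L / 2)) \<le> inverse (L / 2)" using L by (intro le_imp_inverse_le) auto
        then show ?thesis by (simp add: exp_minus)
      qed
      finally show ?thesis by (intro min.coboundedI1) (simp add: add_increasing2)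
    next
      case False
      then have "(L / 2)\<^sup>2 \<le> \<bar>x\<bar>\<^sup>2" using L by (intro power_mono) auto
      then have "1 \<le> 4 / L\<^sup>2 * x\<^sup>2" using L by (simp add: power_divide field_simps)
      then show ?thesis using L by (intro min.coboundedI2 add_increasing) auto
    qed
    have "(\<integral>u. min (gibbs_density \<alpha> V m \<mu> N u) 1 \<partial>\<mu>) = (\<integral>\<omega>. min (gibbs_density \<alpha> V m \<mu> N (\<Phi> \<omega>)) 1 \<partial>P)"
      using density_meas[of N] unfolding assms(4) by (intro integral_distr) (simp_all add: assms(4))
    also have "\<dots> = (\<integral>\<omega>. min (inverse (partition_fn \<alpha> V m \<mu> N) * exp (- X N \<omega>)) 1 \<partial>P)"
      using weight_X measurable_compose[OF \<Phi> weight_meas']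
      by (intro integral_cong_AE) (auto simp: gibbs_density_def elim: eventually_mono)
    also have "\<dots> \<le> (\<integral>\<omega>. 2 / L + 4 / L\<^sup>2 * (X N \<omega>)\<^sup>2 \<partial>P)"
      using int_X[OF N] X_sq[of N] by (intro integral_mono pointwise integrable_min) auto
    also have "\<dots> = 2 / L + 4 / L\<^sup>2 * (\<integral>\<omega>. (X N \<omega>)\<^sup>2 \<partial>P)"
      using X_sq[of N] by (simp add: prob_space)
    also have "\<dots> \<le> 2 / L + 4 / L\<^sup>2 * q N"
      using X_sq[of N] L by (intro add_left_mono mult_left_mono) auto
    also have "\<dots> = 2 / L + 4 / c\<^sup>2 * (q N / ?r N ^ 8)"
      by (simp add: L_def power_mult_distrib flip: power_mult)
    finally show ?thesis unfolding L_def .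
  qed
  have vanish: "(\<lambda>N. \<integral>u. min (gibbs_density \<alpha> V m \<mu> N u) 1 \<partial>\<mu>) \<longlonglongrightarrow> 0"
  proof (rule tendsto_sandwich[where f = "\<lambda>_. 0"])
    have "(\<lambda>N. 4 * pi\<^sup>2 * ((\<Sum>j=1..m. (chaos_coeff \<alpha> V N j)\<^sup>2 * fact (2 * j) * sigma_tilde_sq \<alpha> N ^ (2 * j - 1)) / ?r N ^ 8))
      \<longlonglongrightarrow> 4 * pi\<^sup>2 * 0"
      by (intro tendsto_intros chaos_coeff_sq_sum_tendsto \<alpha> m)
    then have "(\<lambda>N. q N / ?r N ^ 8) \<longlonglongrightarrow> 0" by (simp add: q_def)
    from tendsto_mult_left[OF this, of "4 / c\<^sup>2"]
    have second: "(\<lambda>N. 4 / c\<^sup>2 * (q N / ?r N ^ 8)) \<longlonglongrightarrow> 0" by (simp only: mult_zero_right)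
    have "(\<lambda>N. 2 / c * (1 / ?r N) ^ 4) \<longlonglongrightarrow> 2 / c * 0 ^ 4"
      by (intro tendsto_intros inverse_scale_tendsto \<alpha>)
    then have "(\<lambda>N. 2 / (c * ?r N ^ 4)) \<longlonglongrightarrow> 0" by (simp add: power_divide)
    from tendsto_add[OF this second] show "(\<lambda>N. 2 / (c * ?r N ^ 4) + 4 / c\<^sup>2 * (q N / ?r N ^ 8)) \<longlonglongrightarrow> 0"
      by (simp only: add_0_left)
    show "\<forall>\<^sub>F N in sequentially. (\<integral>u. min (gibbs_density \<alpha> V m \<mu> N u) 1 \<partial>\<mu>) \<le>
      2 / (c * ?r N ^ 4) + 4 / c\<^sup>2 * (q N / ?r N ^ 8)"
      using eventually_ge_at_top[of 1] by eventually_elim (rule vanish_le)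
    show "\<forall>\<^sub>F N in sequentially. 0 \<le> (\<integral>u. min (gibbs_density \<alpha> V m \<mu> N u) 1 \<partial>\<mu>)"
      using density_nonneg by (intro always_eventually allI Bochner_Integration.integral_nonneg) simp
  qed (rule tendsto_const)
  have "\<not> converges_in_L1 \<mu> (gibbs_density \<alpha> V m \<mu>)"
    by (rule not_converges_in_L1I[OF density_int density_one density_nonneg vanish \<mu>.finite_measure_axioms])
  with part1 part2 show ?thesis by blast
qed

end
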